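(* Let $(\Sigma^{\infty,+}_{(L)},\sigma_\infty)$ be an NSFT given by alphabets $(\mathcal{A}_i)_{i\ge0}$ and matrices $(L_i)_{i\ge0}$ satisfying (A1), (A2), (A3) of the context, with $\Sigma^{0,+}_{(L)}$ infinite, and let $\mu_\infty$ be an associated Parry IMS, with corresponding probability vectors $\pi_i$. (i) We have $$h(\sigma_\infty,\mu_\infty)=\lim_{\varepsilon\searrow0}\limsup_{k\to\infty}\frac1k\sum_{\beta}(\pi_{\widetilde n_k(\varepsilon)})_\beta\log\sum_\alpha L^{(0,\widetilde n_k(\varepsilon))}_{\alpha\beta}.$$ (ii) The following condition is sufficient for the equality of $h(\sigma_\infty,\mu_\infty)$ and $h_{\mathrm{top}}(\sigma_\infty)$: for every $\delta\in(0,1)$ there exist $\varepsilon>0$ and $k_0\in\mathbb{N}$ such that for all $k\ge k_0$ and each $\gamma\in\mathcal{A}_k$ which maximizes $\sum_\alpha L^{(0,k)}_{\alpha\gamma}$, the inequality $L^{(k,n_k(\varepsilon))}_{\gamma\beta}\ge1$ holds for all $\beta$ in a set $B\subset\mathcal{A}_{n_k(\varepsilon)}$ satisfying $\sum_{\beta\in B}(\pi_{n_k(\varepsilon)})_\beta\ge1-\delta$.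
   Context: NSFT. Let $\mathcal{A}_i=\{1,\dots,l_i\}$, $i\ge0$, be finite alphabets and $L_i$ a $0$-$1$-matrix of dimension $l_i\times l_{i+1}$. For $n>k$ put $L^{(k,n)}:=L_kL_{k+1}\cdots L_{n-1}$, and let $L^{(k,k)}$ be the identity matrix. Standing assumptions: (A1) no row or column of any $L_i$ is identically zero; (A2) $(l_i)$ is bounded; (A3) $(L_i)$ is primitive: for each $i\ge0$ there is $n>i$ such that all entries of $L^{(i,n)}$ are strictly positive. For $n\le m$ let $w(n,m)$ be the number of words $(x_n,\dots,x_m)$ with $x_i\in\mathcal{A}_i$ and $(L_i)_{x_ix_{i+1}}=1$ for $n\le i\le m-1$. "$\gamma$ maximizes $\sum_\alpha L^{(0,k)}_{\alpha\gamma}$" means $\sum_\alpha L^{(0,k)}_{\alpha\gamma}=\max_{\beta\in\mathcal{A}_k}\sum_\alpha L^{(0,k)}_{\alpha\beta}$. $\Sigma^{k,+}_{(L)}:=\{(x_k,x_{k+1},\dots):x_i\in\mathcal{A}_i,\ (L_i)_{x_ix_{i+1}}=1\ \forall i\ge k\}$, with metric $d_k(x,y)=0$ if $x=y$, $1$ if $x_k\ne y_k$, and $w(k,l)^{-1}$ if $x\ne y$, $x_k=y_k$, $l=\max\{r\ge k:x_i=y_i,\ i=k,\dots,r\}$. $\sigma_k:\Sigma^{k,+}_{(L)}\to\Sigma^{k+1,+}_{(L)}$ is the left shift. The spaces are compact and $\sigma_\infty=(\sigma_k)_{k\ge0}$ is equicontinuous. For $\varepsilon>0$ and $k\ge0$: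 $m_k(\varepsilon):=\min\{m\ge0:w(k,k+m)>1/\varepsilon\}$ (which exists for all $k,\varepsilon$ when $\Sigma^{0,+}_{(L)}$ is infinite), $n_k(\varepsilon):=k+m_k(\varepsilon)$, $\widetilde n_k(\varepsilon):=\max_{0\le i\le k}(i+m_i(\varepsilon))$. Parry IMS. By (A1)–(A3) there exist sequences $(\widehat{\mathbf w}_i)_{i\ge0}$ of column vectors $\widehat{\mathbf w}_i\in\mathbb{R}^{l_i}$ with strictly positive entries and $\widehat{\mathbf w}_i=L_i\widehat{\mathbf w}_{i+1}$, and sequences $(\widehat{\mathbf v}_i^t)_{i\ge0}$ of row vectors with strictly positive entries and $\widehat{\mathbf v}_i^tL_i=\widehat{\mathbf v}_{i+1}^t$. For any choice of these, with $\|\mathbf w\|=\sum_\alpha|\mathbf w_\alpha|$, put $\mathbf w_i:=\widehat{\mathbf w}_i/\|\widehat{\mathbf w}_i\|$, $\mathbf v_i^t:=\widehat{\mathbf v}_i^t/(\widehat{\mathbf v}_i^t\mathbf w_i)$, $\lambda_i:=\|\widehat{\mathbf w}_i\|/\|\widehat{\mathbf w}_{i+1}\|$ (so $L_i\mathbf w_{i+1}=\lambda_i\mathbf w_i$, $\mathbf v_i^tL_i=\lambda_i\mathbf v_{i+1}^t$), $\lambda^{(k,m)}:=\prod_{i=k}^{m-1}\lambda_i$ for $k<m$, $\lambda^{(k,k)}:=1$, and $(\pi_i)_\alpha:=(\mathbf v_i)_\alpha(\mathbf w_i)_\alpha$ for $\alpha\in\mathcal{A}_i$ (a probability vector). The associated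 Parry IMS $\mu_\infty=(\mu_k)_{k\ge0}$ consists of the Borel probability measures $\mu_k$ on $\Sigma^{k,+}_{(L)}$ determined on cylinder sets $[.x_k\dots x_m]=\{y\in\Sigma^{k,+}_{(L)}:y_i=x_i,\ i=k,\dots,m\}$ of admissible words by $\mu_k([.x_k\dots x_m])=\frac1{\lambda^{(k,m)}}(\mathbf v_k^t)_{x_k}(\mathbf w_m)_{x_m}$; it satisfies $\sigma_k\mu_k=\mu_{k+1}$. The theorem is about any measure sequence so obtained. Entropies. For an equicontinuous sequence $f_n:X_n\to X_{n+1}$ of maps between compact metric spaces $(X_n,d_n)$, put $f_0^n=f_{n-1}\circ\cdots\circ f_0$, $f_0^0=\mathrm{id}$, $f_0^{-n}=(f_0^n)^{-1}$. For Borel probability measures $\mu_n$ on $X_n$ with $f_n\mu_n=\mu_{n+1}$ (an IMS), a sequence $\mathcal{P}_\infty=(\mathcal{P}_n)$ of finite Borel partitions $\mathcal{P}_n=\{P_{n,1},\dots,P_{n,k_n}\}$ of $X_n$ is admissible, $\mathcal{P}_\infty\in\mathcal{E}_{\mathrm M}(\mu_\infty)$, iff $(k_n)$ is bounded and for each $\varepsilon>0$ there are $\delta>0$ and compact (possibly empty) $K_{n,i}\subset P_{n,i}$ such that for all $n$: $\mu_n(P_{n,i}\setminus K_{n,i})\le\varepsilon$ for all $i$, and $d_n(x,y)\ge\delta$ for all $x\in K_{n,i}$, $y\in K_{n,j}$, $i\ne j$. The metric entropy is $h(f_\infty,\mu_\infty):=\sup_{\mathcal{P}_\infty\in\mathcal{E}_{\mathrm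 M}(\mu_\infty)}\limsup_{n\to\infty}\frac1nH_{\mu_0}\big(\bigvee_{i=0}^{n-1}f_0^{-i}\mathcal{P}_i\big)$, where $H_\mu(\mathcal{P})=-\sum_{P\in\mathcal P}\mu(P)\log\mu(P)$. The topological entropy is $h_{\mathrm{top}}(f_\infty):=\sup_{\mathcal{U}_\infty}\limsup_{n\to\infty}\frac1n\log\mathcal{N}\big(\bigvee_{i=0}^{n-1}f_0^{-i}\mathcal{U}_i\big)$, the supremum over all sequences of open covers $\mathcal{U}_n$ of $X_n$ with Lebesgue numbers bounded away from zero, $\mathcal{N}$ being the minimal cardinality of a subcover. *)

theory Defs
  imports "HOL-Probability.Probability"
begin

section \<open>Entropy of nonautonomous systems\<close>

text \<open>
  A system is given by carriers \<open>X n\<close>, metrics \<open>d n\<close> on \<open>X n\<close> and maps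
  \<open>f n\<close> from \<open>X n\<close> to \<open>X (Suc n)\<close>. All carriers are subsets of one type.
\<close>

abbreviation mtop :: "'a set \<Rightarrow> ('a \<Rightarrow> 'a \<Rightarrow> real) \<Rightarrow> 'a topology" where
  "mtop X d \<equiv> Metric_space.mtopology X d"

definition mborel :: "'a set \<Rightarrow> ('a \<Rightarrow> 'a \<Rightarrow> real) \<Rightarrow> 'a measure" where
  "mborel X d = sigma X {U. openin (mtop X d) U}"

primrec iterate :: "(nat \<Rightarrow> 'a \<Rightarrow> 'a) \<Rightarrow> nat \<Rightarrow> 'a \<Rightarrow> 'a" where
  "iterate f 0 = id"
| "iterate f (Suc n) = f n \<circ> iterate f n"

text \<open>The join of the pulled back families \<open>f\<^sub>0\<^sup>-\<^sup>i (C i)\<close>, \<open>i < n\<close>. It may contain the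
  empty set, which affects neither \<open>part_entropy\<close> nor \<open>min_subcover\<close>.\<close>

definition join_upto ::
  "(nat \<Rightarrow> 'a set) \<Rightarrow> (nat \<Rightarrow> 'a \<Rightarrow> 'a) \<Rightarrow> (nat \<Rightarrow> 'a set set) \<Rightarrow> nat \<Rightarrow> 'a set set" where
  "join_upto X f C n =
     {{x \<in> X 0. \<forall>i<n. iterate f i x \<in> Q i} | Q. \<forall>i<n. Q i \<in> C i}"

text \<open>The convention \<open>0 * log 0 = 0\<close> is the library's \<open>0 * ln 0 = 0\<close>.\<close>

definition part_entropy :: "'a measure \<Rightarrow> 'a set set \<Rightarrow> real" where
  "part_entropy M C = - (\<Sum>P\<in>C. measure M P * ln (measure M P))"

definition admissible ::
  "(nat \<Rightarrow> 'a set) \<Rightarrow> (nat \<Rightarrow> 'a \<Rightarrow> 'a \<Rightarrow> real) \<Rightarrow> (nat \<Rightarrow> 'a measure) \<Rightarrow> (nat \<Rightarrow> 'a set set) \<Rightarrow> bool"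
  where
  "admissible X d \<mu> \<P> \<longleftrightarrow>
     (\<forall>n. finite (\<P> n) \<and> partition_on (X n) (\<P> n) \<and> \<P> n \<subseteq> sets (mborel (X n) (d n))) \<and>
     (\<exists>b. \<forall>n. card (\<P> n) \<le> b) \<and>
     (\<forall>\<epsilon>>0. \<exists>\<delta>>0. \<exists>K :: nat \<Rightarrow> 'a set \<Rightarrow> 'a set. \<forall>n.
        (\<forall>P\<in>\<P> n. compactin (mtop (X n) (d n)) (K n P) \<and> K n P \<subseteq> P \<and>
                  measure (\<mu> n) (P - K n P) \<le> \<epsilon>) \<and>
        (\<forall>P\<in>\<P> n. \<forall>P'\<in>\<P> n. P \<noteq> P' \<longrightarrow>
           (\<forall>x\<in>K n P. \<forall>y\<in>K n P'. d n x y \<ge> \<delta>)))"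

definition metric_entropy ::
  "(nat \<Rightarrow> 'a set) \<Rightarrow> (nat \<Rightarrow> 'a \<Rightarrow> 'a \<Rightarrow> real) \<Rightarrow> (nat \<Rightarrow> 'a \<Rightarrow> 'a) \<Rightarrow> (nat \<Rightarrow> 'a measure) \<Rightarrow> ereal"
  where
  "metric_entropy X d f \<mu> =
     (SUP \<P>\<in>{\<P>. admissible X d \<mu> \<P>}.
        limsup (\<lambda>n. ereal (part_entropy (\<mu> 0) (join_upto X f \<P> n) / real n)))"

definition min_subcover :: "'a set \<Rightarrow> 'a set set \<Rightarrow> nat" where
  "min_subcover X C = (LEAST n. \<exists>D\<subseteq>C. finite D \<and> X \<subseteq> \<Union>D \<and> card D = n)"

text \<open>\<open>\<delta>\<close> is a Lebesgue number of a cover if every ball of radius \<open>\<delta>\<close> lies in a member.\<close>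

definition lebesgue_covers ::
  "(nat \<Rightarrow> 'a set) \<Rightarrow> (nat \<Rightarrow> 'a \<Rightarrow> 'a \<Rightarrow> real) \<Rightarrow> (nat \<Rightarrow> 'a set set) \<Rightarrow> bool" where
  "lebesgue_covers X d \<U> \<longleftrightarrow>
     (\<forall>n. (\<forall>U\<in>\<U> n. openin (mtop (X n) (d n)) U) \<and> \<Union>(\<U> n) = X n) \<and>
     (\<exists>\<delta>>0. \<forall>n. \<forall>x\<in>X n. \<exists>U\<in>\<U> n. Metric_space.mball (X n) (d n) x \<delta> \<subseteq> U)"

definition top_entropy ::
  "(nat \<Rightarrow> 'a set) \<Rightarrow> (nat \<Rightarrow> 'a \<Rightarrow> 'a \<Rightarrow> real) \<Rightarrow> (nat \<Rightarrow> 'a \<Rightarrow> 'a) \<Rightarrow> ereal" where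
  "top_entropy X d f =
     (SUP \<U>\<in>{\<U>. lebesgue_covers X d \<U>}.
        limsup (\<lambda>n. ereal (ln (real (min_subcover (X 0) (join_upto X f \<U> n))) / real n)))"


section \<open>Nonstationary subshifts of finite type\<close>

text \<open>
  Matrices are functions \<open>L i a b\<close>, relevant only for \<open>a \<in> {1..l i}\<close> and
  \<open>b \<in> {1..l (Suc i)}\<close>. A word or sequence starting at time \<open>k\<close> keeps its time indices:
  it is an extensional function (\<open>undefined\<close> outside \<open>{k..m}\<close>, resp. \<open>{k..}\<close>).
\<close>

definition alph :: "(nat \<Rightarrow> nat) \<Rightarrow> nat \<Rightarrow> nat set" where
  "alph l i = {1..l i}"

text \<open>\<open>Lprod l L k n\<close> is \<open>L\<^sub>k \<cdots> L\<^sub>n\<^sub>-\<^sub>1\<close> for \<open>n > k\<close> and the identity matrix for \<open>n = k\<close>;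
  it is not used for \<open>n < k\<close>.\<close>

primrec Lprod :: "(nat \<Rightarrow> nat) \<Rightarrow> (nat \<Rightarrow> nat \<Rightarrow> nat \<Rightarrow> nat) \<Rightarrow> nat \<Rightarrow> nat \<Rightarrow> nat \<Rightarrow> nat \<Rightarrow> nat" where
  "Lprod l L k 0 a b = (if a = b then 1 else 0)"
| "Lprod l L k (Suc n) a b =
     (if n < k then (if a = b then 1 else 0)
      else (\<Sum>c\<in>alph l n. Lprod l L k n a c * L n c b))"

definition nsft :: "(nat \<Rightarrow> nat) \<Rightarrow> (nat \<Rightarrow> nat \<Rightarrow> nat \<Rightarrow> nat) \<Rightarrow> bool" where
  "nsft l L \<longleftrightarrow>
     (\<forall>i. 1 \<le> l i) \<and>
     (\<forall>i. \<forall>a\<in>alph l i. \<forall>b\<in>alph l (Suc i). L i a b \<in> {0, 1}) \<and>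
     (\<forall>i. \<forall>a\<in>alph l i. \<exists>b\<in>alph l (Suc i). L i a b \<noteq> 0) \<and>
     (\<forall>i. \<forall>b\<in>alph l (Suc i). \<exists>a\<in>alph l i. L i a b \<noteq> 0) \<and>
     (\<exists>c. \<forall>i. l i \<le> c) \<and>
     (\<forall>i. \<exists>n>i. \<forall>a\<in>alph l i. \<forall>b\<in>alph l n. Lprod l L i n a b > 0)"

definition words ::
  "(nat \<Rightarrow> nat) \<Rightarrow> (nat \<Rightarrow> nat \<Rightarrow> nat \<Rightarrow> nat) \<Rightarrow> nat \<Rightarrow> nat \<Rightarrow> (nat \<Rightarrow> nat) set" where
  "words l L n m =
     {x \<in> (\<Pi>\<^sub>E i\<in>{n..m}. alph l i). \<forall>i\<in>{n..<m}. L i (x i) (x (Suc i)) = 1}"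

definition nwords :: "(nat \<Rightarrow> nat) \<Rightarrow> (nat \<Rightarrow> nat \<Rightarrow> nat \<Rightarrow> nat) \<Rightarrow> nat \<Rightarrow> nat \<Rightarrow> nat" where
  "nwords l L n m = card (words l L n m)"

definition Shift_space ::
  "(nat \<Rightarrow> nat) \<Rightarrow> (nat \<Rightarrow> nat \<Rightarrow> nat \<Rightarrow> nat) \<Rightarrow> nat \<Rightarrow> (nat \<Rightarrow> nat) set" where
  "Shift_space l L k =
     {x \<in> (\<Pi>\<^sub>E i\<in>{k..}. alph l i). \<forall>i\<ge>k. L i (x i) (x (Suc i)) = 1}"

definition shift_dist ::
  "(nat \<Rightarrow> nat) \<Rightarrow> (nat \<Rightarrow> nat \<Rightarrow> nat \<Rightarrow> nat) \<Rightarrow> nat \<Rightarrow> (nat \<Rightarrow> nat) \<Rightarrow> (nat \<Rightarrow> nat) \<Rightarrow> real" where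
  "shift_dist l L k x y =
     (if x = y then 0
      else if x k \<noteq> y k then 1
      else 1 / real (nwords l L k (Max {r. k \<le> r \<and> (\<forall>i\<in>{k..r}. x i = y i)})))"

text \<open>As sequences keep their time indices, the left shift just drops the entry at time \<open>k\<close>.\<close>

definition shift_map :: "nat \<Rightarrow> (nat \<Rightarrow> nat) \<Rightarrow> (nat \<Rightarrow> nat)" where
  "shift_map k x = restrict x {Suc k..}"

definition m_fun :: "(nat \<Rightarrow> nat) \<Rightarrow> (nat \<Rightarrow> nat \<Rightarrow> nat \<Rightarrow> nat) \<Rightarrow> nat \<Rightarrow> real \<Rightarrow> nat" where
  "m_fun l L k \<epsilon> = (LEAST m. real (nwords l L k (k + m)) > 1 / \<epsilon>)"

definition n_fun :: "(nat \<Rightarrow> nat) \<Rightarrow> (nat \<Rightarrow> nat \<Rightarrow> nat \<Rightarrow> nat) \<Rightarrow> nat \<Rightarrow> real \<Rightarrow> nat" where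
  "n_fun l L k \<epsilon> = k + m_fun l L k \<epsilon>"

definition ntilde_fun :: "(nat \<Rightarrow> nat) \<Rightarrow> (nat \<Rightarrow> nat \<Rightarrow> nat \<Rightarrow> nat) \<Rightarrow> nat \<Rightarrow> real \<Rightarrow> nat" where
  "ntilde_fun l L k \<epsilon> = Max ((\<lambda>i. i + m_fun l L i \<epsilon>) ` {0..k})"

definition col_sum :: "(nat \<Rightarrow> nat) \<Rightarrow> (nat \<Rightarrow> nat \<Rightarrow> nat \<Rightarrow> nat) \<Rightarrow> nat \<Rightarrow> nat \<Rightarrow> nat" where
  "col_sum l L k \<gamma> = (\<Sum>\<alpha>\<in>alph l 0. Lprod l L 0 k \<alpha> \<gamma>)"

definition maximizes_col_sum ::
  "(nat \<Rightarrow> nat) \<Rightarrow> (nat \<Rightarrow> nat \<Rightarrow> nat \<Rightarrow> nat) \<Rightarrow> nat \<Rightarrow> nat \<Rightarrow> bool" where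
  "maximizes_col_sum l L k \<gamma> \<longleftrightarrow> col_sum l L k \<gamma> = Max (col_sum l L k ` alph l k)"


section \<open>Parry measures\<close>

text \<open>In what follows \<open>wh\<close> and \<open>vh\<close> are the unnormalized sequences of column and row vectors.\<close>

definition parry_vectors ::
  "(nat \<Rightarrow> nat) \<Rightarrow> (nat \<Rightarrow> nat \<Rightarrow> nat \<Rightarrow> nat) \<Rightarrow> (nat \<Rightarrow> nat \<Rightarrow> real) \<Rightarrow> (nat \<Rightarrow> nat \<Rightarrow> real) \<Rightarrow> bool" where
  "parry_vectors l L wh vh \<longleftrightarrow>
     (\<forall>i. \<forall>a\<in>alph l i. wh i a > 0 \<and> vh i a > 0) \<and>
     (\<forall>i. \<forall>a\<in>alph l i. wh i a = (\<Sum>b\<in>alph l (Suc i). real (L i a b) * wh (Suc i) b)) \<and>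
     (\<forall>i. \<forall>b\<in>alph l (Suc i). (\<Sum>a\<in>alph l i. vh i a * real (L i a b)) = vh (Suc i) b)"

definition l1norm :: "(nat \<Rightarrow> nat) \<Rightarrow> (nat \<Rightarrow> nat \<Rightarrow> real) \<Rightarrow> nat \<Rightarrow> real" where
  "l1norm l u i = (\<Sum>a\<in>alph l i. \<bar>u i a\<bar>)"

definition parry_w :: "(nat \<Rightarrow> nat) \<Rightarrow> (nat \<Rightarrow> nat \<Rightarrow> real) \<Rightarrow> nat \<Rightarrow> nat \<Rightarrow> real" where
  "parry_w l wh i a = wh i a / l1norm l wh i"

definition parry_v ::
  "(nat \<Rightarrow> nat) \<Rightarrow> (nat \<Rightarrow> nat \<Rightarrow> real) \<Rightarrow> (nat \<Rightarrow> nat \<Rightarrow> real) \<Rightarrow> nat \<Rightarrow> nat \<Rightarrow> real" where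
  "parry_v l wh vh i a = vh i a / (\<Sum>b\<in>alph l i. vh i b * parry_w l wh i b)"

definition parry_lambda :: "(nat \<Rightarrow> nat) \<Rightarrow> (nat \<Rightarrow> nat \<Rightarrow> real) \<Rightarrow> nat \<Rightarrow> nat \<Rightarrow> real" where
  "parry_lambda l wh k m = (\<Prod>i\<in>{k..<m}. l1norm l wh i / l1norm l wh (Suc i))"

definition parry_pi ::
  "(nat \<Rightarrow> nat) \<Rightarrow> (nat \<Rightarrow> nat \<Rightarrow> real) \<Rightarrow> (nat \<Rightarrow> nat \<Rightarrow> real) \<Rightarrow> nat \<Rightarrow> nat \<Rightarrow> real" where
  "parry_pi l wh vh i a = parry_v l wh vh i a * parry_w l wh i a"

definition cylinder ::
  "(nat \<Rightarrow> nat) \<Rightarrow> (nat \<Rightarrow> nat \<Rightarrow> nat \<Rightarrow> nat) \<Rightarrow> nat \<Rightarrow> nat \<Rightarrow> (nat \<Rightarrow> nat) \<Rightarrow> (nat \<Rightarrow> nat) set" where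
  "cylinder l L k m x = {y \<in> Shift_space l L k. \<forall>i\<in>{k..m}. y i = x i}"

definition parry_ims ::
  "(nat \<Rightarrow> nat) \<Rightarrow> (nat \<Rightarrow> nat \<Rightarrow> nat \<Rightarrow> nat) \<Rightarrow> (nat \<Rightarrow> nat \<Rightarrow> real) \<Rightarrow> (nat \<Rightarrow> nat \<Rightarrow> real) \<Rightarrow>
   (nat \<Rightarrow> (nat \<Rightarrow> nat) measure) \<Rightarrow> bool" where
  "parry_ims l L wh vh \<mu> \<longleftrightarrow>
     parry_vectors l L wh vh \<and>
     (\<forall>k. prob_space (\<mu> k) \<and> space (\<mu> k) = Shift_space l L k \<and>
          sets (\<mu> k) = sets (mborel (Shift_space l L k) (shift_dist l L k))) \<and>
     (\<forall>k m x. k \<le> m \<longrightarrow> x \<in> words l L k m \<longrightarrow>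
        measure (\<mu> k) (cylinder l L k m x) =
          1 / parry_lambda l wh k m * parry_v l wh vh k (x k) * parry_w l wh m (x m))"

end

theory Submission
  imports Defs
begin

text \<open>
  For \<open>\<epsilon> > 0\<close> let \<open>C\<^sub>i(\<epsilon>)\<close> be the partition of the space at time \<open>i\<close> into the cylinders on the
  coordinates \<open>i, \<dots>, n\<^sub>i(\<epsilon>)\<close>. It has boundedly many elements, mutual distances at least
  \<open>min 1 \<epsilon>\<close> and diameters below \<open>\<epsilon>\<close>, so \<open>(C\<^sub>i(\<epsilon>))\<^sub>i\<close> is both an admissible sequence of partitions
  and a sequence of open covers with a common Lebesgue number. The join of the pullbacks of the
  \<open>C\<^sub>i(\<epsilon>)\<close>, \<open>i \<le> k\<close>, is the partition into cylinders on the coordinates \<open>0, \<dots>, N\<close> with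
  \<open>N\<close> the value at \<open>k\<close> of \<open>ntilde_fun\<close>, and as \<open>\<epsilon>\<close> decreases to 0 these sequences exhaust both
  entropies. The Parry formula identifies the entropy of the cylinder partition up to a bounded error
  with the \<open>\<pi>\<^sub>N\<close>-average of the logarithms of the column sums, which gives (i).

  For (ii), the number of words on \<open>0, \<dots>, N\<close> is at most a constant times the largest column
  sum, say at \<open>\<gamma>\<close>. By hypothesis \<open>\<gamma>\<close> can be joined to a set of letters of measure at least
  \<open>1 - \<delta>\<close> at time \<open>n\<^sub>N(\<epsilon>')\<close>, whose column sums are therefore at least as large. Submultiplicativity of
  word counts shows that this time does not exceed \<open>ntilde_fun\<close> at \<open>k\<close> for a smaller \<open>\<epsilon>\<close>.
\<close>

section \<open>Entropy inequalities\<close>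

text \<open>The hard inequality is that an arbitrary admissible sequence produces no more entropy
  than the window cylinders. Admissibility separates partition elements only after sets of small
  measure are removed, and everything varies with time, so the elements need not be unions of
  cylinders. One inequality of Gibbs type replaces a calculus of conditional entropies: H(A) is at
  most H(B) plus the expected loss -ln q of any rule q that guesses the A-element from the
  B-element. A rule that is a product over the times makes the loss a sum over the times, and
  invariance of the measures evaluates each summand at its own time. Simpler rules give the
  monotonicity of the cylinder entropy in its length and its bound by the logarithm of the word
  count. That monotonicity carries both limits. It makes the rates antitone in \<epsilon>, so that
  their limit at 0 is their supremum. In (ii) it also allows a time to be replaced by a larger one;
  for the \<pi>-averages this is possible only up to the bounded error that separates them from
  cylinder entropies.\<close>

lemma gibbs_term:
  fixes p q a b :: real
  assumes "0 \<le> p" "p \<le> a" "p \<le> b" "0 \<le> q" "p \<noteq> 0 \<Longrightarrow> 0 < q"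
  shows "- (p * ln a) \<le> - (p * ln b) + p * (- ln q) + (b * q - p)"
proof (cases "p = 0")
  case False
  then have p: "p > 0" "q > 0" "a > 0" "b > 0" using assms by auto
  \<comment> \<open>Replacing the marginal \<open>a\<close> by the joint mass \<open>p\<close> is
    the termwise form of H(A) <= H(A, B). Only the marginal \<open>b\<close> is then compared, by ln
    t <= t - 1 at t = b q / p.\<close>
  have "- (p * ln a) \<le> - (p * ln p)"
    using p assms by simp
  moreover have "p * ln (b * q / p) \<le> p * (b * q / p - 1)"
    using p by (intro mult_left_mono ln_le_minus_one) auto
  moreover have "p * (b * q / p - 1) = b * q - p"
    using p by (simp add: field_simps)
  moreover have "p * ln (b * q / p) = p * ln b + p * ln q - p * ln p"
    using p by (simp add: ln_mult ln_div algebra_simps)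
  ultimately show ?thesis by simp
qed (use assms in auto)

text \<open>In entropy terms H(a) <= H(a, b) = H(b) + H(a | b), and the conditional entropy is at
  most the expected loss of any guess \<open>q\<close> given \<open>j\<close>. It is enough that
  each column of \<open>q\<close> is a subprobability, since the remainders b q - p then have
  nonpositive sum.\<close>

lemma gibbs_sum:
  fixes p q :: "'i \<Rightarrow> 'j \<Rightarrow> real"
  assumes fin: "finite I" "finite J"
    and p0: "\<And>i j. i \<in> I \<Longrightarrow> j \<in> J \<Longrightarrow> 0 \<le> p i j"
    and q0: "\<And>i j. i \<in> I \<Longrightarrow> j \<in> J \<Longrightarrow> 0 \<le> q i j"
    and pq: "\<And>i j. i \<in> I \<Longrightarrow> j \<in> J \<Longrightarrow> p i j \<noteq> 0 \<Longrightarrow> 0 < q i j"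
    and a: "\<And>i. i \<in> I \<Longrightarrow> a i = (\<Sum>j\<in>J. p i j)"
    and b: "\<And>j. j \<in> J \<Longrightarrow> b j = (\<Sum>i\<in>I. p i j)"
    and q1: "\<And>j. j \<in> J \<Longrightarrow> (\<Sum>i\<in>I. q i j) \<le> 1"
  shows "- (\<Sum>i\<in>I. a i * ln (a i)) \<le>
    - (\<Sum>j\<in>J. b j * ln (b j)) + (\<Sum>i\<in>I. \<Sum>j\<in>J. p i j * (- ln (q i j)))"
proof -
  have "- (\<Sum>i\<in>I. a i * ln (a i)) = (\<Sum>i\<in>I. \<Sum>j\<in>J. - (p i j * ln (a i)))"
    using a by (simp add: sum_distrib_right sum_negf)
  also have "\<dots> \<le> (\<Sum>i\<in>I. \<Sum>j\<in>J. - (p i j * ln (b j)) + p i j * (- ln (q i j)) + (b j * q i j - p i j))"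
  proof (intro sum_mono gibbs_term)
    fix i j assume ij: "i \<in> I" "j \<in> J"
    show "p i j \<le> a i" unfolding a[OF ij(1)] using ij fin p0 by (intro member_le_sum) auto
    show "p i j \<le> b j" unfolding b[OF ij(2)]
      using ij fin p0 by (intro member_le_sum[of i I "\<lambda>i. p i j"]) auto
  qed (use p0 q0 pq in auto)
  also have "\<dots> = (\<Sum>i\<in>I. \<Sum>j\<in>J. - (p i j * ln (b j))) + (\<Sum>i\<in>I. \<Sum>j\<in>J. p i j * (- ln (q i j)))
      + ((\<Sum>i\<in>I. \<Sum>j\<in>J. b j * q i j) - (\<Sum>i\<in>I. \<Sum>j\<in>J. p i j))"
    by (simp only: sum.distrib sum_subtractf)
  also have "(\<Sum>i\<in>I. \<Sum>j\<in>J. - (p i j * ln (b j))) = - (\<Sum>j\<in>J. b j * ln (b j))"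
    using b by (subst sum.swap) (simp add: sum_distrib_right sum_negf)
  also have "(\<Sum>i\<in>I. \<Sum>j\<in>J. b j * q i j) \<le> (\<Sum>i\<in>I. \<Sum>j\<in>J. p i j)"
  proof -
    have "(\<Sum>i\<in>I. \<Sum>j\<in>J. b j * q i j) = (\<Sum>j\<in>J. b j * (\<Sum>i\<in>I. q i j))"
      by (subst sum.swap) (simp add: sum_distrib_left)
    also have "\<dots> \<le> (\<Sum>j\<in>J. b j * 1)"
      using q1 b p0 by (intro sum_mono mult_left_mono) (auto intro!: sum_nonneg)
    also have "\<dots> = (\<Sum>i\<in>I. \<Sum>j\<in>J. p i j)"
      using b by (subst sum.swap) simp
    finally show ?thesis .
  qed
  finally show ?thesis by simp
qed

lemma (in prob_space) gibbs_partition: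
  fixes A :: "'i \<Rightarrow> 'a set" and B :: "'j \<Rightarrow> 'a set" and q :: "'i \<Rightarrow> 'j \<Rightarrow> real"
  assumes fin: "finite I" "finite J"
    and A: "A ` I \<subseteq> events" "disjoint_family_on A I" "(\<Union>i\<in>I. A i) = space M"
    and B: "B ` J \<subseteq> events" "disjoint_family_on B J" "(\<Union>j\<in>J. B j) = space M"
    and q0: "\<And>i j. i \<in> I \<Longrightarrow> j \<in> J \<Longrightarrow> 0 \<le> q i j"
    and pq: "\<And>i j. i \<in> I \<Longrightarrow> j \<in> J \<Longrightarrow> prob (A i \<inter> B j) \<noteq> 0 \<Longrightarrow> 0 < q i j"
    and q1: "\<And>j. j \<in> J \<Longrightarrow> (\<Sum>i\<in>I. q i j) \<le> 1"
  shows "- (\<Sum>i\<in>I. prob (A i) * ln (prob (A i))) \<le>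
    - (\<Sum>j\<in>J. prob (B j) * ln (prob (B j))) + (\<Sum>i\<in>I. \<Sum>j\<in>J. prob (A i \<inter> B j) * (- ln (q i j)))"
proof (rule gibbs_sum[OF fin])
  fix i assume i: "i \<in> I"
  have "A i = (\<Union>j\<in>J. A i \<inter> B j)"
    using A(1) B(3) i sets.sets_into_space[of "A i" M] by auto
  then have "prob (A i) = prob (\<Union>j\<in>J. A i \<inter> B j)" by simp
  also have "\<dots> = (\<Sum>j\<in>J. prob (A i \<inter> B j))"
    using A(1) B(1) B(2) i fin
    by (intro finite_measure_finite_Union) (auto simp: disjoint_family_on_def, blast)
  finally show "prob (A i) = (\<Sum>j\<in>J. prob (A i \<inter> B j))" .
next
  fix j assume j: "j \<in> J"
  have "B j = (\<Union>i\<in>I. A i \<inter> B j)"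
    using B(1) A(3) j sets.sets_into_space[of "B j" M] by auto
  then have "prob (B j) = prob (\<Union>i\<in>I. A i \<inter> B j)" by simp
  also have "\<dots> = (\<Sum>i\<in>I. prob (A i \<inter> B j))"
    using A(1) A(2) B(1) j fin
    by (intro finite_measure_finite_Union) (auto simp: disjoint_family_on_def)
  finally show "prob (B j) = (\<Sum>i\<in>I. prob (A i \<inter> B j))" .
qed (use q0 q1 pq in auto)

text \<open>\<open>part_entropy\<close> sums over a set of sets, so indices with equal images are
  counted once. By disjointness such images are empty and contribute 0.\<close>

lemma part_entropy_image:
  assumes "finite I" "disjoint_family_on A I"
  shows "part_entropy M (A ` I) = - (\<Sum>i\<in>I. measure M (A i) * ln (measure M (A i)))"
proof -
  have "(\<Sum>P\<in>A ` I. measure M P * ln (measure M P)) = (\<Sum>i\<in>I. measure M (A i) * ln (measure M (A i)))"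
    using assms
    by (subst sum.reindex_nontrivial) (auto simp: disjoint_family_on_def, metis inf.idem measure_empty)
  then show ?thesis by (simp add: part_entropy_def)
qed

lemma neg_mult_ln_le_one:
  fixes p :: real
  assumes "0 \<le> p" "p \<le> 1"
  shows "0 \<le> - (p * ln p)" "- (p * ln p) \<le> 1"
proof -
  show "0 \<le> - (p * ln p)" using assms
    by (cases "p = 0") (auto simp: mult_le_0_iff)
  have "- (0 * ln p) \<le> 1" by simp
  moreover have "- (p * ln p) \<le> 1" if "p > 0"
  proof -
    have "- (p * ln p) = p * ln (1 / p)" using that by (simp add: ln_div)
    also have "\<dots> \<le> p * (1 / p - 1)" using that by (intro mult_left_mono ln_le_minus_one) auto
    also have "\<dots> \<le> 1" using that by (simp add: field_simps)
    finally show ?thesis .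
  qed
  ultimately show "- (p * ln p) \<le> 1" using assms by (cases "p = 0") auto
qed

text \<open>The joins up to time \<open>k\<close> have \<open>k + 1\<close> factors, while the
  formula in (i) divides by \<open>k\<close>. Under linear growth the two quotients differ by at
  most C / k.\<close>

lemma limsup_mult_ratio:
  fixes u :: "nat \<Rightarrow> real"
  assumes "\<And>k. 0 \<le> u k" "\<And>k. u k \<le> C * (real k + 1)"
  shows "limsup (\<lambda>k. ereal (u k / real k)) = limsup (\<lambda>k. ereal (u k / real (Suc k)))"
proof (rule antisym)
  have C: "C \<ge> 0" using assms(1)[of 0] assms(2)[of 0] by simp
  have "limsup (\<lambda>k. ereal (u k / real k)) \<le> limsup (\<lambda>k. ereal (C / real k) + ereal (u k / real (Suc k)))"
  proof (rule Limsup_mono, rule eventually_mono[OF eventually_gt_at_top[of 0]])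
    fix k :: nat assume k: "0 < k"
    have "u k / real k - u k / real (Suc k) = u k / (real k * (real k + 1))"
      using k by (simp add: field_simps)
    also have "\<dots> \<le> C * (real k + 1) / (real k * (real k + 1))"
      using assms(2)[of k] k by (intro divide_right_mono) auto
    also have "\<dots> = C / real k" by (rule nonzero_mult_divide_mult_cancel_right) (use k in linarith)
    finally show "ereal (u k / real k) \<le> ereal (C / real k) + ereal (u k / real (Suc k))" by simp
  qed
  also have "\<dots> = 0 + limsup (\<lambda>k. ereal (u k / real (Suc k)))"
  proof (rule ereal_limsup_lim_add)
    have "(\<lambda>k. C / real k) \<longlonglongrightarrow> 0" by (rule lim_const_over_n)
    then show "(\<lambda>k. ereal (C / real k)) \<longlonglongrightarrow> 0" by (simp add: zero_ereal_def)
  qed auto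
  finally show "limsup (\<lambda>k. ereal (u k / real k)) \<le> limsup (\<lambda>k. ereal (u k / real (Suc k)))" by simp
  show "limsup (\<lambda>k. ereal (u k / real (Suc k))) \<le> limsup (\<lambda>k. ereal (u k / real k))"
    by (rule Limsup_mono, rule eventually_mono[OF eventually_gt_at_top[of 0]])
      (use assms(1) in \<open>auto intro!: divide_left_mono\<close>)
qed

lemma limsup_le_add_bounded:
  fixes u v :: "nat \<Rightarrow> real"
  assumes "\<And>k. u k \<le> v k + D"
  shows "limsup (\<lambda>k. ereal (u k / real k)) \<le> limsup (\<lambda>k. ereal (v k / real k))"
proof -
  have "limsup (\<lambda>k. ereal (u k / real k)) \<le> limsup (\<lambda>k. ereal (D / real k) + ereal (v k / real k))"
    using assms by (intro Limsup_mono always_eventually allI)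
      (simp add: add.commute add_divide_distrib[symmetric] divide_right_mono)
  also have "\<dots> = 0 + limsup (\<lambda>k. ereal (v k / real k))"
  proof (rule ereal_limsup_lim_add)
    have "(\<lambda>k. D / real k) \<longlonglongrightarrow> 0" by (rule lim_const_over_n)
    then show "(\<lambda>k. ereal (D / real k)) \<longlonglongrightarrow> 0" by (simp add: zero_ereal_def)
  qed auto
  finally show ?thesis by simp
qed

section \<open>Words and sequences\<close>

lemma iterate_shift_map: "iterate shift_map i x = restrict x {i..}"
  by (induction i) (auto simp: shift_map_def fun_eq_iff)

locale nonstationary_shift =
  fixes l :: "nat \<Rightarrow> nat" and L :: "nat \<Rightarrow> nat \<Rightarrow> nat \<Rightarrow> nat"
  assumes nsft: "nsft l L"
    and infinite_space: "infinite (Shift_space l L 0)"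
begin

lemma alph_nonempty: "alph l i \<noteq> {}"
  using nsft by (auto simp: nsft_def alph_def)

lemma finite_alph [simp]: "finite (alph l i)"
  by (simp add: alph_def)

lemma L_01: "a \<in> alph l i \<Longrightarrow> b \<in> alph l (Suc i) \<Longrightarrow> L i a b = 0 \<or> L i a b = 1"
  using nsft by (auto simp: nsft_def)

lemma L_successor:
  assumes "a \<in> alph l i"
  shows "\<exists>b\<in>alph l (Suc i). L i a b = 1"
proof -
  obtain b where "b \<in> alph l (Suc i)" "L i a b \<noteq> 0" using nsft assms unfolding nsft_def by blast
  then show ?thesis using L_01[OF assms] by metis
qed

lemma L_predecessor:
  assumes "b \<in> alph l (Suc i)"
  shows "\<exists>a\<in>alph l i. L i a b = 1"
proof -
  obtain a where "a \<in> alph l i" "L i a b \<noteq> 0" using nsft assms unfolding nsft_def by blast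
  then show ?thesis using L_01[OF _ assms] by metis
qed

lemma card_alph_bounded: "\<exists>c\<ge>1. \<forall>i. card (alph l i) \<le> c"
proof -
  obtain c where "\<forall>i. l i \<le> c" using nsft by (auto simp: nsft_def)
  then show ?thesis by (intro exI[of _ "max 1 c"]) (auto simp: alph_def le_max_iff_disj)
qed

definition alph_bound :: nat where
  "alph_bound = (SOME c. c \<ge> 1 \<and> (\<forall>i. card (alph l i) \<le> c))"

lemma alph_bound: "alph_bound \<ge> 1" "card (alph l i) \<le> alph_bound"
  using someI_ex[OF card_alph_bounded] by (auto simp: alph_bound_def)

lemma Shift_space_iff:
  "x \<in> Shift_space l L k \<longleftrightarrow>
     (\<forall>i\<ge>k. x i \<in> alph l i \<and> L i (x i) (x (Suc i)) = 1) \<and> (\<forall>i<k. x i = undefined)"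
  unfolding Shift_space_def PiE_def Pi_def extensional_def by (auto simp: not_le)

lemma words_iff:
  "x \<in> words l L k m \<longleftrightarrow>
     (\<forall>i. k \<le> i \<and> i \<le> m \<longrightarrow> x i \<in> alph l i) \<and>
     (\<forall>i. k \<le> i \<and> i < m \<longrightarrow> L i (x i) (x (Suc i)) = 1) \<and>
     (\<forall>i. \<not> (k \<le> i \<and> i \<le> m) \<longrightarrow> x i = undefined)"
  unfolding words_def PiE_def Pi_def extensional_def by auto

lemma finite_words [simp]: "finite (words l L k m)"
  by (rule finite_subset[of _ "\<Pi>\<^sub>E i\<in>{k..m}. alph l i"])
    (auto simp: words_def intro!: finite_PiE)

lemma restrict_mem_words:
  assumes "x \<in> Shift_space l L k" "k \<le> k'" "k' \<le> m"
  shows "restrict x {k'..m} \<in> words l L k' m"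
  using assms by (auto simp: words_iff Shift_space_iff)

lemma restrict_word_mem_words:
  assumes "x \<in> words l L k m" "k \<le> k'" "m' \<le> m"
  shows "restrict x {k'..m'} \<in> words l L k' m'"
  using assms by (auto simp: words_iff)

lemma restrict_mem_Shift_space:
  assumes "x \<in> Shift_space l L k" "k \<le> k'"
  shows "restrict x {k'..} \<in> Shift_space l L k'"
  using assms by (auto simp: Shift_space_iff)

lemma extend_word:
  assumes x: "x \<in> words l L k m" and km: "k \<le> m"
  obtains y where "y \<in> Shift_space l L k" "\<And>i. i \<in> {k..m} \<Longrightarrow> y i = x i"
proof -
  have "\<forall>i. \<exists>s. \<forall>a\<in>alph l i. s a \<in> alph l (Suc i) \<and> L i a (s a) = 1"
    using L_successor by meson
  then obtain s where s: "\<And>i a. a \<in> alph l i \<Longrightarrow> s i a \<in> alph l (Suc i) \<and> L i a (s i a) = 1"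
    by metis
  \<comment> \<open>\<open>z j\<close> is the letter at time \<open>m + j\<close> when the last
    letter of \<open>x\<close> is continued by the chosen successors.\<close>
  define z where "z = rec_nat (x m) (\<lambda>j a. s (m + j) a)"
  have z0: "z 0 = x m" and zS: "\<And>j. z (Suc j) = s (m + j) (z j)"
    by (simp_all add: z_def)
  have zA: "z j \<in> alph l (m + j)" for j
  proof (induction j)
    case 0 then show ?case using x km by (simp add: z0 words_iff)
  next
    case (Suc j) then show ?case using s by (simp add: zS)
  qed
  define y where "y i = (if i < k then undefined else if i \<le> m then x i else z (i - m))" for i
  have ym: "y i = z (i - m)" if "m \<le> i" for i
    using that km z0 by (auto simp: y_def)
  have "y \<in> Shift_space l L k"
    unfolding Shift_space_iff
  proof (intro conjI allI impI)
    fix i assume "k \<le> i"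
    show "y i \<in> alph l i"
      using x \<open>k \<le> i\<close> zA[of "i - m"] by (cases "i \<le> m") (auto simp: y_def words_iff)
    show "L i (y i) (y (Suc i)) = 1"
    proof (cases "i < m")
      case True
      then show ?thesis using x \<open>k \<le> i\<close> by (auto simp: y_def words_iff)
    next
      case False
      then have "y i = z (i - m)" "y (Suc i) = s i (z (i - m))"
        using ym[of i] ym[of "Suc i"] zS[of "i - m"] by (simp_all add: Suc_diff_le)
      then show ?thesis using s zA[of "i - m"] False by simp
    qed
  qed (simp add: y_def)
  moreover have "\<And>i. i \<in> {k..m} \<Longrightarrow> y i = x i" by (simp add: y_def)
  ultimately show thesis using that by blast
qed

text \<open>No column of a matrix vanishes, so a predecessor can be prepended until time 0 is
  reached.\<close>

lemma extend_word_left: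
  assumes "x \<in> words l L k m" "k \<le> m"
  obtains y where "y \<in> words l L 0 m" "restrict y {k..m} = x"
proof -
  have "\<exists>y\<in>words l L 0 m. restrict y {k..m} = x"
    using assms
  proof (induction k arbitrary: x)
    case 0
    then show ?case by (intro bexI[of _ x]) (auto simp: words_iff fun_eq_iff)
  next
    case (Suc k)
    have "x (Suc k) \<in> alph l (Suc k)" using Suc.prems by (simp add: words_iff)
    then obtain a where a: "a \<in> alph l k" "L k a (x (Suc k)) = 1" using L_predecessor by blast
    have "x(k := a) \<in> words l L k m"
      using Suc.prems a by (auto simp: words_iff not_less_eq_eq le_Suc_eq)
    moreover have "k \<le> m" using Suc.prems by simp
    ultimately obtain y where y: "y \<in> words l L 0 m" "restrict y {k..m} = x(k := a)"
      using Suc.IH by blast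
    have "restrict y {Suc k..m} = restrict (restrict y {k..m}) {Suc k..m}"
      by (auto simp: fun_eq_iff)
    also have "\<dots> = restrict x {Suc k..m}" unfolding y(2) by (auto simp: fun_eq_iff)
    also have "\<dots> = x" using Suc.prems(1) by (auto simp: fun_eq_iff words_iff)
    finally show ?case using y(1) by blast
  qed
  then show thesis using that by blast
qed

lemma words_eq_image:
  assumes "k \<le> m"
  shows "words l L k m = (\<lambda>x. restrict x {k..m}) ` Shift_space l L k"
proof
  show "words l L k m \<subseteq> (\<lambda>x. restrict x {k..m}) ` Shift_space l L k"
  proof
    fix x assume x: "x \<in> words l L k m"
    obtain y where y: "y \<in> Shift_space l L k" "\<And>i. i \<in> {k..m} \<Longrightarrow> y i = x i"
      using extend_word[OF x assms] by blast
    have "restrict y {k..m} = x"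
      using x y(2) by (auto simp: words_iff fun_eq_iff)
    then show "x \<in> (\<lambda>x. restrict x {k..m}) ` Shift_space l L k" using y(1) by blast
  qed
qed (use assms restrict_mem_words in auto)

lemma Shift_space_nonempty: "Shift_space l L k \<noteq> {}"
proof -
  obtain a where a: "a \<in> alph l k" using alph_nonempty by blast
  have "(\<lambda>i. if i = k then a else undefined) \<in> words l L k k"
    using a by (auto simp: words_iff)
  then show ?thesis using words_eq_image[of k k] by blast
qed

section \<open>Word counts\<close>

lemma nwords_pos: "k \<le> m \<Longrightarrow> 0 < nwords l L k m"
  using Shift_space_nonempty[of k] words_eq_image[of k m] finite_words[of k m]
  unfolding nwords_def card_gt_0_iff by blast

lemma nwords_mono:
  assumes "k \<le> m" "m \<le> m'"
  shows "nwords l L k m \<le> nwords l L k m'"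
proof -
  have "restrict (restrict x {k..m'}) {k..m} = restrict x {k..m}" for x :: "nat \<Rightarrow> nat"
    using assms by (auto simp: fun_eq_iff)
  then have "words l L k m = (\<lambda>x. restrict x {k..m}) ` words l L k m'"
    using assms by (simp add: words_eq_image image_image)
  then show ?thesis by (metis nwords_def card_image_le finite_words)
qed

lemma nwords_single: "nwords l L k k \<le> alph_bound"
proof -
  have "card (words l L k k) \<le> card (alph l k)"
    by (rule card_inj_on_le[of "\<lambda>x. x k"]) (auto simp: words_iff inj_on_def fun_eq_iff, metis le_antisym)
  then show ?thesis using alph_bound(2)[of k] by (simp add: nwords_def)
qed

text \<open>The two pieces share the letter at time \<open>n\<close>; a word is determined by them,
  although not every pair of pieces can be glued.\<close>

lemma nwords_submult:
  assumes "k \<le> n" "n \<le> m"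
  shows "nwords l L k m \<le> nwords l L k n * nwords l L n m"
proof -
  let ?f = "\<lambda>x. (restrict x {k..n}, restrict x {n..m})"
  have inj: "inj_on ?f (words l L k m)"
  proof (rule inj_onI)
    fix x y assume x: "x \<in> words l L k m" and y: "y \<in> words l L k m" and eq: "?f x = ?f y"
    have 1: "x i = y i" if "i \<in> {k..n}" for i
      using eq that by (metis prod.inject restrict_apply')
    have 2: "x i = y i" if "i \<in> {n..m}" for i
      using eq that by (metis prod.inject restrict_apply')
    show "x = y"
    proof
      fix i
      show "x i = y i"
        using 1[of i] 2[of i] x y
        by (cases "k \<le> i \<and> i \<le> m"; cases "i \<le> n") (auto simp: words_iff)
    qed
  qed
  have "?f ` words l L k m \<subseteq> words l L k n \<times> words l L n m"
    using assms by (auto intro: restrict_word_mem_words)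
  then have "card (words l L k m) \<le> card (words l L k n \<times> words l L n m)"
    by (intro card_inj_on_le[OF inj]) auto
  then show ?thesis by (simp add: nwords_def card_cartesian_product)
qed

lemma nwords_Suc: "nwords l L k (Suc n) \<le> nwords l L k n * alph_bound" if "k \<le> n"
proof -
  let ?f = "\<lambda>x. (restrict x {k..n}, x (Suc n))"
  have inj: "inj_on ?f (words l L k (Suc n))"
  proof (rule inj_onI)
    fix x y assume x: "x \<in> words l L k (Suc n)" and y: "y \<in> words l L k (Suc n)" and eq: "?f x = ?f y"
    have 1: "x i = y i" if "i \<in> {k..n}" for i
      using eq that by (metis prod.inject restrict_apply')
    show "x = y"
    proof
      fix i
      show "x i = y i"
        using 1[of i] eq x y
        by (cases "k \<le> i \<and> i \<le> Suc n"; cases "i = Suc n") (auto simp: words_iff)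
    qed
  qed
  have "?f ` words l L k (Suc n) \<subseteq> words l L k n \<times> alph l (Suc n)"
    using that by (auto intro: restrict_word_mem_words) (auto simp: words_iff)
  then have "card (words l L k (Suc n)) \<le> card (words l L k n \<times> alph l (Suc n))"
    by (intro card_inj_on_le[OF inj]) auto
  also have "\<dots> \<le> nwords l L k n * alph_bound"
    by (simp add: nwords_def card_cartesian_product alph_bound)
  finally show ?thesis by (simp add: nwords_def)
qed

text \<open>There are finitely many beginnings on the times below \<open>k\<close>, so a finite
  space at time \<open>k\<close> would leave only finitely many sequences at time 0.\<close>

lemma infinite_Shift_space: "infinite (Shift_space l L k)"
proof
  assume fin: "finite (Shift_space l L k)"
  let ?f = "\<lambda>x. (restrict x {..<k}, restrict x {k..})"
  have inj: "inj_on ?f (Shift_space l L 0)"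
  proof (rule inj_onI)
    fix x y assume eq: "?f x = ?f y"
    then have "restrict x {..<k} i = restrict y {..<k} i" "restrict x {k..} i = restrict y {k..} i" for i
      by auto
    then show "x = y" by (metis atLeast_iff ext lessThan_iff not_less restrict_apply')
  qed
  have "?f ` Shift_space l L 0 \<subseteq> (\<Pi>\<^sub>E i\<in>{..<k}. alph l i) \<times> Shift_space l L k"
    by (auto simp: Shift_space_iff split: if_splits)
  moreover have "finite ((\<Pi>\<^sub>E i\<in>{..<k}. alph l i) \<times> Shift_space l L k)"
    using fin by (intro finite_cartesian_product finite_PiE) auto
  ultimately have "finite (Shift_space l L 0)"
    using inj by (meson finite_imageD finite_subset)
  then show False using infinite_space by simp
qed

text \<open>Any \<open>N\<close> distinct sequences are already distinguished on a finite window and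
  so yield \<open>N\<close> words. This makes the \<open>LEAST\<close> in \<open>m_fun\<close>
  meaningful at every time.\<close>

lemma nwords_unbounded: "\<exists>m. real (nwords l L k (k + m)) > C"
proof -
  obtain N :: nat where N: "C < real N" using reals_Archimedean2 by blast
  obtain F where F: "finite F" "card F = N" "F \<subseteq> Shift_space l L k"
    using infinite_arbitrarily_large[OF infinite_Shift_space] by blast
  define D where "D x y = (LEAST i. x i \<noteq> y i)" for x y :: "nat \<Rightarrow> nat"
  \<comment> \<open>The first disagreement \<open>D\<close> is an absolute time, so
    \<open>m\<close>, used as an increment after \<open>k\<close>, is more than large
    enough.\<close>
  define m where "m = Max ((\<lambda>(x, y). D x y) ` (F \<times> F))"
  have Dm: "D x y \<le> m" if "x \<in> F" "y \<in> F" for x y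
    unfolding m_def using that F(1) by (intro Max_ge) auto
  have "inj_on (\<lambda>x. restrict x {k..k + m}) F"
  proof (rule inj_onI, rule ccontr)
    fix x y assume xy: "x \<in> F" "y \<in> F" and eq: "restrict x {k..k + m} = restrict y {k..k + m}"
      and "x \<noteq> y"
    then obtain i where "x i \<noteq> y i" by blast
    then have D: "x (D x y) \<noteq> y (D x y)" unfolding D_def by (rule LeastI)
    moreover have "D x y \<le> k + m" using Dm[OF xy] by simp
    moreover have "k \<le> D x y"
      using D xy F(3) Shift_space_iff by (metis subsetD not_le)
    ultimately show False using eq by (metis atLeastAtMost_iff restrict_apply')
  qed
  then have "card F \<le> card (words l L k (k + m))"
    using F(3) by (intro card_inj_on_le) (auto intro: restrict_mem_words)
  then show ?thesis using N F(2) by (intro exI[of _ m]) (simp add: nwords_def)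
qed

section \<open>Ends of the windows and their running maxima\<close>

lemma n_fun_ge: "k \<le> n_fun l L k \<epsilon>"
  by (simp add: n_fun_def)

lemma nwords_n_fun: "real (nwords l L k (n_fun l L k \<epsilon>)) > 1 / \<epsilon>"
  unfolding n_fun_def m_fun_def by (rule LeastI_ex[OF nwords_unbounded])

lemma nwords_less_n_fun:
  assumes "k \<le> r" "r < n_fun l L k \<epsilon>"
  shows "real (nwords l L k r) \<le> 1 / \<epsilon>"
proof -
  have "r - k < m_fun l L k \<epsilon>" using assms by (simp add: n_fun_def)
  then show ?thesis using assms unfolding m_fun_def by (auto dest: not_less_Least)
qed

lemma n_fun_leI:
  assumes "k \<le> r" "real (nwords l L k r) > 1 / \<epsilon>"
  shows "n_fun l L k \<epsilon> \<le> r"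
  using nwords_less_n_fun[OF assms(1), of \<epsilon>] assms(2) by (cases "r < n_fun l L k \<epsilon>") auto

lemma n_fun_antimono:
  assumes "0 < \<epsilon>" "\<epsilon> \<le> \<epsilon>'"
  shows "n_fun l L k \<epsilon>' \<le> n_fun l L k \<epsilon>"
proof (rule n_fun_leI[OF n_fun_ge])
  have "1 / \<epsilon>' \<le> 1 / \<epsilon>" using assms by (simp add: frac_le)
  then show "1 / \<epsilon>' < real (nwords l L k (n_fun l L k \<epsilon>))" using nwords_n_fun[of \<epsilon> k] by simp
qed

text \<open>One step before \<open>n_fun\<close> the count is still at most 1/\<epsilon>, and one
  more letter multiplies it by at most \<open>alph_bound\<close>. The summand 1 covers windows of a
  single letter, which have no previous step. The bound does not depend on \<open>k\<close>.\<close>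

lemma nwords_n_fun_le:
  assumes "0 < \<epsilon>"
  shows "real (nwords l L k (n_fun l L k \<epsilon>)) \<le> (1 + 1 / \<epsilon>) * real alph_bound"
proof (cases "n_fun l L k \<epsilon> = k")
  case True
  then have "real (nwords l L k (n_fun l L k \<epsilon>)) \<le> 1 * real alph_bound"
    using nwords_single[of k] by simp
  also have "\<dots> \<le> (1 + 1 / \<epsilon>) * real alph_bound"
    using assms by (intro mult_right_mono) auto
  finally show ?thesis .
next
  case False
  then obtain r where r: "n_fun l L k \<epsilon> = Suc r" "k \<le> r"
    using n_fun_ge[of k \<epsilon>] by (cases "n_fun l L k \<epsilon>") auto
  have "real (nwords l L k (Suc r)) \<le> real (nwords l L k r) * real alph_bound"
    using nwords_Suc[OF r(2)] by (metis of_nat_le_iff of_nat_mult)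
  also have "\<dots> \<le> (1 + 1 / \<epsilon>) * real alph_bound"
    using nwords_less_n_fun[of k r \<epsilon>] r by (intro mult_right_mono) auto
  finally show ?thesis using r by simp
qed

lemma ntilde_eq: "ntilde_fun l L k \<epsilon> = Max ((\<lambda>i. n_fun l L i \<epsilon>) ` {0..k})"
  by (simp add: ntilde_fun_def n_fun_def)

lemma n_fun_le_ntilde: "i \<le> k \<Longrightarrow> n_fun l L i \<epsilon> \<le> ntilde_fun l L k \<epsilon>"
  unfolding ntilde_eq by (intro Max_ge) auto

lemma ntilde_attained: "\<exists>i\<le>k. ntilde_fun l L k \<epsilon> = n_fun l L i \<epsilon>"
proof -
  have "ntilde_fun l L k \<epsilon> \<in> (\<lambda>i. n_fun l L i \<epsilon>) ` {0..k}"
    unfolding ntilde_eq by (intro Max_in) auto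
  then show ?thesis by auto
qed

lemma ntilde_ge: "k \<le> ntilde_fun l L k \<epsilon>"
  using n_fun_le_ntilde[of k k \<epsilon>] n_fun_ge[of k \<epsilon>] by simp

text \<open>The windows from \<open>i\<close> to \<open>n_fun l L i \<epsilon>\<close>,
  \<open>i \<le> k\<close>, leave no gap: a time up to \<open>k\<close> lies in its own window, and
  a later one in the window that attains the maximum.\<close>

lemma le_ntilde_iff: "j \<le> ntilde_fun l L k \<epsilon> \<longleftrightarrow> (\<exists>i\<le>k. i \<le> j \<and> j \<le> n_fun l L i \<epsilon>)"
proof
  assume j: "j \<le> ntilde_fun l L k \<epsilon>"
  show "\<exists>i\<le>k. i \<le> j \<and> j \<le> n_fun l L i \<epsilon>"
  proof (cases "j \<le> k")
    case True then show ?thesis using n_fun_ge by blast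
  next
    case False
    obtain i where "i \<le> k" "ntilde_fun l L k \<epsilon> = n_fun l L i \<epsilon>" using ntilde_attained by blast
    then show ?thesis using False j by (intro exI[of _ i]) auto
  qed
qed (meson n_fun_le_ntilde order_trans)

lemma ntilde_antimono:
  assumes "0 < \<epsilon>" "\<epsilon> \<le> \<epsilon>'"
  shows "ntilde_fun l L k \<epsilon>' \<le> ntilde_fun l L k \<epsilon>"
proof -
  obtain i where "i \<le> k" "ntilde_fun l L k \<epsilon>' = n_fun l L i \<epsilon>'" using ntilde_attained by blast
  then show ?thesis
    using n_fun_antimono[OF assms, of i] n_fun_le_ntilde[of i k \<epsilon>] by linarith
qed

text \<open>If the maximum grows at \<open>Suc k\<close>, it is attained by the new window, and the
  word splits at time \<open>Suc k\<close>. As \<open>Suc k\<close> is at most one step beyond the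
  old maximum, the cost is one factor \<open>alph_bound\<close> for that step and the window bound
  for the rest; hence the square of \<open>alph_bound\<close>.\<close>

lemma nwords_ntilde_le:
  assumes "0 < \<epsilon>"
  shows "real (nwords l L 0 (ntilde_fun l L k \<epsilon>)) \<le> ((1 + 1 / \<epsilon>) * real alph_bound * real alph_bound) ^ Suc k"
proof (induction k)
  case 0
  have "real (nwords l L 0 (n_fun l L 0 \<epsilon>)) \<le> (1 + 1 / \<epsilon>) * real alph_bound * 1"
    using nwords_n_fun_le[OF assms] by simp
  also have "\<dots> \<le> (1 + 1 / \<epsilon>) * real alph_bound * real alph_bound"
    using assms alph_bound(1) by (intro mult_left_mono) auto
  finally show ?case by (simp add: ntilde_eq)
next
  case (Suc k)
  let ?N = "ntilde_fun l L k \<epsilon>" and ?b = "(1 + 1 / \<epsilon>) * real alph_bound * real alph_bound"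
  have b: "1 \<le> ?b"
  proof -
    have "1 * 1 * 1 \<le> ?b"
      using assms alph_bound(1) by (intro mult_mono) auto
    then show ?thesis by simp
  qed
  show ?case
  proof (cases "ntilde_fun l L (Suc k) \<epsilon> = ?N")
    case True
    have "?b ^ Suc k \<le> ?b ^ Suc (Suc k)" using b by (intro power_increasing) auto
    then show ?thesis using Suc True by simp
  next
    case False
    obtain i where i: "i \<le> Suc k" "ntilde_fun l L (Suc k) \<epsilon> = n_fun l L i \<epsilon>"
      using ntilde_attained by blast
    have "?N \<le> ntilde_fun l L (Suc k) \<epsilon>" unfolding ntilde_eq by (intro Max_mono) auto
    then have "i = Suc k"
      using i False n_fun_le_ntilde[of i k \<epsilon>] by (cases "i \<le> k") auto
    then have eq: "ntilde_fun l L (Suc k) \<epsilon> = n_fun l L (Suc k) \<epsilon>" using i by simp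
    have "nwords l L 0 (n_fun l L (Suc k) \<epsilon>) \<le>
        nwords l L 0 (Suc k) * nwords l L (Suc k) (n_fun l L (Suc k) \<epsilon>)"
      by (intro nwords_submult n_fun_ge) auto
    also have "nwords l L 0 (Suc k) \<le> nwords l L 0 (Suc ?N)"
      using ntilde_ge[of k \<epsilon>] by (intro nwords_mono) auto
    also have "\<dots> \<le> nwords l L 0 ?N * alph_bound" by (rule nwords_Suc) simp
    finally have "nwords l L 0 (n_fun l L (Suc k) \<epsilon>) \<le>
        nwords l L 0 ?N * alph_bound * nwords l L (Suc k) (n_fun l L (Suc k) \<epsilon>)" by simp
    then have "real (nwords l L 0 (n_fun l L (Suc k) \<epsilon>)) \<le>
        real (nwords l L 0 ?N) * real alph_bound * real (nwords l L (Suc k) (n_fun l L (Suc k) \<epsilon>))"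
      by (metis of_nat_le_iff of_nat_mult)
    also have "\<dots> \<le> ?b ^ Suc k * real alph_bound * ((1 + 1 / \<epsilon>) * real alph_bound)"
      using Suc nwords_n_fun_le[OF assms, of "Suc k"] b
      by (intro mult_mono) auto
    also have "\<dots> = ?b ^ Suc (Suc k)" by (simp add: algebra_simps)
    finally show ?thesis using eq by simp
  qed
qed

section \<open>Column sums as numbers of words with prescribed last letter\<close>

lemma col_sum_eq_card:
  assumes "b \<in> alph l n"
  shows "col_sum l L n b = card {x \<in> words l L 0 n. x n = b}"
  using assms
proof (induction n arbitrary: b)
  case 0
  have "{x \<in> words l L 0 0. x 0 = b} = {\<lambda>i. if i = 0 then b else undefined}"
    using 0 by (auto simp: words_iff fun_eq_iff)
  moreover have "col_sum l L 0 b = 1"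
    using 0 by (simp add: col_sum_def if_distrib cong: if_cong)
  ultimately show ?case by simp
next
  case (Suc n)
  have "col_sum l L (Suc n) b = (\<Sum>c\<in>alph l n. col_sum l L n c * L n c b)"
    unfolding col_sum_def by (simp add: sum_distrib_right) (rule sum.swap)
  also have "\<dots> = (\<Sum>c\<in>alph l n. if L n c b = 1 then card {x \<in> words l L 0 n. x n = c} else 0)"
  proof (intro sum.cong refl)
    fix c assume c: "c \<in> alph l n"
    then show "col_sum l L n c * L n c b = (if L n c b = 1 then card {x \<in> words l L 0 n. x n = c} else 0)"
      using Suc.IH[OF c] L_01[OF c Suc.prems] by auto
  qed
  also have "\<dots> = (\<Sum>c\<in>{c\<in>alph l n. L n c b = 1}. card {x \<in> words l L 0 n. x n = c})"
    by (rule sum.inter_filter[symmetric]) simp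
  also have "\<dots> = card (\<Union>c\<in>{c\<in>alph l n. L n c b = 1}. {x \<in> words l L 0 n. x n = c})"
    by (intro card_UN_disjoint[symmetric]) auto
  also have "\<dots> = card {x \<in> words l L 0 (Suc n). x (Suc n) = b}"
  proof (rule bij_betw_same_card[of "\<lambda>x. x(Suc n := b)"], rule bij_betwI[where g = "\<lambda>x. restrict x {0..n}"])
    show "(\<lambda>x. x(Suc n := b)) \<in> (\<Union>c\<in>{c\<in>alph l n. L n c b = 1}. {x \<in> words l L 0 n. x n = c})
        \<rightarrow> {x \<in> words l L 0 (Suc n). x (Suc n) = b}"
      using Suc.prems by (auto simp: words_iff less_Suc_eq le_Suc_eq)
    show "(\<lambda>x. restrict x {0..n}) \<in> {x \<in> words l L 0 (Suc n). x (Suc n) = b}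
        \<rightarrow> (\<Union>c\<in>{c\<in>alph l n. L n c b = 1}. {x \<in> words l L 0 n. x n = c})"
      by (auto simp: words_iff)
    show "restrict (x(Suc n := b)) {0..n} = x"
      if "x \<in> (\<Union>c\<in>{c\<in>alph l n. L n c b = 1}. {x \<in> words l L 0 n. x n = c})" for x
      using that by (auto simp: words_iff fun_eq_iff)
    show "(restrict x {0..n})(Suc n := b) = x" if "x \<in> {x \<in> words l L 0 (Suc n). x (Suc n) = b}" for x
      using that by (auto simp: words_iff fun_eq_iff)
  qed
  finally show ?case .
qed

lemma sum_col_sum: "(\<Sum>b\<in>alph l n. col_sum l L n b) = nwords l L 0 n"
proof -
  have "(\<Sum>b\<in>alph l n. col_sum l L n b) = (\<Sum>b\<in>alph l n. card {x \<in> words l L 0 n. x n = b})"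
    by (simp add: col_sum_eq_card)
  also have "\<dots> = card (\<Union>b\<in>alph l n. {x \<in> words l L 0 n. x n = b})"
    by (intro card_UN_disjoint[symmetric]) auto
  also have "(\<Union>b\<in>alph l n. {x \<in> words l L 0 n. x n = b}) = words l L 0 n"
    by (auto simp: words_iff)
  finally show ?thesis by (simp add: nwords_def)
qed

lemma col_sum_pos:
  assumes "b \<in> alph l n"
  shows "1 \<le> col_sum l L n b"
proof -
  have "(\<lambda>i. if i = n then b else undefined) \<in> words l L n n"
    using assms by (auto simp: words_iff)
  then obtain y where y: "y \<in> words l L 0 n" "restrict y {n..n} = (\<lambda>i. if i = n then b else undefined)"
    using extend_word_left by blast
  have "y n = b" using fun_cong[OF y(2), of n] by simp
  then have "{x \<in> words l L 0 n. x n = b} \<noteq> {}" using y(1) by blast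
  then have "0 < card {x \<in> words l L 0 n. x n = b}" by (simp add: card_gt_0_iff)
  then show ?thesis using col_sum_eq_card[OF assms] by simp
qed

lemma Lprod_split:
  assumes "n \<le> m" "b \<in> alph l m" 
  shows "Lprod l L 0 m a b = (\<Sum>c\<in>alph l n. Lprod l L 0 n a c * Lprod l L n m c b)"
  using assms
proof (induction m arbitrary: b)
  case 0
  then show ?case by (simp add: if_distrib cong: if_cong)
next
  case (Suc m)
  show ?case
  proof (cases "n = Suc m")
    case True
    \<comment> \<open>Here the branch \<open>m < n\<close> of the recursion applies, which returns
      the identity matrix.\<close>
    have "Lprod l L n n c b = (if c = b then 1 else 0)" for c using True by simp
    then have "(\<Sum>c\<in>alph l n. Lprod l L 0 n a c * Lprod l L n n c b) =
        (\<Sum>c\<in>alph l n. if c = b then Lprod l L 0 n a c else 0)"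
      by (intro sum.cong) (simp_all del: Lprod.simps)
    then show ?thesis using True Suc.prems by (simp del: Lprod.simps)
  next
    case False
    then have "n \<le> m" using Suc.prems by simp
    then have "Lprod l L 0 (Suc m) a b =
        (\<Sum>e\<in>alph l m. (\<Sum>c\<in>alph l n. Lprod l L 0 n a c * Lprod l L n m c e) * L m e b)"
      using Suc.IH by simp
    also have "\<dots> = (\<Sum>e\<in>alph l m. \<Sum>c\<in>alph l n. Lprod l L 0 n a c * (Lprod l L n m c e * L m e b))"
      by (simp add: sum_distrib_right mult.assoc)
    also have "\<dots> = (\<Sum>c\<in>alph l n. \<Sum>e\<in>alph l m. Lprod l L 0 n a c * (Lprod l L n m c e * L m e b))"
      by (rule sum.swap)
    also have "\<dots> = (\<Sum>c\<in>alph l n. Lprod l L 0 n a c * Lprod l L n (Suc m) c b)"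
      using \<open>n \<le> m\<close> by (simp add: sum_distrib_left)
    finally show ?thesis .
  qed
qed

text \<open>Words ending in \<open>c\<close> continue to words ending in \<open>b\<close>, and
  different ones stay different. In matrix terms a single summand of \<open>Lprod_split\<close> is
  kept.\<close>

lemma col_sum_le_col_sum:
  assumes "n \<le> m" "b \<in> alph l m" "c \<in> alph l n" "Lprod l L n m c b \<ge> 1"
  shows "col_sum l L n c \<le> col_sum l L m b"
  unfolding col_sum_def
proof (rule sum_mono)
  fix a
  have "Lprod l L 0 n a c \<le> Lprod l L 0 n a c * Lprod l L n m c b" using assms(4) by simp
  also have "\<dots> \<le> (\<Sum>c\<in>alph l n. Lprod l L 0 n a c * Lprod l L n m c b)"
    using assms(3) by (intro member_le_sum) auto
  finally show "Lprod l L 0 n a c \<le> Lprod l L 0 m a b" using Lprod_split[OF assms(1,2)] by simp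
qed

subsection \<open>The metric on sequence spaces\<close>

text \<open>The \<open>Max\<close> in \<open>shift_dist\<close> is taken over a finite nonempty set:
  \<open>k\<close> belongs to it, and a time of disagreement bounds it. The last time
  \<open>r\<close> of agreement obtained here replaces the \<open>Max\<close> in all later
  estimates.\<close>

lemma shift_dist_cases:
  assumes "x \<in> Shift_space l L k" "y \<in> Shift_space l L k" "x \<noteq> y" "x k = y k"
  shows "\<exists>r\<ge>k. (\<forall>i\<in>{k..r}. x i = y i) \<and> x (Suc r) \<noteq> y (Suc r) \<and>
    shift_dist l L k x y = 1 / real (nwords l L k r)"
proof -
  define S where "S = {r. k \<le> r \<and> (\<forall>i\<in>{k..r}. x i = y i)}"
  obtain i where i: "x i \<noteq> y i" using assms(3) by blast
  then have "k \<le> i" using assms(1,2) by (metis Shift_space_iff not_le)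
  then have "S \<subseteq> {..<i}" using i by (auto simp: S_def not_less[symmetric])
  then have fin: "finite S" by (rule finite_subset) simp
  have "k \<in> S" using assms(4) by (simp add: S_def)
  then obtain R where R: "R \<in> S" "R = Max S" using Max_in[OF fin] by blast
  have r: "k \<le> R" "\<forall>i\<in>{k..R}. x i = y i" using R(1) by (simp_all add: S_def)
  have "x (Suc R) \<noteq> y (Suc R)"
  proof
    assume "x (Suc R) = y (Suc R)"
    then have "Suc R \<in> S" using r unfolding S_def by (simp add: atLeastAtMostSuc_conv)
    then have "Suc R \<le> Max S" using fin by (intro Max_ge)
    then show False using R(2) by simp
  qed
  moreover have "shift_dist l L k x y = 1 / real (nwords l L k R)"
    using assms R(2) by (simp add: shift_dist_def S_def)
  ultimately show ?thesis using r by blast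
qed

lemma one_div_nwords_le_one: "k \<le> r \<Longrightarrow> 1 / real (nwords l L k r) \<le> 1"
  using nwords_pos[of k r] by simp

lemma one_div_nwords_antimono:
  assumes "k \<le> r" "r \<le> r'"
  shows "1 / real (nwords l L k r') \<le> 1 / real (nwords l L k r)"
  using nwords_mono[OF assms] nwords_pos[OF assms(1)] by (intro divide_left_mono) auto

lemma shift_dist_le:
  assumes "x \<in> Shift_space l L k" "y \<in> Shift_space l L k" "k \<le> r"
    and "\<And>i. i \<in> {k..r} \<Longrightarrow> x i = y i"
  shows "shift_dist l L k x y \<le> 1 / real (nwords l L k r)"
proof (cases "x = y")
  case True then show ?thesis by (simp add: shift_dist_def)
next
  case False
  have "x k = y k" using assms by simp
  then obtain r' where r': "k \<le> r'" "x (Suc r') \<noteq> y (Suc r')"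
    "shift_dist l L k x y = 1 / real (nwords l L k r')"
    using shift_dist_cases[OF assms(1,2) False] by blast
  have "r \<le> r'" using r' assms(4)[of "Suc r'"] by (cases "Suc r' \<le> r") auto
  then show ?thesis using r' one_div_nwords_antimono assms(3) by simp
qed

text \<open>A disagreement as late as \<open>Suc r\<close> still forces the last time of agreement
  to be at most \<open>r\<close>; this extra step is what the triangle inequality uses.\<close>

lemma shift_dist_ge:
  assumes "x \<in> Shift_space l L k" "y \<in> Shift_space l L k" "k \<le> r"
    and "k \<le> j" "j \<le> Suc r" "x j \<noteq> y j"
  shows "1 / real (nwords l L k r) \<le> shift_dist l L k x y"
proof (cases "x k = y k")
  case False
  then show ?thesis using one_div_nwords_le_one[OF assms(3)] by (auto simp: shift_dist_def)
next
  case True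
  have "x \<noteq> y" using assms by blast
  then obtain r' where r': "k \<le> r'" "\<forall>i\<in>{k..r'}. x i = y i"
    "shift_dist l L k x y = 1 / real (nwords l L k r')"
    using shift_dist_cases[OF assms(1,2) _ True] by blast
  have "r' \<le> r" using r'(2) assms(4-6) by (cases "j \<le> r'") auto
  then show ?thesis using r' one_div_nwords_antimono by simp
qed

lemma shift_dist_le_one:
  assumes "x \<in> Shift_space l L k" "y \<in> Shift_space l L k"
  shows "shift_dist l L k x y \<le> 1"
proof (cases "x k = y k")
  case True
  then have "shift_dist l L k x y \<le> 1 / real (nwords l L k k)"
    using assms by (intro shift_dist_le) auto
  then show ?thesis using one_div_nwords_le_one[of k k] by simp
qed (auto simp: shift_dist_def)

lemma Metric_space_shift: "Metric_space (Shift_space l L k) (shift_dist l L k)"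
proof
  fix x y show "0 \<le> shift_dist l L k x y" by (simp add: shift_dist_def)
  show "shift_dist l L k x y = shift_dist l L k y x"
  proof -
    have "{r. k \<le> r \<and> (\<forall>i\<in>{k..r}. x i = y i)} = {r. k \<le> r \<and> (\<forall>i\<in>{k..r}. y i = x i)}"
      by (auto simp: eq_commute)
    then show ?thesis by (simp add: shift_dist_def eq_commute)
  qed
next
  fix x y assume x: "x \<in> Shift_space l L k" and y: "y \<in> Shift_space l L k"
  show "shift_dist l L k x y = 0 \<longleftrightarrow> x = y"
  proof (cases "x = y \<or> x k \<noteq> y k")
    case False
    then have "x \<noteq> y" "x k = y k" by auto
    from shift_dist_cases[OF x y this] obtain r where
      "k \<le> r" "shift_dist l L k x y = 1 / real (nwords l L k r)" by blast
    then show ?thesis using False nwords_pos[of k r] by auto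
  qed (auto simp: shift_dist_def)
  fix z assume z: "z \<in> Shift_space l L k"
  have nn: "\<And>u v. 0 \<le> shift_dist l L k u v" by (simp add: shift_dist_def)
  \<comment> \<open>An ultrametric inequality: at the first time where \<open>x\<close> and
    \<open>z\<close> differ, \<open>y\<close> must differ from one of them.\<close>
  have "shift_dist l L k x z \<le> shift_dist l L k x y \<or> shift_dist l L k x z \<le> shift_dist l L k y z"
  proof (cases "x = z")
    case True then show ?thesis using nn by (simp add: shift_dist_def)
  next
    case ne: False
    show ?thesis
    proof (cases "x k = z k")
      case False
      then have "x k \<noteq> y k \<or> y k \<noteq> z k" by auto
      then have "shift_dist l L k x y = 1 \<or> shift_dist l L k y z = 1"
        by (auto simp: shift_dist_def)
      then show ?thesis using shift_dist_le_one[OF x z] by auto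
    next
      case True
      obtain r where r: "k \<le> r" "x (Suc r) \<noteq> z (Suc r)"
        "shift_dist l L k x z = 1 / real (nwords l L k r)"
        using shift_dist_cases[OF x z ne True] by blast
      show ?thesis
      proof (cases "x (Suc r) = y (Suc r)")
        case True
        then show ?thesis using shift_dist_ge[OF y z r(1), of "Suc r"] r by simp
      next
        case False
        then show ?thesis using shift_dist_ge[OF x y r(1), of "Suc r"] r by simp
      qed
    qed
  qed
  then show "shift_dist l L k x z \<le> shift_dist l L k x y + shift_dist l L k y z"
    using nn[of x y] nn[of y z] by linarith
qed

lemma shift_dist_less_n_fun:
  assumes "0 < \<epsilon>" "x \<in> Shift_space l L k" "y \<in> Shift_space l L k"
    and "\<And>i. i \<in> {k..n_fun l L k \<epsilon>} \<Longrightarrow> x i = y i"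
  shows "shift_dist l L k x y < \<epsilon>"
proof -
  have "shift_dist l L k x y \<le> 1 / real (nwords l L k (n_fun l L k \<epsilon>))"
    using assms n_fun_ge by (intro shift_dist_le) auto
  also have "\<dots> < \<epsilon>"
    using nwords_n_fun[of \<epsilon> k] assms(1) nwords_pos[OF n_fun_ge, of k \<epsilon>] by (simp add: field_simps)
  finally show ?thesis .
qed

text \<open>If the last agreement precedes the end of the window, the word count there is at most
  1/\<epsilon>, so the distance is at least \<epsilon>. Disagreement already at time
  \<open>k\<close> gives only distance 1, hence the minimum.\<close>

lemma shift_dist_ge_n_fun:
  assumes "0 < \<epsilon>" "x \<in> Shift_space l L k" "y \<in> Shift_space l L k"
    and "j \<in> {k..n_fun l L k \<epsilon>}" "x j \<noteq> y j"
  shows "min 1 \<epsilon> \<le> shift_dist l L k x y"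
proof (cases "x k = y k")
  case False then show ?thesis by (auto simp: shift_dist_def)
next
  case True
  have "x \<noteq> y" using assms by blast
  then obtain r where r: "k \<le> r" "\<forall>i\<in>{k..r}. x i = y i"
    "shift_dist l L k x y = 1 / real (nwords l L k r)"
    using shift_dist_cases[OF assms(2,3) _ True] by blast
  have "r < n_fun l L k \<epsilon>" using r(2) assms(4,5) by (cases "j \<le> r") auto
  then have "real (nwords l L k r) \<le> 1 / \<epsilon>" using nwords_less_n_fun r(1) by blast
  then have "\<epsilon> \<le> 1 / real (nwords l L k r)"
    using assms(1) nwords_pos[OF r(1)] by (simp add: field_simps)
  then show ?thesis using r by simp
qed

section \<open>Topology, compactness and Borel sets in terms of cylinders\<close>

lemma cylinder_subset: "cylinder l L k m x \<subseteq> Shift_space l L k"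
  by (auto simp: cylinder_def)

text \<open>Cylinders and balls are cofinal: the ball of radius \<open>r\<close> contains the
  cylinder on the window that ends at \<open>n_fun l L k r\<close>, and the ball whose radius is the
  inverse word count lies in the cylinder. From here on open sets are handled without the
  metric.\<close>

lemma openin_shift_topology_iff:
  "openin (mtop (Shift_space l L k) (shift_dist l L k)) U \<longleftrightarrow>
    U \<subseteq> Shift_space l L k \<and> (\<forall>x\<in>U. \<exists>m\<ge>k. cylinder l L k m x \<subseteq> U)"
proof -
  interpret S: Metric_space "Shift_space l L k" "shift_dist l L k" by (rule Metric_space_shift)
  have 1: "\<exists>m\<ge>k. cylinder l L k m x \<subseteq> S.mball x r" if "x \<in> Shift_space l L k" "0 < r" for x r
  proof (intro exI[of _ "n_fun l L k r"] conjI n_fun_ge subsetI)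
    fix y assume "y \<in> cylinder l L k (n_fun l L k r) x"
    then have "y \<in> Shift_space l L k" "\<And>i. i \<in> {k..n_fun l L k r} \<Longrightarrow> x i = y i"
      by (auto simp: cylinder_def)
    then show "y \<in> S.mball x r" using shift_dist_less_n_fun[OF that(2,1)] that by simp
  qed
  have 2: "S.mball x (1 / real (nwords l L k m)) \<subseteq> cylinder l L k m x" if "k \<le> m" for x m
  proof
    fix y assume y: "y \<in> S.mball x (1 / real (nwords l L k m))"
    then have xy: "x \<in> Shift_space l L k" "y \<in> Shift_space l L k" by auto
    have "x i = y i" if "i \<in> {k..m}" for i
    proof (rule ccontr)
      assume "x i \<noteq> y i"
      then have "1 / real (nwords l L k m) \<le> shift_dist l L k x y"
        using shift_dist_ge[OF xy \<open>k \<le> m\<close>, of i] that by auto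
      then show False using y by simp
    qed
    then show "y \<in> cylinder l L k m x" using xy by (auto simp: cylinder_def)
  qed
  show ?thesis
    unfolding S.openin_mtopology
  proof (intro iffI conjI ballI)
    fix x assume U: "U \<subseteq> Shift_space l L k \<and> (\<forall>x. x \<in> U \<longrightarrow> (\<exists>r>0. S.mball x r \<subseteq> U))" and "x \<in> U"
    then show "\<exists>m\<ge>k. cylinder l L k m x \<subseteq> U" using 1 by (meson subsetD subset_trans)
  next
    assume U: "U \<subseteq> Shift_space l L k \<and> (\<forall>x\<in>U. \<exists>m\<ge>k. cylinder l L k m x \<subseteq> U)"
    show "\<forall>x. x \<in> U \<longrightarrow> (\<exists>r>0. S.mball x r \<subseteq> U)"
    proof (intro allI impI)
      fix x assume "x \<in> U"
      then obtain m where m: "m \<ge> k" "cylinder l L k m x \<subseteq> U" using U by blast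
      then show "\<exists>r>0. S.mball x r \<subseteq> U"
        using 2[OF m(1), of x] nwords_pos[OF m(1)]
        by (intro exI[of _ "1 / real (nwords l L k m)"]) auto
    qed
  qed auto
qed

lemma openin_cylinder:
  assumes "k \<le> m"
  shows "openin (mtop (Shift_space l L k) (shift_dist l L k)) (cylinder l L k m x)"
  unfolding openin_shift_topology_iff
proof (intro conjI ballI cylinder_subset)
  fix y assume "y \<in> cylinder l L k m x"
  then show "\<exists>m'\<ge>k. cylinder l L k m' y \<subseteq> cylinder l L k m x"
    using assms by (intro exI[of _ m]) (auto simp: cylinder_def)
qed

text \<open>Compactness is transported from the product of the finite discrete alphabets.\<close>

lemma compactin_cylinder:
  "compactin (mtop (Shift_space l L k) (shift_dist l L k)) (cylinder l L k m x)"
proof -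
  let ?X = "Shift_space l L k"
  define T where "T = product_topology (\<lambda>i. discrete_topology (alph l i)) {k..}"
  have topT: "topspace T = (\<Pi>\<^sub>E i\<in>{k..}. alph l i)" by (simp add: T_def)
  have compT: "compact_space T"
    unfolding T_def compact_space_product_topology by (auto simp: compact_space_discrete_topology)
  have proj: "continuous_map T (discrete_topology (alph l i)) (\<lambda>y. y i)" if "k \<le> i" for i
    unfolding T_def using that by (intro continuous_map_product_projection) auto
  have clopen: "closedin T {y \<in> topspace T. y i \<in> A}" "openin T {y \<in> topspace T. y i \<in> A}"
    if "k \<le> i" for i A
  proof -
    have eq: "{y \<in> topspace T. y i \<in> A} = {y \<in> topspace T. y i \<in> A \<inter> alph l i}"
      using that by (auto simp: topT)
    show "closedin T {y \<in> topspace T. y i \<in> A}" unfolding eq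
      by (rule closedin_continuous_map_preimage[OF proj[OF that]]) auto
    show "openin T {y \<in> topspace T. y i \<in> A}" unfolding eq
      by (rule openin_continuous_map_preimage[OF proj[OF that]]) auto
  qed
  have step: "closedin T {y \<in> topspace T. L i (y i) (y (Suc i)) = 1}" if "k \<le> i" for i
  proof -
    have "{y \<in> topspace T. L i (y i) (y (Suc i)) = 1} =
      (\<Union>a\<in>alph l i. {y \<in> topspace T. y i \<in> {a}} \<inter> {y \<in> topspace T. y (Suc i) \<in> {b. L i a b = 1}})"
      using that by (auto simp: topT)
    moreover have "closedin T \<dots>"
    proof (rule closedin_Union)
      fix S assume "S \<in> (\<lambda>a. {y \<in> topspace T. y i \<in> {a}} \<inter> {y \<in> topspace T. y (Suc i) \<in> {b. L i a b = 1}}) ` alph l i"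
      then show "closedin T S" using that by (auto simp only: intro!: closedin_Int clopen(1))
    qed simp
    ultimately show ?thesis by simp
  qed
  have "cylinder l L k m x = (\<Inter>i\<in>{k..}. {y \<in> topspace T. L i (y i) (y (Suc i)) = 1}) \<inter>
      (\<Inter>i\<in>{k..}. {y \<in> topspace T. y i \<in> {a. i \<le> m \<longrightarrow> a = x i}})"
    unfolding cylinder_def Shift_space_def topT by auto
  moreover have "closedin T \<dots>"
    by (intro closedin_Int closedin_Inter)
      (auto simp del: mem_Collect_eq One_nat_def simp flip: One_nat_def intro!: step clopen(1))
  ultimately have "closedin T (cylinder l L k m x)" by simp
  then have "compactin T (cylinder l L k m x)" using compT closedin_compact_space by blast
  then have comp: "compactin (subtopology T ?X) (cylinder l L k m x)"
    by (simp add: compactin_subtopology cylinder_subset)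
  have XT: "?X \<subseteq> topspace T" by (auto simp: topT Shift_space_def)
  have opencyl: "openin (subtopology T ?X) (cylinder l L k r y)" if "k \<le> r" for r y
  proof -
    have "openin T (\<Inter>i\<in>{k..r}. {z \<in> topspace T. z i \<in> {y i}})"
      using that by (intro openin_Inter) (auto simp del: singleton_iff insert_iff intro!: clopen(2))
    moreover have "cylinder l L k r y = ?X \<inter> (\<Inter>i\<in>{k..r}. {z \<in> topspace T. z i \<in> {y i}})"
      using XT that by (auto simp: cylinder_def)
    ultimately show ?thesis by (simp only: openin_subtopology_Int2)
  qed
  \<comment> \<open>Compactness is pushed forward by the identity, so continuity in this one
    direction suffices and the two topologies need not be compared further.\<close>
  have "continuous_map (subtopology T ?X) (mtop ?X (shift_dist l L k)) id"
    unfolding continuous_map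
  proof (intro conjI allI impI)
    have "topspace (mtop ?X (shift_dist l L k)) = ?X"
      by (rule Metric_space.topspace_mtopology[OF Metric_space_shift])
    then show "id ` topspace (subtopology T ?X) \<subseteq> topspace (mtop ?X (shift_dist l L k))" by auto
    fix U assume U: "openin (mtop ?X (shift_dist l L k)) U"
    have "openin (subtopology T ?X) U"
    proof (subst openin_subopen, intro ballI)
      fix y assume y: "y \<in> U"
      then obtain r where "r \<ge> k" "cylinder l L k r y \<subseteq> U"
        using U unfolding openin_shift_topology_iff by blast
      moreover have "y \<in> cylinder l L k r y"
        using y U unfolding openin_shift_topology_iff by (auto simp: cylinder_def)
      ultimately show "\<exists>V. openin (subtopology T ?X) V \<and> y \<in> V \<and> V \<subseteq> U"
        using opencyl by blast
    qed
    moreover have "U \<subseteq> ?X" using U openin_shift_topology_iff by blast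
    moreover from this have "{y \<in> topspace (subtopology T ?X). id y \<in> U} = U" using XT by auto
    ultimately show "openin (subtopology T ?X) {y \<in> topspace (subtopology T ?X). id y \<in> U}" by simp
  qed
  from image_compactin[OF comp this] show ?thesis by simp
qed

text \<open>The empty set makes the family closed under intersection, as cylinders are nested or
  disjoint. Only admissible words are used, so that the Parry formula applies to every other
  member.\<close>

definition cyl_sets :: "nat \<Rightarrow> (nat \<Rightarrow> nat) set set" where
  "cyl_sets k = insert {} (\<Union>m\<in>{k..}. cylinder l L k m ` words l L k m)"

lemma cylinder_restrict:
  "cylinder l L k m (restrict x {k..m}) = cylinder l L k m x"
  by (auto simp: cylinder_def)

lemma cylinder_mem_cyl_sets:
  assumes "k \<le> m" "x \<in> Shift_space l L k"
  shows "cylinder l L k m x \<in> cyl_sets k"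
  using assms restrict_mem_words[of x k k m] cylinder_restrict[of k m x]
  unfolding cyl_sets_def by (intro insertI2 UN_I[of m] image_eqI[of _ _ "restrict x {k..m}"]) auto

text \<open>There are only countably many cylinders over words, so every open set is a countable
  union of them.\<close>

lemma sets_shift_borel:
  "sets (mborel (Shift_space l L k) (shift_dist l L k)) = sigma_sets (Shift_space l L k) (cyl_sets k)"
proof -
  let ?X = "Shift_space l L k"
  let ?O = "{U. openin (mtop ?X (shift_dist l L k)) U}"
  have "?O \<subseteq> Pow ?X" by (auto simp: openin_shift_topology_iff)
  then have "sets (mborel ?X (shift_dist l L k)) = sigma_sets ?X ?O"
    by (simp add: mborel_def)
  also have "\<dots> = sigma_sets ?X (cyl_sets k)"
  proof (rule sigma_sets_eqI)
    fix U assume "U \<in> ?O"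
    then have U: "U \<subseteq> ?X" "\<And>x. x \<in> U \<Longrightarrow> \<exists>m\<ge>k. cylinder l L k m x \<subseteq> U"
      by (auto simp: openin_shift_topology_iff)
    have "U = \<Union>{V \<in> cyl_sets k. V \<subseteq> U}"
    proof (intro equalityI subsetI)
      fix x assume x: "x \<in> U"
      then obtain m where "m \<ge> k" "cylinder l L k m x \<subseteq> U" using U by blast
      moreover have "x \<in> cylinder l L k m x" using x U by (auto simp: cylinder_def)
      ultimately show "x \<in> \<Union>{V \<in> cyl_sets k. V \<subseteq> U}"
        using x U cylinder_mem_cyl_sets by blast
    qed auto
    moreover have "countable {V \<in> cyl_sets k. V \<subseteq> U}"
    proof (rule countable_subset[of _ "cyl_sets k"])
      show "countable (cyl_sets k)" unfolding cyl_sets_def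
        by (intro countable_insert countable_UN) (auto intro: countable_finite)
    qed auto
    ultimately show "U \<in> sigma_sets ?X (cyl_sets k)"
      by (metis (no_types, lifting) mem_Collect_eq sigma_sets.Basic sigma_sets_UNION)
  next
    fix V assume "V \<in> cyl_sets k"
    then have "V \<in> ?O" using openin_cylinder by (auto simp: cyl_sets_def)
    then show "V \<in> sigma_sets ?X ?O" by (rule sigma_sets.Basic)
  qed
  finally show ?thesis .
qed

lemma cylinder_Int:
  assumes "m \<le> m'"
  shows "cylinder l L k m x \<inter> cylinder l L k m' y =
    (if \<forall>i\<in>{k..m}. x i = y i then cylinder l L k m' y else {})"
proof (cases "\<forall>i\<in>{k..m}. x i = y i")
  case False
  then obtain i where "i \<in> {k..m}" "x i \<noteq> y i" by blast
  then show ?thesis using assms by (auto simp: cylinder_def)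
qed (use assms in \<open>auto simp: cylinder_def\<close>)

lemma Int_stable_cyl_sets: "Int_stable (cyl_sets k)"
proof (rule Int_stableI)
  fix A B assume A: "A \<in> cyl_sets k" and B: "B \<in> cyl_sets k"
  show "A \<inter> B \<in> cyl_sets k"
  proof (cases "A = {} \<or> B = {}")
    case True then show ?thesis by (auto simp: cyl_sets_def)
  next
    case False
    then obtain m x m' y where 1: "k \<le> m" "x \<in> words l L k m" "A = cylinder l L k m x"
      "k \<le> m'" "y \<in> words l L k m'" "B = cylinder l L k m' y"
      using A B by (auto simp: cyl_sets_def)
    show ?thesis
    proof (cases "m \<le> m'")
      case True
      then show ?thesis using 1 A B cylinder_Int[OF True] by (auto simp: cyl_sets_def)
    next
      case False
      then have "m' \<le> m" by simp
      then show ?thesis using 1 A B cylinder_Int[of m' m k y x] by (auto simp: cyl_sets_def Int_commute)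
    qed
  qed
qed

lemma cylinder_nonempty:
  assumes "x \<in> words l L k m" "k \<le> m"
  shows "cylinder l L k m x \<noteq> {}"
proof -
  obtain y where "y \<in> Shift_space l L k" "\<And>i. i \<in> {k..m} \<Longrightarrow> y i = x i"
    using extend_word[OF assms] by blast
  then have "y \<in> cylinder l L k m x" by (simp add: cylinder_def)
  then show ?thesis by blast
qed

lemma disjoint_family_cylinder: "disjoint_family_on (cylinder l L k m) (words l L k m)"
  unfolding disjoint_family_on_def
proof (intro ballI impI)
  fix x y assume "x \<in> words l L k m" "y \<in> words l L k m" "x \<noteq> y"
  then obtain i where "x i \<noteq> y i" "i \<in> {k..m}"
    by (metis atLeastAtMost_iff ext words_iff)
  then show "cylinder l L k m x \<inter> cylinder l L k m y = {}" by (auto simp: cylinder_def)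
qed

lemma UN_cylinder:
  assumes "k \<le> m"
  shows "(\<Union>x\<in>words l L k m. cylinder l L k m x) = Shift_space l L k"
proof
  show "Shift_space l L k \<subseteq> (\<Union>x\<in>words l L k m. cylinder l L k m x)"
    using assms by (intro subsetI UN_I[OF restrict_mem_words]) (auto simp: cylinder_def)
qed (use cylinder_subset in blast)

lemma inj_on_cylinder:
  assumes "k \<le> m"
  shows "inj_on (cylinder l L k m) (words l L k m)"
  using disjoint_family_cylinder[of k m] cylinder_nonempty[OF _ assms]
  unfolding disjoint_family_on_def inj_on_def by (metis inf.idem)

lemma partition_on_cylinders:
  assumes "k \<le> m"
  shows "partition_on (Shift_space l L k) (cylinder l L k m ` words l L k m)"
proof (rule partition_onI)
  show "\<Union> (cylinder l L k m ` words l L k m) = Shift_space l L k" by (rule UN_cylinder[OF assms])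
  show "{} \<notin> cylinder l L k m ` words l L k m"
    using cylinder_nonempty[OF _ assms] by blast
  show "disjnt p q" if pq: "p \<in> cylinder l L k m ` words l L k m"
    "q \<in> cylinder l L k m ` words l L k m" "p \<noteq> q" for p q
  proof -
    obtain u where u: "u \<in> words l L k m" "p = cylinder l L k m u" using pq(1) by blast
    obtain v where v: "v \<in> words l L k m" "q = cylinder l L k m v" using pq(2) by blast
    have "u \<noteq> v" using u v pq(3) by blast
    then show ?thesis
      using u v disjoint_family_onD[OF disjoint_family_cylinder] by (simp add: disjnt_def)
  qed
qed

end

section \<open>Parry measures\<close>

locale parry_shift = nonstationary_shift +
  fixes wh vh :: "nat \<Rightarrow> nat \<Rightarrow> real" and \<mu> :: "nat \<Rightarrow> (nat \<Rightarrow> nat) measure"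
  assumes parry: "parry_ims l L wh vh \<mu>"
begin

abbreviation "\<pi> \<equiv> parry_pi l wh vh"
abbreviation "v \<equiv> parry_v l wh vh"
abbreviation "w \<equiv> parry_w l wh"
abbreviation "lam \<equiv> parry_lambda l wh"

section \<open>Normalized Parry vectors\<close>

lemma wh_pos: "a \<in> alph l i \<Longrightarrow> 0 < wh i a" and vh_pos: "a \<in> alph l i \<Longrightarrow> 0 < vh i a"
  using parry unfolding parry_ims_def parry_vectors_def by blast+

lemma wh_eq: "a \<in> alph l i \<Longrightarrow> wh i a = (\<Sum>b\<in>alph l (Suc i). real (L i a b) * wh (Suc i) b)"
  using parry by (simp add: parry_ims_def parry_vectors_def)

lemma vh_eq: "b \<in> alph l (Suc i) \<Longrightarrow> (\<Sum>a\<in>alph l i. vh i a * real (L i a b)) = vh (Suc i) b"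
  using parry by (simp add: parry_ims_def parry_vectors_def)

lemma l1norm_pos: "0 < l1norm l wh i"
proof -
  have "0 < \<bar>wh i a\<bar>" if "a \<in> alph l i" for a using wh_pos[OF that] by simp
  then show ?thesis unfolding l1norm_def using alph_nonempty by (intro sum_pos) auto
qed

lemma w_pos: "a \<in> alph l i \<Longrightarrow> 0 < w i a"
  using wh_pos l1norm_pos by (simp add: parry_w_def)

lemma vh_w_pos: "0 < (\<Sum>b\<in>alph l i. vh i b * w i b)"
  using alph_nonempty vh_pos w_pos by (intro sum_pos) auto

lemma v_pos: "a \<in> alph l i \<Longrightarrow> 0 < v i a"
  using vh_pos vh_w_pos by (simp add: parry_v_def)

lemma pi_pos: "a \<in> alph l i \<Longrightarrow> 0 < \<pi> i a"
  using v_pos w_pos by (simp add: parry_pi_def)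

lemma sum_pi: "(\<Sum>a\<in>alph l i. \<pi> i a) = 1"
  using vh_w_pos[of i] by (simp add: parry_pi_def parry_v_def flip: sum_divide_distrib)

lemma pi_le_one: "a \<in> alph l i \<Longrightarrow> \<pi> i a \<le> 1"
  using sum_pi[of i] pi_pos
  by (metis finite_alph less_eq_real_def member_le_sum[of a "alph l i" "\<pi> i"] DiffD1)

lemma lam_pos: "0 < lam k m"
  unfolding parry_lambda_def using l1norm_pos by (intro prod_pos) auto

text \<open>The pairing of \<open>vh\<close> and \<open>wh\<close> does not depend on time, because
  the matrix can be moved from one vector to the other. As \<open>s j\<close> times the norm of
  \<open>wh\<close> at time \<open>j\<close> is this constant, the normalizer \<open>s\<close> of
  \<open>v\<close> changes from \<open>i\<close> to \<open>Suc i\<close> by exactly the factor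
  \<open>lam i (Suc i)\<close>.\<close>

lemma v_step:
  assumes "b \<in> alph l (Suc i)"
  shows "(\<Sum>a\<in>alph l i. v i a * real (L i a b)) = lam i (Suc i) * v (Suc i) b"
proof -
  define s where "s j = (\<Sum>b\<in>alph l j. vh j b * w j b)" for j
  have s_pos: "0 < s j" for j using vh_w_pos by (simp add: s_def)
  have "(\<Sum>b\<in>alph l (Suc i). vh (Suc i) b * wh (Suc i) b) =
      (\<Sum>b\<in>alph l (Suc i). \<Sum>a\<in>alph l i. vh i a * real (L i a b) * wh (Suc i) b)"
    by (intro sum.cong refl) (simp add: vh_eq[symmetric] sum_distrib_right)
  also have "\<dots> = (\<Sum>a\<in>alph l i. \<Sum>b\<in>alph l (Suc i). vh i a * real (L i a b) * wh (Suc i) b)"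
    by (rule sum.swap)
  also have "\<dots> = (\<Sum>a\<in>alph l i. vh i a * wh i a)"
    by (intro sum.cong refl) (simp add: wh_eq sum_distrib_left mult.assoc)
  finally have eq: "(\<Sum>b\<in>alph l (Suc i). vh (Suc i) b * wh (Suc i) b) = (\<Sum>a\<in>alph l i. vh i a * wh i a)" .
  have s_eq: "s j * l1norm l wh j = (\<Sum>a\<in>alph l j. vh j a * wh j a)" for j
    using l1norm_pos[of j] by (simp add: s_def parry_w_def sum_distrib_right)
  have lam: "lam i (Suc i) = s (Suc i) / s i"
    using eq s_eq[of i] s_eq[of "Suc i"] s_pos[of i] l1norm_pos[of i] l1norm_pos[of "Suc i"]
    by (simp add: parry_lambda_def field_simps)
  have "(\<Sum>a\<in>alph l i. v i a * real (L i a b)) = (\<Sum>a\<in>alph l i. vh i a * real (L i a b)) / s i"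
    by (simp add: parry_v_def s_def sum_divide_distrib)
  also have "\<dots> = vh (Suc i) b / s i" by (simp add: vh_eq[OF assms])
  also have "\<dots> = lam i (Suc i) * v (Suc i) b"
    using s_pos[of i] s_pos[of "Suc i"] unfolding lam by (simp add: parry_v_def s_def)
  finally show ?thesis .
qed

lemma lam_Suc: "k \<le> m \<Longrightarrow> lam k (Suc m) = lam k m * lam m (Suc m)"
  by (simp add: parry_lambda_def)

lemma lam_head: "k < m \<Longrightarrow> lam k m = lam k (Suc k) * lam (Suc k) m"
  unfolding parry_lambda_def by (simp add: prod.atLeast_Suc_lessThan)

lemma v_Lprod:
  assumes "b \<in> alph l n"
  shows "(\<Sum>a\<in>alph l 0. v 0 a * real (Lprod l L 0 n a b)) = lam 0 n * v n b"
  using assms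
proof (induction n arbitrary: b)
  case 0
  have "(\<Sum>a\<in>alph l 0. v 0 a * real (Lprod l L 0 0 a b)) = (\<Sum>a\<in>alph l 0. if a = b then v 0 a else 0)"
    by (intro sum.cong) auto
  then show ?case using 0 by (simp add: parry_lambda_def)
next
  case (Suc n)
  have "(\<Sum>a\<in>alph l 0. v 0 a * real (Lprod l L 0 (Suc n) a b)) =
      (\<Sum>a\<in>alph l 0. \<Sum>c\<in>alph l n. v 0 a * real (Lprod l L 0 n a c) * real (L n c b))"
    by (simp add: sum_distrib_left mult.assoc)
  also have "\<dots> = (\<Sum>c\<in>alph l n. \<Sum>a\<in>alph l 0. v 0 a * real (Lprod l L 0 n a c) * real (L n c b))"
    by (rule sum.swap)
  also have "\<dots> = (\<Sum>c\<in>alph l n. lam 0 n * v n c * real (L n c b))"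
    by (intro sum.cong refl) (simp add: Suc.IH flip: sum_distrib_right)
  also have "\<dots> = lam 0 n * (\<Sum>c\<in>alph l n. v n c * real (L n c b))"
    by (simp add: sum_distrib_left mult.assoc)
  also have "\<dots> = lam 0 (Suc n) * v (Suc n) b"
    using v_step[OF Suc.prems] lam_Suc[of 0 n] by simp
  finally show ?case .
qed

section \<open>Invariance of the Parry measures\<close>

lemma prob_space_mu: "prob_space (\<mu> k)"
  and space_mu: "space (\<mu> k) = Shift_space l L k"
  and sets_mu_borel: "sets (\<mu> k) = sets (mborel (Shift_space l L k) (shift_dist l L k))"
  using parry by (auto simp: parry_ims_def)

lemma sets_mu: "sets (\<mu> k) = sigma_sets (Shift_space l L k) (cyl_sets k)"
  by (simp add: sets_mu_borel sets_shift_borel)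

lemma measure_cylinder:
  "k \<le> m \<Longrightarrow> x \<in> words l L k m \<Longrightarrow>
    measure (\<mu> k) (cylinder l L k m x) = v k (x k) * w m (x m) / lam k m"
  using parry by (simp add: parry_ims_def)

lemma cyl_sets_subset: "cyl_sets k \<subseteq> Pow (Shift_space l L k)"
  using cylinder_subset by (auto simp: cyl_sets_def)

lemma cyl_sets_measurable: "A \<in> cyl_sets k \<Longrightarrow> A \<in> sets (\<mu> k)"
  by (simp add: sets_mu)

lemma cylinder_measurable: "k \<le> m \<Longrightarrow> x \<in> words l L k m \<Longrightarrow> cylinder l L k m x \<in> sets (\<mu> k)"
  by (rule cyl_sets_measurable) (auto simp: cyl_sets_def)

lemma cons_word:
  assumes "y \<in> words l L (Suc k) m" "Suc k \<le> m" "a \<in> alph l k" "L k a (y (Suc k)) = 1"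
  shows "y(k := a) \<in> words l L k m"
  using assms by (auto simp: words_iff not_less_eq_eq le_Suc_eq)

lemma shift_map_vimage_cylinder:
  assumes y: "y \<in> words l L (Suc k) m" and km: "Suc k \<le> m"
  shows "shift_map k -` cylinder l L (Suc k) m y \<inter> Shift_space l L k =
    (\<Union>a\<in>{a\<in>alph l k. L k a (y (Suc k)) = 1}. cylinder l L k m (y(k := a)))"
proof (intro equalityI subsetI)
  fix x assume "x \<in> shift_map k -` cylinder l L (Suc k) m y \<inter> Shift_space l L k"
  then have x: "x \<in> Shift_space l L k" "\<And>i. i \<in> {Suc k..m} \<Longrightarrow> x i = y i"
    by (auto simp: cylinder_def shift_map_def)
  have 1: "x k \<in> alph l k" "L k (x k) (x (Suc k)) = 1"
    using x(1) by (auto simp: Shift_space_iff)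
  have "x \<in> cylinder l L k m (y(k := x k))"
    using x by (auto simp: cylinder_def)
  moreover have "x k \<in> {a\<in>alph l k. L k a (y (Suc k)) = 1}"
    using 1 x(2)[of "Suc k"] km by simp
  ultimately show "x \<in> (\<Union>a\<in>{a\<in>alph l k. L k a (y (Suc k)) = 1}. cylinder l L k m (y(k := a)))"
    by blast
next
  fix x assume "x \<in> (\<Union>a\<in>{a\<in>alph l k. L k a (y (Suc k)) = 1}. cylinder l L k m (y(k := a)))"
  then obtain a where x: "x \<in> Shift_space l L k" "\<forall>i\<in>{k..m}. x i = (y(k := a)) i"
    by (auto simp: cylinder_def)
  then show "x \<in> shift_map k -` cylinder l L (Suc k) m y \<inter> Shift_space l L k"
    using restrict_mem_Shift_space[OF x(1), of "Suc k"] by (auto simp: cylinder_def shift_map_def)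
qed

lemma shift_map_measurable: "shift_map k \<in> measurable (\<mu> k) (\<mu> (Suc k))"
proof (rule measurable_sigma_sets[OF sets_mu cyl_sets_subset])
  show "shift_map k \<in> space (\<mu> k) \<rightarrow> Shift_space l L (Suc k)"
    using restrict_mem_Shift_space[of _ k "Suc k"] by (auto simp: space_mu shift_map_def)
  fix A assume "A \<in> cyl_sets (Suc k)"
  then consider "A = {}" | m y where "Suc k \<le> m" "y \<in> words l L (Suc k) m" "A = cylinder l L (Suc k) m y"
    by (auto simp: cyl_sets_def)
  then show "shift_map k -` A \<inter> space (\<mu> k) \<in> sets (\<mu> k)"
  proof cases
    case 2
    have "cylinder l L k m (y(k := a)) \<in> sets (\<mu> k)" if "a \<in> alph l k" "L k a (y (Suc k)) = 1" for a
      using cons_word[OF 2(2,1) that] 2(1) by (intro cylinder_measurable) auto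
    then show ?thesis
      unfolding 2(3) space_mu shift_map_vimage_cylinder[OF 2(2,1)] by (intro sets.finite_UN) auto
  qed simp
qed

text \<open>\<open>parry_ims\<close> prescribes only the values on cylinders, so invariance is
  derived. The preimage of a cylinder is a disjoint union over the letters that can be prepended; by
  \<open>v_step\<close> their sum produces the factor \<open>lam k (Suc k)\<close>, which cancels.
  Agreement on the intersection-stable generator then gives equality.\<close>

lemma distr_shift_map: "distr (\<mu> k) (\<mu> (Suc k)) (shift_map k) = \<mu> (Suc k)"
proof (rule measure_eqI_generator_eq_countable[OF Int_stable_cyl_sets cyl_sets_subset])
  interpret M: prob_space "\<mu> k" by (rule prob_space_mu)
  interpret N: prob_space "\<mu> (Suc k)" by (rule prob_space_mu)
  fix A assume "A \<in> cyl_sets (Suc k)"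
  then consider "A = {}" | m y where "Suc k \<le> m" "y \<in> words l L (Suc k) m" "A = cylinder l L (Suc k) m y"
    by (auto simp: cyl_sets_def)
  then show "emeasure (distr (\<mu> k) (\<mu> (Suc k)) (shift_map k)) A = emeasure (\<mu> (Suc k)) A"
  proof cases
    case 2
    let ?I = "{a\<in>alph l k. L k a (y (Suc k)) = 1}"
    have cons: "y(k := a) \<in> words l L k m" if "a \<in> ?I" for a
      using cons_word[OF 2(2,1)] that by simp
    have yS: "y (Suc k) \<in> alph l (Suc k)" using 2 by (simp add: words_iff)
    have "measure (\<mu> k) (shift_map k -` A \<inter> space (\<mu> k)) =
        measure (\<mu> k) (\<Union>a\<in>?I. cylinder l L k m (y(k := a)))"
      unfolding 2(3) space_mu shift_map_vimage_cylinder[OF 2(2,1)] ..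
    also have "\<dots> = (\<Sum>a\<in>?I. measure (\<mu> k) (cylinder l L k m (y(k := a))))"
    proof (rule M.finite_measure_finite_Union)
      show "(\<lambda>a. cylinder l L k m (y(k := a))) ` ?I \<subseteq> sets (\<mu> k)"
        using cons 2(1) by (auto intro!: cylinder_measurable)
      have "x k = a" if "x \<in> cylinder l L k m (y(k := a))" for x a
        using that 2(1) by (simp add: cylinder_def)
      then show "disjoint_family_on (\<lambda>a. cylinder l L k m (y(k := a))) ?I"
        unfolding disjoint_family_on_def by blast
    qed simp
    also have "\<dots> = (\<Sum>a\<in>?I. v k a * w m (y m) / lam k m)"
      using cons 2(1) by (intro sum.cong refl) (simp add: measure_cylinder)
    also have "\<dots> = (\<Sum>a\<in>alph l k. v k a * real (L k a (y (Suc k))) * w m (y m) / lam k m)"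
    proof (rule sum.mono_neutral_cong_left)
      show "\<forall>a\<in>alph l k - ?I. v k a * real (L k a (y (Suc k))) * w m (y m) / lam k m = 0"
        using L_01[OF _ yS] by fastforce
    qed auto
    also have "\<dots> = (\<Sum>a\<in>alph l k. v k a * real (L k a (y (Suc k)))) * w m (y m) / lam k m"
      by (simp add: sum_distrib_right sum_divide_distrib)
    also have "\<dots> = v (Suc k) (y (Suc k)) * w m (y m) / lam (Suc k) m"
      using v_step[OF yS] lam_head[of k m] lam_pos[of k "Suc k"] 2(1) by simp
    also have "\<dots> = measure (\<mu> (Suc k)) A"
      using 2 by (simp add: measure_cylinder)
    finally have "measure (\<mu> k) (shift_map k -` A \<inter> space (\<mu> k)) = measure (\<mu> (Suc k)) A" .
    moreover have "A \<in> sets (\<mu> (Suc k))" using 2 cylinder_measurable by simp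
    ultimately show ?thesis
      by (simp add: emeasure_distr[OF shift_map_measurable] M.emeasure_eq_measure N.emeasure_eq_measure)
  qed simp
next
  \<comment> \<open>The cylinders of a single letter form the countable cover of finite measure that
    uniqueness requires.\<close>
  let ?A = "cylinder l L (Suc k) (Suc k) ` words l L (Suc k) (Suc k)"
  show "?A \<subseteq> cyl_sets (Suc k)" by (auto simp: cyl_sets_def)
  show "\<Union> ?A = Shift_space l L (Suc k)" by (rule UN_cylinder) simp
  show "countable ?A" by (intro countable_finite) simp
  interpret D: prob_space "distr (\<mu> k) (\<mu> (Suc k)) (shift_map k)"
    using prob_space.prob_space_distr[OF prob_space_mu shift_map_measurable] .
  show "emeasure (distr (\<mu> k) (\<mu> (Suc k)) (shift_map k)) a \<noteq> \<infinity>" for a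
    by (simp add: D.emeasure_eq_measure)
qed (auto simp: sets_mu)

lemma iterate_measurable: "iterate shift_map i \<in> measurable (\<mu> 0) (\<mu> i)"
proof (induction i)
  case (Suc i)
  show ?case unfolding iterate.simps by (rule measurable_comp[OF Suc shift_map_measurable])
qed simp

lemma distr_iterate: "distr (\<mu> 0) (\<mu> i) (iterate shift_map i) = \<mu> i"
proof (induction i)
  case 0
  then show ?case by (simp add: distr_id2)
next
  case (Suc i)
  have "distr (\<mu> 0) (\<mu> (Suc i)) (iterate shift_map (Suc i)) =
      distr (distr (\<mu> 0) (\<mu> i) (iterate shift_map i)) (\<mu> (Suc i)) (shift_map i)"
    unfolding distr_distr[OF shift_map_measurable iterate_measurable] iterate.simps ..
  also have "\<dots> = \<mu> (Suc i)" unfolding Suc distr_shift_map ..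
  finally show ?case .
qed

lemma measure_iterate_vimage:
  assumes "A \<in> sets (\<mu> i)"
  shows "measure (\<mu> 0) {x \<in> Shift_space l L 0. restrict x {i..} \<in> A} = measure (\<mu> i) A"
    and "{x \<in> Shift_space l L 0. restrict x {i..} \<in> A} \<in> sets (\<mu> 0)"
proof -
  have eq: "iterate shift_map i -` A \<inter> space (\<mu> 0) = {x \<in> Shift_space l L 0. restrict x {i..} \<in> A}"
    by (auto simp: space_mu iterate_shift_map)
  have "measure (\<mu> i) A = measure (distr (\<mu> 0) (\<mu> i) (iterate shift_map i)) A"
    by (simp add: distr_iterate)
  also have "\<dots> = measure (\<mu> 0) (iterate shift_map i -` A \<inter> space (\<mu> 0))"
    by (rule measure_distr[OF iterate_measurable assms])
  finally show "measure (\<mu> 0) {x \<in> Shift_space l L 0. restrict x {i..} \<in> A} = measure (\<mu> i) A"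
    by (simp add: eq)
  show "{x \<in> Shift_space l L 0. restrict x {i..} \<in> A} \<in> sets (\<mu> 0)"
    using measurable_sets[OF iterate_measurable assms] by (simp add: eq)
qed

text \<open>The union of these cylinders is the preimage of the one-letter cylinder of
  \<open>b\<close> at time \<open>n\<close>, and there the Parry formula reduces to \<pi> because
  \<open>lam n n = 1\<close>.\<close>

lemma sum_cylinder_last:
  assumes "b \<in> alph l n"
  shows "(\<Sum>x\<in>{x \<in> words l L 0 n. x n = b}. measure (\<mu> 0) (cylinder l L 0 n x)) = \<pi> n b"
proof -
  interpret M: prob_space "\<mu> 0" by (rule prob_space_mu)
  let ?y = "\<lambda>i. if i = n then b else undefined"
  have y: "?y \<in> words l L n n" using assms by (auto simp: words_iff)
  have "(\<Sum>x\<in>{x \<in> words l L 0 n. x n = b}. measure (\<mu> 0) (cylinder l L 0 n x)) =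
      measure (\<mu> 0) (\<Union>x\<in>{x \<in> words l L 0 n. x n = b}. cylinder l L 0 n x)"
  proof (rule M.finite_measure_finite_Union[symmetric])
    show "cylinder l L 0 n ` {x \<in> words l L 0 n. x n = b} \<subseteq> sets (\<mu> 0)"
      by (auto intro!: cylinder_measurable)
    show "disjoint_family_on (cylinder l L 0 n) {x \<in> words l L 0 n. x n = b}"
      by (rule disjoint_family_on_mono[OF _ disjoint_family_cylinder]) auto
  qed simp
  also have "(\<Union>x\<in>{x \<in> words l L 0 n. x n = b}. cylinder l L 0 n x) =
      {x \<in> Shift_space l L 0. restrict x {n..} \<in> cylinder l L n n ?y}"
  proof (intro equalityI subsetI)
    fix x assume "x \<in> (\<Union>x\<in>{x \<in> words l L 0 n. x n = b}. cylinder l L 0 n x)"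
    then show "x \<in> {x \<in> Shift_space l L 0. restrict x {n..} \<in> cylinder l L n n ?y}"
      using restrict_mem_Shift_space[of x 0 n] by (auto simp: cylinder_def)
  next
    fix x assume x: "x \<in> {x \<in> Shift_space l L 0. restrict x {n..} \<in> cylinder l L n n ?y}"
    then have "restrict x {0..n} \<in> {x \<in> words l L 0 n. x n = b}"
      using restrict_mem_words[of x 0 0 n] by (auto simp: cylinder_def)
    moreover have "x \<in> cylinder l L 0 n (restrict x {0..n})" using x by (auto simp: cylinder_def)
    ultimately show "x \<in> (\<Union>x\<in>{x \<in> words l L 0 n. x n = b}. cylinder l L 0 n x)" by blast
  qed
  also have "measure (\<mu> 0) \<dots> = measure (\<mu> n) (cylinder l L n n ?y)"
    using y by (intro measure_iterate_vimage cylinder_measurable) auto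
  also have "\<dots> = \<pi> n b" using y by (simp add: measure_cylinder parry_lambda_def parry_pi_def)
  finally show ?thesis .
qed

section \<open>Entropy of cylinder partitions\<close>

definition cyl_entropy :: "nat \<Rightarrow> real" where
  "cyl_entropy n = part_entropy (\<mu> 0) (cylinder l L 0 n ` words l L 0 n)"

definition pi_col_sum :: "nat \<Rightarrow> real" where
  "pi_col_sum n = (\<Sum>b\<in>alph l n. \<pi> n b * ln (real (col_sum l L n b)))"

lemma cyl_entropy_eq:
  "cyl_entropy n = - (\<Sum>x\<in>words l L 0 n. measure (\<mu> 0) (cylinder l L 0 n x) * ln (measure (\<mu> 0) (cylinder l L 0 n x)))"
  unfolding cyl_entropy_def by (rule part_entropy_image[OF finite_words disjoint_family_cylinder])

lemma cyl_entropy_nonneg: "0 \<le> cyl_entropy n"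
proof -
  interpret M: prob_space "\<mu> 0" by (rule prob_space_mu)
  have "0 \<le> (\<Sum>x\<in>words l L 0 n. - (measure (\<mu> 0) (cylinder l L 0 n x) * ln (measure (\<mu> 0) (cylinder l L 0 n x))))"
    by (intro sum_nonneg neg_mult_ln_le_one) auto
  then show ?thesis by (simp add: cyl_entropy_eq sum_negf)
qed

text \<open>The longer word determines the shorter one, so a deterministic guess has no
  loss.\<close>

lemma cyl_entropy_mono:
  assumes "n \<le> m"
  shows "cyl_entropy n \<le> cyl_entropy m"
proof -
  interpret M: prob_space "\<mu> 0" by (rule prob_space_mu)
  let ?q = "\<lambda>x y. if restrict y {0..n} = x then 1 else (0::real)"
  have "cyl_entropy n \<le> cyl_entropy m + (\<Sum>x\<in>words l L 0 n. \<Sum>y\<in>words l L 0 m.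
      measure (\<mu> 0) (cylinder l L 0 n x \<inter> cylinder l L 0 m y) * (- ln (?q x y)))"
    unfolding cyl_entropy_eq
  proof (rule M.gibbs_partition)
    fix x y assume x: "x \<in> words l L 0 n" and y: "y \<in> words l L 0 m"
      and nz: "measure (\<mu> 0) (cylinder l L 0 n x \<inter> cylinder l L 0 m y) \<noteq> 0"
    have "\<forall>i\<in>{0..n}. x i = y i"
      using nz cylinder_Int[OF assms, of 0 x y] by (metis measure_empty)
    then have "restrict y {0..n} = x" using x by (auto simp: fun_eq_iff words_iff)
    then show "0 < ?q x y" by simp
  next
    fix y assume "y \<in> words l L 0 m"
    have "(\<Sum>x\<in>words l L 0 n. ?q x y) \<le> 1" by (simp add: sum.delta)
    then show "(\<Sum>x\<in>words l L 0 n. ?q x y) \<le> 1" .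
  qed (auto intro!: cylinder_measurable disjoint_family_cylinder simp: UN_cylinder space_mu)
  \<comment> \<open>Both values of the kernel contribute nothing, since \<open>ln 1 = 0\<close> and
    by convention \<open>ln 0 = 0\<close>.\<close>
  also have "(\<Sum>x\<in>words l L 0 n. \<Sum>y\<in>words l L 0 m.
      measure (\<mu> 0) (cylinder l L 0 n x \<inter> cylinder l L 0 m y) * (- ln (?q x y))) = 0"
    by (intro sum.neutral ballI) simp
  finally show ?thesis by simp
qed

text \<open>Gibbs' inequality with the trivial partition as second partition and the uniform
  distribution on words as guess.\<close>

lemma cyl_entropy_le: "cyl_entropy n \<le> ln (real (nwords l L 0 n))"
proof -
  interpret M: prob_space "\<mu> 0" by (rule prob_space_mu)
  have w0: "0 < nwords l L 0 n" by (rule nwords_pos) simp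
  have full: "measure (\<mu> 0) (Shift_space l L 0) = 1" using M.prob_space by (simp add: space_mu)
  let ?q = "1 / real (nwords l L 0 n)"
  have "cyl_entropy n \<le> - (\<Sum>j\<in>{()}. measure (\<mu> 0) (space (\<mu> 0)) * ln (measure (\<mu> 0) (space (\<mu> 0)))) +
      (\<Sum>x\<in>words l L 0 n. \<Sum>j\<in>{()}. measure (\<mu> 0) (cylinder l L 0 n x \<inter> space (\<mu> 0)) * (- ln ?q))"
    unfolding cyl_entropy_eq
  proof (rule M.gibbs_partition)
    show "(\<Sum>x\<in>words l L 0 n. ?q) \<le> 1" by (simp add: nwords_def)
    show "(\<lambda>j. space (\<mu> 0)) ` {()} \<subseteq> sets (\<mu> 0)" by auto
    show "disjoint_family_on (\<lambda>j. space (\<mu> 0)) {()}" by (simp add: disjoint_family_on_def)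
  qed (use w0 in \<open>auto intro!: cylinder_measurable disjoint_family_cylinder simp: UN_cylinder space_mu\<close>)
  also have "\<dots> = (\<Sum>x\<in>words l L 0 n. measure (\<mu> 0) (cylinder l L 0 n x)) * ln (real (nwords l L 0 n))"
    using w0 cylinder_subset
    by (simp add: full ln_div sum_distrib_right space_mu Int_absorb2)
  also have "(\<Sum>x\<in>words l L 0 n. measure (\<mu> 0) (cylinder l L 0 n x)) =
      measure (\<mu> 0) (\<Union>x\<in>words l L 0 n. cylinder l L 0 n x)"
    by (intro M.finite_measure_finite_Union[symmetric] disjoint_family_cylinder)
      (auto intro!: cylinder_measurable)
  also have "\<dots> = 1" by (simp add: UN_cylinder full)
  finally show ?thesis by simp
qed

text \<open>By the Parry formula, a cylinder \<open>[x\<^sub>0 \<dots> x\<^sub>n]\<close> has measure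
  \<open>v\<^sub>0(x\<^sub>0) \<pi>\<^sub>n(x\<^sub>n) / (\<lambda>\<^sup>(\<^sup>0\<^sup>,\<^sup>n\<^sup>) v\<^sub>n(x\<^sub>n))\<close>, and \<open>\<lambda>\<^sup>(\<^sup>0\<^sup>,\<^sup>n\<^sup>) v\<^sub>n\<close> is comparable to the
  column sums because \<open>v\<^sub>0\<close> is bounded above and away from zero.\<close>

lemma cyl_entropy_pi_col_sum: "\<exists>D. \<forall>n. \<bar>cyl_entropy n - pi_col_sum n\<bar> \<le> D"
proof -
  define va where "va = Min (v 0 ` alph l 0)"
  define vb where "vb = Max (v 0 ` alph l 0)"
  have "va \<in> v 0 ` alph l 0" unfolding va_def using alph_nonempty by (intro Min_in) auto
  then have va0: "0 < va" using v_pos by auto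
  have va: "va \<le> v 0 a" and vb: "v 0 a \<le> vb" if "a \<in> alph l 0" for a
    using that by (auto simp: va_def vb_def)
  obtain a0 where "a0 \<in> alph l 0" using alph_nonempty by blast
  then have vb0: "0 < vb" "va \<le> vb" using va vb va0 by fastforce+
  \<comment> \<open>Both \<open>ln (v 0 (x 0))\<close> and the logarithm of the ratio between
    \<open>lam 0 n * v n b\<close> and the column sum lie between \<open>ln va\<close> and
    \<open>ln vb\<close>; their difference is therefore at most \<open>R\<close> in absolute value,
    for every \<open>n\<close>.\<close>
  define R where "R = ln vb - ln va"
  have R: "0 \<le> R" using va0 vb0 by (simp add: R_def)
  have main: "\<bar>cyl_entropy n - pi_col_sum n\<bar> \<le> R + real alph_bound" for n
  proof -
    define p where "p x = measure (\<mu> 0) (cylinder l L 0 n x)" for x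
    have term_bound: "- ln (p x) \<le> ln (real (col_sum l L n b)) - ln (\<pi> n b) + R \<and>
        ln (real (col_sum l L n b)) - ln (\<pi> n b) - R \<le> - ln (p x)"
      if x: "x \<in> words l L 0 n" and xb: "x n = b" for x b
    proof -
      have b: "b \<in> alph l n" and x0: "x 0 \<in> alph l 0" using x xb by (auto simp: words_iff)
      define q where "q = lam 0 n * v n b"
      define c where "c = real (col_sum l L n b)"
      have c1: "1 \<le> c" using col_sum_pos[OF b] by (simp add: c_def)
      have q0: "0 < q" using lam_pos v_pos[OF b] by (simp add: q_def)
      have cq: "c = (\<Sum>a\<in>alph l 0. real (Lprod l L 0 n a b))" by (simp add: c_def col_sum_def)
      have q_eq: "q = (\<Sum>a\<in>alph l 0. v 0 a * real (Lprod l L 0 n a b))"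
        by (simp add: q_def v_Lprod[OF b])
      have q1: "va * c \<le> q" unfolding q_eq cq sum_distrib_left
        using va by (intro sum_mono mult_right_mono) auto
      have q2: "q \<le> vb * c" unfolding q_eq cq sum_distrib_left
        using vb by (intro sum_mono mult_right_mono) auto
      have px: "p x = v 0 (x 0) * \<pi> n b / q"
        using x xb v_pos[OF b] by (simp add: p_def measure_cylinder q_def parry_pi_def)
      have lnp: "ln (p x) = ln (v 0 (x 0)) + ln (\<pi> n b) - ln q"
        using v_pos[OF x0] pi_pos[OF b] q0 unfolding px by (simp add: ln_div ln_mult)
      have "ln (va * c) \<le> ln q" using q1 va0 c1 by (intro ln_mono) auto
      then have lq1: "ln va + ln c \<le> ln q" using va0 c1 by (simp add: ln_mult)
      have "ln q \<le> ln (vb * c)" using q2 q0 vb0 c1 by (intro ln_mono) auto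
      then have lq2: "ln q \<le> ln vb + ln c" using vb0 c1 by (simp add: ln_mult)
      have "ln va \<le> ln (v 0 (x 0))" "ln (v 0 (x 0)) \<le> ln vb"
        using va[OF x0] vb[OF x0] va0 v_pos[OF x0] by (auto intro: ln_mono)
      then show ?thesis using lq1 lq2 lnp unfolding R_def c_def[symmetric] by linarith
    qed
    have p0: "0 \<le> p x" for x by (simp add: p_def)
    have "cyl_entropy n = (\<Sum>x\<in>words l L 0 n. p x * (- ln (p x)))"
      by (simp add: cyl_entropy_eq p_def sum_negf)
    also have "\<dots> = (\<Sum>b\<in>alph l n. \<Sum>x\<in>{x \<in> words l L 0 n. x n = b}. p x * (- ln (p x)))"
      by (rule sum.group[symmetric]) (auto simp: words_iff)
    finally have E: "cyl_entropy n = (\<Sum>b\<in>alph l n. \<Sum>x\<in>{x \<in> words l L 0 n. x n = b}. p x * (- ln (p x)))" .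
    have sum_p: "(\<Sum>x\<in>{x \<in> words l L 0 n. x n = b}. p x * c) = \<pi> n b * c" if "b \<in> alph l n" for b c
      using sum_cylinder_last[OF that] by (simp add: p_def flip: sum_distrib_right)
    \<comment> \<open>The entropy of \<pi> at time \<open>n\<close>, which comes from the factor
      \<pi> in the measure of a cylinder. It has at most \<open>alph_bound\<close> summands, each
      between 0 and 1.\<close>
    define h where "h = (\<Sum>b\<in>alph l n. - (\<pi> n b * ln (\<pi> n b)))"
    have h: "0 \<le> h" "h \<le> real alph_bound"
    proof -
      show "0 \<le> h" unfolding h_def
        using pi_pos pi_le_one by (intro sum_nonneg neg_mult_ln_le_one) (auto intro: less_imp_le)
      have "h \<le> (\<Sum>b\<in>alph l n. 1)" unfolding h_def
        using pi_pos pi_le_one by (intro sum_mono neg_mult_ln_le_one) (auto intro: less_imp_le)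
      also have "\<dots> \<le> real alph_bound" using alph_bound(2)[of n] by simp
      finally show "h \<le> real alph_bound" .
    qed
    have split: "(\<Sum>b\<in>alph l n. \<pi> n b * (ln (real (col_sum l L n b)) - ln (\<pi> n b) + C)) = pi_col_sum n + h + C" for C
    proof -
      have "(\<Sum>b\<in>alph l n. \<pi> n b * (ln (real (col_sum l L n b)) - ln (\<pi> n b) + C)) =
          (\<Sum>b\<in>alph l n. \<pi> n b * ln (real (col_sum l L n b)) + - (\<pi> n b * ln (\<pi> n b)) + \<pi> n b * C)"
        by (intro sum.cong refl) (simp add: algebra_simps)
      also have "\<dots> = pi_col_sum n + h + (\<Sum>b\<in>alph l n. \<pi> n b) * C"
        unfolding pi_col_sum_def h_def sum_distrib_right by (simp only: sum.distrib)
      finally show ?thesis by (simp add: sum_pi)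
    qed
    have "cyl_entropy n \<le> (\<Sum>b\<in>alph l n. \<Sum>x\<in>{x \<in> words l L 0 n. x n = b}.
        p x * (ln (real (col_sum l L n b)) - ln (\<pi> n b) + R))"
      unfolding E using term_bound p0 by (intro sum_mono mult_left_mono) auto
    also have "\<dots> = pi_col_sum n + h + R" using split[of R] sum_p by simp
    finally have 1: "cyl_entropy n \<le> pi_col_sum n + h + R" .
    have "pi_col_sum n + h + (- R) = (\<Sum>b\<in>alph l n. \<Sum>x\<in>{x \<in> words l L 0 n. x n = b}.
        p x * (ln (real (col_sum l L n b)) - ln (\<pi> n b) + (- R)))"
      using split[of "- R"] sum_p by simp
    also have "\<dots> \<le> cyl_entropy n"
    proof -
      have "ln (real (col_sum l L n (x n))) - ln (\<pi> n (x n)) + (- R) \<le> - ln (p x)"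
        if "x \<in> words l L 0 n" for x
        using term_bound[OF that refl] by linarith
      then show ?thesis unfolding E using p0 by (intro sum_mono mult_left_mono) auto
    qed
    finally show ?thesis using 1 h R by linarith
  qed
  then show ?thesis by blast
qed

end

section \<open>Joins\<close>

text \<open>Extensional choice functions give a finite index set on which, for partitions, different
  indices have disjoint images. They also allow sums over the join to factor over the times.\<close>

lemma join_upto_image:
  "join_upto X f C n = (\<lambda>Q. {x \<in> X 0. \<forall>i<n. iterate f i x \<in> Q i}) ` (\<Pi>\<^sub>E i\<in>{..<n}. C i)"
proof (intro equalityI subsetI)
  fix S assume "S \<in> join_upto X f C n"
  then obtain Q where "S = {x \<in> X 0. \<forall>i<n. iterate f i x \<in> Q i}" "\<forall>i<n. Q i \<in> C i"
    by (auto simp: join_upto_def)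
  then show "S \<in> (\<lambda>Q. {x \<in> X 0. \<forall>i<n. iterate f i x \<in> Q i}) ` (\<Pi>\<^sub>E i\<in>{..<n}. C i)"
    by (intro image_eqI[of _ _ "restrict Q {..<n}"]) auto
qed (auto simp: join_upto_def)

lemma finite_join_upto:
  assumes "\<And>i. i < n \<Longrightarrow> finite (C i)"
  shows "finite (join_upto X f C n)"
  unfolding join_upto_image using assms by (intro finite_imageI finite_PiE) auto

lemma disjoint_family_on_join:
  assumes "\<And>i. i < n \<Longrightarrow> partition_on (X i) (C i)"
  shows "disjoint_family_on (\<lambda>Q. {x \<in> X 0. \<forall>i<n. iterate f i x \<in> Q i}) (\<Pi>\<^sub>E i\<in>{..<n}. C i)"
  unfolding disjoint_family_on_def
proof (intro ballI impI)
  fix Q R assume Q: "Q \<in> (\<Pi>\<^sub>E i\<in>{..<n}. C i)" and R: "R \<in> (\<Pi>\<^sub>E i\<in>{..<n}. C i)" and "Q \<noteq> R"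
  then obtain i where i: "i < n" "Q i \<noteq> R i" by (metis PiE_ext lessThan_iff)
  then have "Q i \<inter> R i = {}"
    using partition_onD2[OF assms[OF i(1)]] Q R by (meson PiE_mem disjointD lessThan_iff)
  then show "{x \<in> X 0. \<forall>i<n. iterate f i x \<in> Q i} \<inter> {x \<in> X 0. \<forall>i<n. iterate f i x \<in> R i} = {}"
    using i(1) by blast
qed

lemma UN_join:
  assumes "\<And>i. i < n \<Longrightarrow> partition_on (X i) (C i)"
    and "\<And>i x. i < n \<Longrightarrow> x \<in> X 0 \<Longrightarrow> iterate f i x \<in> X i"
  shows "(\<Union>Q\<in>(\<Pi>\<^sub>E i\<in>{..<n}. C i). {x \<in> X 0. \<forall>i<n. iterate f i x \<in> Q i}) = X 0"
proof (intro equalityI subsetI)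
  fix x assume x: "x \<in> X 0"
  have "\<exists>P. P \<in> C i \<and> iterate f i x \<in> P" if "i < n" for i
    using partition_onD1[OF assms(1)[OF that]] assms(2)[OF that x] by auto
  then obtain Q where Q: "\<And>i. i < n \<Longrightarrow> Q i \<in> C i \<and> iterate f i x \<in> Q i" by metis
  then have "restrict Q {..<n} \<in> (\<Pi>\<^sub>E i\<in>{..<n}. C i)" by auto
  moreover have "x \<in> {x \<in> X 0. \<forall>i<n. iterate f i x \<in> restrict Q {..<n} i}"
    using x Q by auto
  ultimately show "x \<in> (\<Union>Q\<in>(\<Pi>\<^sub>E i\<in>{..<n}. C i). {x \<in> X 0. \<forall>i<n. iterate f i x \<in> Q i})"
    by blast
qed auto

context nonstationary_shift
begin

section \<open>Window partitions and their joins\<close>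

definition cyl_part :: "real \<Rightarrow> nat \<Rightarrow> (nat \<Rightarrow> nat) set set" where
  "cyl_part \<epsilon> i = cylinder l L i (n_fun l L i \<epsilon>) ` words l L i (n_fun l L i \<epsilon>)"

lemma finite_cyl_part: "finite (cyl_part \<epsilon> i)"
  by (simp add: cyl_part_def)

lemma partition_on_cyl_part: "partition_on (Shift_space l L i) (cyl_part \<epsilon> i)"
  unfolding cyl_part_def by (rule partition_on_cylinders[OF n_fun_ge])

lemma cyl_part_eq_cylinder:
  assumes "Q \<in> cyl_part \<epsilon> i" "z \<in> Q"
  shows "Q = cylinder l L i (n_fun l L i \<epsilon>) z"
  using assms by (auto simp: cyl_part_def cylinder_def)

lemma cylinder_mem_cyl_part:
  assumes "z \<in> Shift_space l L i"
  shows "cylinder l L i (n_fun l L i \<epsilon>) z \<in> cyl_part \<epsilon> i"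
  unfolding cyl_part_def
  using restrict_mem_words[OF assms order_refl n_fun_ge] cylinder_restrict
  by (metis image_eqI)

lemma cyl_part_agree:
  assumes "Q \<in> cyl_part \<epsilon> i" "x \<in> Q" "y \<in> Q" "j \<in> {i..n_fun l L i \<epsilon>}"
  shows "x j = y j"
  using assms by (auto simp: cyl_part_def cylinder_def)

lemma restrict_mem_cylinder_iff:
  assumes "y \<in> Shift_space l L 0"
  shows "restrict y {i..} \<in> cylinder l L i m (restrict x {i..}) \<longleftrightarrow> (\<forall>j\<in>{i..m}. y j = x j)"
  using restrict_mem_Shift_space[OF assms, of i] by (auto simp: cylinder_def)

lemma join_cylinder:
  "{y \<in> Shift_space l L 0. \<forall>i<Suc k. iterate shift_map i y \<in>
      cylinder l L i (n_fun l L i \<epsilon>) (restrict x {i..})} =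
    cylinder l L 0 (ntilde_fun l L k \<epsilon>) x"
proof -
  have "(\<forall>i<Suc k. iterate shift_map i y \<in> cylinder l L i (n_fun l L i \<epsilon>) (restrict x {i..}))
      \<longleftrightarrow> (\<forall>j\<in>{0..ntilde_fun l L k \<epsilon>}. y j = x j)" if y: "y \<in> Shift_space l L 0" for y
  proof -
    have "(\<forall>i<Suc k. iterate shift_map i y \<in> cylinder l L i (n_fun l L i \<epsilon>) (restrict x {i..}))
      \<longleftrightarrow> (\<forall>i\<le>k. \<forall>j\<in>{i..n_fun l L i \<epsilon>}. y j = x j)"
      using restrict_mem_cylinder_iff[OF y] by (simp add: iterate_shift_map less_Suc_eq_le)
    also have "\<dots> \<longleftrightarrow> (\<forall>j\<in>{0..ntilde_fun l L k \<epsilon>}. y j = x j)"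
      using le_ntilde_iff[of _ k \<epsilon>] by (auto simp: Ball_def)
    finally show ?thesis .
  qed
  then show ?thesis unfolding cylinder_def by blast
qed

lemma iterate_mem_Shift_space:
  "x \<in> Shift_space l L 0 \<Longrightarrow> iterate shift_map i x \<in> Shift_space l L i"
  by (simp add: iterate_shift_map restrict_mem_Shift_space)

text \<open>Choices that disagree on overlapping windows have empty intersection and are removed.
  Compatible ones prescribe every coordinate up to the largest end of a window, as the windows leave
  no gap.\<close>

lemma join_cyl_part:
  "join_upto (Shift_space l L) shift_map (cyl_part \<epsilon>) (Suc k) - {{}} =
    cylinder l L 0 (ntilde_fun l L k \<epsilon>) ` words l L 0 (ntilde_fun l L k \<epsilon>)"
proof (intro equalityI subsetI)
  fix S assume S: "S \<in> join_upto (Shift_space l L) shift_map (cyl_part \<epsilon>) (Suc k) - {{}}"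
  then obtain Q where Q: "\<forall>i<Suc k. Q i \<in> cyl_part \<epsilon> i"
    and SQ: "S = {x \<in> Shift_space l L 0. \<forall>i<Suc k. iterate shift_map i x \<in> Q i}"
    by (auto simp: join_upto_def)
  obtain x where x: "x \<in> S" using S by blast
  have xX: "x \<in> Shift_space l L 0" using x SQ by blast
  have "Q i = cylinder l L i (n_fun l L i \<epsilon>) (restrict x {i..})" if "i < Suc k" for i
    using cyl_part_eq_cylinder[of "Q i" \<epsilon> i "iterate shift_map i x"] Q x that
    unfolding SQ iterate_shift_map by blast
  then have "S = cylinder l L 0 (ntilde_fun l L k \<epsilon>) x"
    unfolding SQ join_cylinder[symmetric] by auto
  then show "S \<in> cylinder l L 0 (ntilde_fun l L k \<epsilon>) ` words l L 0 (ntilde_fun l L k \<epsilon>)"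
    using restrict_mem_words[OF xX order_refl] cylinder_restrict by (metis image_eqI le0)
next
  fix S assume "S \<in> cylinder l L 0 (ntilde_fun l L k \<epsilon>) ` words l L 0 (ntilde_fun l L k \<epsilon>)"
  then obtain u where u: "u \<in> words l L 0 (ntilde_fun l L k \<epsilon>)" "S = cylinder l L 0 (ntilde_fun l L k \<epsilon>) u"
    by blast
  then have ne: "S \<noteq> {}" using cylinder_nonempty by simp
  then obtain x where x: "x \<in> S" by blast
  then have xX: "x \<in> Shift_space l L 0" and "S = cylinder l L 0 (ntilde_fun l L k \<epsilon>) x"
    using u by (auto simp: cylinder_def)
  then have "S = {y \<in> Shift_space l L 0. \<forall>i<Suc k. iterate shift_map i y \<in>
      cylinder l L i (n_fun l L i \<epsilon>) (restrict x {i..})}"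
    unfolding join_cylinder by simp
  moreover have "\<forall>i<Suc k. cylinder l L i (n_fun l L i \<epsilon>) (restrict x {i..}) \<in> cyl_part \<epsilon> i"
    using cylinder_mem_cyl_part restrict_mem_Shift_space[OF xX] by simp
  ultimately have "S \<in> join_upto (Shift_space l L) shift_map (cyl_part \<epsilon>) (Suc k)"
    unfolding join_upto_def
    by (intro CollectI exI[of _ "\<lambda>i. cylinder l L i (n_fun l L i \<epsilon>) (restrict x {i..})"] conjI)
  then show "S \<in> join_upto (Shift_space l L) shift_map (cyl_part \<epsilon>) (Suc k) - {{}}"
    using ne by blast
qed

lemma card_cyl_part_le:
  assumes "0 < \<epsilon>"
  shows "card (cyl_part \<epsilon> i) \<le> nat \<lceil>(1 + 1 / \<epsilon>) * real alph_bound\<rceil>"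
proof -
  have "real (card (cyl_part \<epsilon> i)) \<le> real (nwords l L i (n_fun l L i \<epsilon>))"
    unfolding cyl_part_def nwords_def by (intro of_nat_mono card_image_le finite_words)
  also have "\<dots> \<le> (1 + 1 / \<epsilon>) * real alph_bound" by (rule nwords_n_fun_le[OF assms])
  finally show ?thesis by linarith
qed

lemma dist_distinct_cyl_part:
  assumes "0 < \<epsilon>" "Q \<in> cyl_part \<epsilon> i" "R \<in> cyl_part \<epsilon> i" "Q \<noteq> R" "x \<in> Q" "y \<in> R"
  shows "min 1 \<epsilon> \<le> shift_dist l L i x y"
proof -
  have xy: "x \<in> Shift_space l L i" "y \<in> Shift_space l L i"
    using assms by (auto simp: cyl_part_def cylinder_def)
  have "\<exists>j\<in>{i..n_fun l L i \<epsilon>}. x j \<noteq> y j"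
  proof (rule ccontr)
    assume "\<not> ?thesis"
    then have "y \<in> cylinder l L i (n_fun l L i \<epsilon>) x" using xy by (auto simp: cylinder_def)
    then have "y \<in> Q" using cyl_part_eq_cylinder assms by blast
    then show False
      using partition_onD2[OF partition_on_cyl_part] assms by (metis disjointD disjoint_iff)
  qed
  then show ?thesis using shift_dist_ge_n_fun[OF assms(1) xy] by blast
qed

lemma openin_cyl_part:
  assumes "Q \<in> cyl_part \<epsilon> i"
  shows "openin (mtop (Shift_space l L i) (shift_dist l L i)) Q"
  using assms openin_cylinder[OF n_fun_ge] by (auto simp: cyl_part_def)

lemma lebesgue_covers_cyl_part:
  assumes "0 < \<epsilon>"
  shows "lebesgue_covers (Shift_space l L) (shift_dist l L) (cyl_part \<epsilon>)"
  unfolding lebesgue_covers_def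
proof (intro conjI allI exI[of _ "min 1 \<epsilon>"] ballI)
  fix n x assume x: "x \<in> Shift_space l L n"
  interpret S: Metric_space "Shift_space l L n" "shift_dist l L n" by (rule Metric_space_shift)
  obtain Q where Q: "Q \<in> cyl_part \<epsilon> n" "x \<in> Q"
    using partition_onD1[OF partition_on_cyl_part] x by blast
  have "S.mball x (min 1 \<epsilon>) \<subseteq> Q"
  proof
    fix y assume "y \<in> S.mball x (min 1 \<epsilon>)"
    then have y: "y \<in> Shift_space l L n" "shift_dist l L n x y < min 1 \<epsilon>" by auto
    obtain R where R: "R \<in> cyl_part \<epsilon> n" "y \<in> R"
      using partition_onD1[OF partition_on_cyl_part] y(1) by blast
    then show "y \<in> Q" using dist_distinct_cyl_part[OF assms Q(1) R(1) _ Q(2) R(2)] y(2) by fastforce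
  qed
  then show "\<exists>U\<in>cyl_part \<epsilon> n. S.mball x (min 1 \<epsilon>) \<subseteq> U" using Q(1) by blast
qed (use assms openin_cyl_part partition_onD1[OF partition_on_cyl_part] in auto)

section \<open>Topological entropy as growth rate of word counts\<close>

definition top_eps :: "real \<Rightarrow> ereal" where
  "top_eps \<epsilon> = limsup (\<lambda>k. ereal (ln (real (nwords l L 0 (ntilde_fun l L k \<epsilon>))) / real k))"

lemma ln_nwords_nonneg: "0 \<le> ln (real (nwords l L 0 n))"
  using nwords_pos[of 0 n] by simp

lemma ln_nwords_ntilde_le:
  assumes "0 < \<epsilon>"
  shows "ln (real (nwords l L 0 (ntilde_fun l L k \<epsilon>))) \<le>
    ln ((1 + 1 / \<epsilon>) * real alph_bound * real alph_bound) * (real k + 1)"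
proof -
  have pos: "0 < (1 + 1 / \<epsilon>) * real alph_bound * real alph_bound"
    using assms alph_bound(1) by (intro mult_pos_pos add_pos_pos) auto
  have "ln (real (nwords l L 0 (ntilde_fun l L k \<epsilon>))) \<le>
      ln (((1 + 1 / \<epsilon>) * real alph_bound * real alph_bound) ^ Suc k)"
    using nwords_ntilde_le[OF assms, of k] nwords_pos[of 0 "ntilde_fun l L k \<epsilon>"]
    by (intro ln_mono) auto
  also have "\<dots> = ln ((1 + 1 / \<epsilon>) * real alph_bound * real alph_bound) * (real k + 1)"
    using pos by (subst ln_realpow) (auto simp: algebra_simps)
  finally show ?thesis .
qed

lemma top_eps_shift:
  assumes "0 < \<epsilon>"
  shows "top_eps \<epsilon> = limsup (\<lambda>k. ereal (ln (real (nwords l L 0 (ntilde_fun l L k \<epsilon>))) / real (Suc k)))"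
  unfolding top_eps_def
  using ln_nwords_nonneg ln_nwords_ntilde_le[OF assms] by (rule limsup_mult_ratio)

text \<open>The nonempty members of the join are pairwise disjoint, so no subcover can omit one of
  them.\<close>

lemma nwords_le_min_subcover:
  "nwords l L 0 (ntilde_fun l L k \<epsilon>) \<le>
    min_subcover (Shift_space l L 0) (join_upto (Shift_space l L) shift_map (cyl_part \<epsilon>) (Suc k))"
proof -
  let ?J = "join_upto (Shift_space l L) shift_map (cyl_part \<epsilon>) (Suc k)"
  let ?N = "ntilde_fun l L k \<epsilon>"
  let ?C = "cylinder l L 0 ?N ` words l L 0 ?N"
  have cover: "\<Union>?C = Shift_space l L 0" by (rule UN_cylinder) simp
  have "\<exists>n. \<exists>D\<subseteq>?J. finite D \<and> Shift_space l L 0 \<subseteq> \<Union>D \<and> card D = n"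
    using join_cyl_part[of \<epsilon> k] cover
    by (intro exI[of _ "card ?C"] exI[of _ ?C]) auto
  then have "\<exists>D\<subseteq>?J. finite D \<and> Shift_space l L 0 \<subseteq> \<Union>D \<and> card D = min_subcover (Shift_space l L 0) ?J"
    unfolding min_subcover_def by (rule LeastI_ex)
  then obtain D where D: "D \<subseteq> ?J" "finite D" "Shift_space l L 0 \<subseteq> \<Union>D"
    "card D = min_subcover (Shift_space l L 0) ?J" by blast
  have "?C \<subseteq> D"
  proof
    fix S assume S: "S \<in> ?C"
    then obtain x where x: "x \<in> S" using cylinder_nonempty by blast
    then have "x \<in> Shift_space l L 0" using S cover by blast
    then obtain T where T: "T \<in> D" "x \<in> T" using D by blast
    then have "T \<in> ?C" using D(1) join_cyl_part[of \<epsilon> k] by blast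
    then have "S = T"
      using S x T partition_onD2[OF partition_on_cylinders[of 0 ?N]]
      by (metis disjointD disjoint_iff le0)
    then show "S \<in> D" using T by simp
  qed
  then have "card ?C \<le> card D" using D(2) by (rule card_mono[rotated])
  moreover have "card ?C = nwords l L 0 ?N"
    unfolding nwords_def by (rule card_image[OF inj_on_cylinder]) simp
  ultimately show ?thesis using D(4) by simp
qed

lemma top_eps_le_top_entropy:
  assumes "0 < \<epsilon>"
  shows "top_eps \<epsilon> \<le> top_entropy (Shift_space l L) (shift_dist l L) shift_map"
proof -
  let ?m = "\<lambda>n. min_subcover (Shift_space l L 0) (join_upto (Shift_space l L) shift_map (cyl_part \<epsilon>) n)"
  have "top_eps \<epsilon> \<le> limsup (\<lambda>k. ereal (ln (real (?m (k + 1))) / real (k + 1)))"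
    unfolding top_eps_shift[OF assms]
  proof (intro Limsup_mono always_eventually allI)
    fix k
    have "ln (real (nwords l L 0 (ntilde_fun l L k \<epsilon>))) \<le> ln (real (?m (Suc k)))"
      using nwords_le_min_subcover[of k \<epsilon>] nwords_pos[of 0 "ntilde_fun l L k \<epsilon>"]
      by (intro ln_mono) auto
    then show "ereal (ln (real (nwords l L 0 (ntilde_fun l L k \<epsilon>))) / real (Suc k)) \<le>
        ereal (ln (real (?m (k + 1))) / real (k + 1))"
      by (simp add: divide_right_mono)
  qed
  also have "\<dots> = limsup (\<lambda>n. ereal (ln (real (?m n)) / real n))"
    by (rule limsup_shift[where u = "\<lambda>n. ereal (ln (real (?m n)) / real n)"])
  also have "\<dots> \<le> top_entropy (Shift_space l L) (shift_dist l L) shift_map"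
    unfolding top_entropy_def using lebesgue_covers_cyl_part[OF assms] by (intro SUP_upper) auto
  finally show ?thesis .
qed

text \<open>A window cylinder has mesh below the Lebesgue number and so lies in a member of the
  cover at its time. Intersecting these members over the times gives one member of the join for each
  word, and together they cover.\<close>

lemma min_subcover_le_nwords:
  assumes "0 < \<delta>"
    and U: "\<And>i x. x \<in> Shift_space l L i \<Longrightarrow>
      \<exists>V\<in>\<U> i. Metric_space.mball (Shift_space l L i) (shift_dist l L i) x \<delta> \<subseteq> V"
  shows "min_subcover (Shift_space l L 0) (join_upto (Shift_space l L) shift_map \<U> (Suc k))
    \<le> nwords l L 0 (ntilde_fun l L k \<delta>)"
proof -
  let ?J = "join_upto (Shift_space l L) shift_map \<U> (Suc k)"
  let ?N = "ntilde_fun l L k \<delta>"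
  have "\<exists>V\<in>?J. cylinder l L 0 ?N u \<subseteq> V" if u: "u \<in> words l L 0 ?N" for u
  proof -
    obtain x where "x \<in> cylinder l L 0 ?N u" using cylinder_nonempty[OF u] by blast
    then have x: "x \<in> Shift_space l L 0" "cylinder l L 0 ?N u = cylinder l L 0 ?N x"
      by (auto simp: cylinder_def)
    have "\<forall>i. \<exists>V\<in>\<U> i. Metric_space.mball (Shift_space l L i) (shift_dist l L i) (restrict x {i..}) \<delta> \<subseteq> V"
      using U restrict_mem_Shift_space[OF x(1)] by simp
    then obtain Q where Q: "\<And>i. Q i \<in> \<U> i"
      "\<And>i. Metric_space.mball (Shift_space l L i) (shift_dist l L i) (restrict x {i..}) \<delta> \<subseteq> Q i"
      by metis
    have ball: "cylinder l L i (n_fun l L i \<delta>) (restrict x {i..}) \<subseteq> Q i" for i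
    proof
      interpret S: Metric_space "Shift_space l L i" "shift_dist l L i" by (rule Metric_space_shift)
      fix z assume "z \<in> cylinder l L i (n_fun l L i \<delta>) (restrict x {i..})"
      then have z: "z \<in> Shift_space l L i" "\<And>j. j \<in> {i..n_fun l L i \<delta>} \<Longrightarrow> restrict x {i..} j = z j"
        by (auto simp: cylinder_def)
      have xi: "restrict x {i..} \<in> Shift_space l L i" by (rule restrict_mem_Shift_space[OF x(1)]) simp
      have "shift_dist l L i (restrict x {i..}) z < \<delta>"
        by (rule shift_dist_less_n_fun[OF assms(1) xi z])
      then show "z \<in> Q i" using Q(2)[of i] z(1) xi by auto
    qed
    have "cylinder l L 0 ?N x \<subseteq> {y \<in> Shift_space l L 0. \<forall>i<Suc k. iterate shift_map i y \<in> Q i}"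
      unfolding join_cylinder[symmetric] using ball by blast
    moreover have "{y \<in> Shift_space l L 0. \<forall>i<Suc k. iterate shift_map i y \<in> Q i} \<in> ?J"
      using Q(1) by (auto simp: join_upto_def)
    ultimately show ?thesis using x(2) by auto
  qed
  then obtain V where V: "\<And>u. u \<in> words l L 0 ?N \<Longrightarrow> V u \<in> ?J \<and> cylinder l L 0 ?N u \<subseteq> V u"
    by metis
  let ?D = "V ` words l L 0 ?N"
  have "Shift_space l L 0 \<subseteq> \<Union>?D"
    using UN_cylinder[of 0 ?N] V by fastforce
  then have "min_subcover (Shift_space l L 0) ?J \<le> card ?D"
    unfolding min_subcover_def using V by (intro Least_le exI[of _ ?D]) auto
  also have "\<dots> \<le> nwords l L 0 ?N" unfolding nwords_def by (rule card_image_le) simp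
  finally show ?thesis .
qed

lemma top_entropy_le:
  assumes "\<And>\<epsilon>. 0 < \<epsilon> \<Longrightarrow> top_eps \<epsilon> \<le> h"
  shows "top_entropy (Shift_space l L) (shift_dist l L) shift_map \<le> h"
  unfolding top_entropy_def
proof (rule SUP_least)
  fix \<U> assume "\<U> \<in> {\<U>. lebesgue_covers (Shift_space l L) (shift_dist l L) \<U>}"
  then obtain \<delta> where \<delta>: "0 < \<delta>" "\<And>i x. x \<in> Shift_space l L i \<Longrightarrow>
      \<exists>V\<in>\<U> i. Metric_space.mball (Shift_space l L i) (shift_dist l L i) x \<delta> \<subseteq> V"
    by (auto simp: lebesgue_covers_def)
  let ?m = "\<lambda>n. min_subcover (Shift_space l L 0) (join_upto (Shift_space l L) shift_map \<U> n)"
  have "limsup (\<lambda>n. ereal (ln (real (?m n)) / real n)) =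
      limsup (\<lambda>k. ereal (ln (real (?m (k + 1))) / real (k + 1)))"
    by (rule limsup_shift[where u = "\<lambda>n. ereal (ln (real (?m n)) / real n)", symmetric])
  also have "\<dots> \<le> top_eps \<delta>"
    unfolding top_eps_shift[OF \<delta>(1)]
  proof (intro Limsup_mono always_eventually allI)
    fix k
    have le: "?m (Suc k) \<le> nwords l L 0 (ntilde_fun l L k \<delta>)" by (rule min_subcover_le_nwords[OF \<delta>])
    \<comment> \<open>Should the minimal cardinality be 0, the convention \<open>ln 0 = 0\<close>
      still gives the bound.\<close>
    have "ln (real (?m (Suc k))) \<le> ln (real (nwords l L 0 (ntilde_fun l L k \<delta>)))"
      using le ln_nwords_nonneg by (cases "?m (Suc k) = 0") auto
    then show "ereal (ln (real (?m (k + 1))) / real (k + 1)) \<le>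
        ereal (ln (real (nwords l L 0 (ntilde_fun l L k \<delta>))) / real (Suc k))"
      by (simp add: divide_right_mono)
  qed
  also have "\<dots> \<le> h" by (rule assms[OF \<delta>(1)])
  finally show "limsup (\<lambda>n. ereal (ln (real (?m n)) / real n)) \<le> h" .
qed

end

section \<open>Metric entropy\<close>

context parry_shift
begin

lemma part_entropy_join_cyl_part:
  "part_entropy (\<mu> 0) (join_upto (Shift_space l L) shift_map (cyl_part \<epsilon>) (Suc k)) =
    cyl_entropy (ntilde_fun l L k \<epsilon>)"
proof -
  let ?J = "join_upto (Shift_space l L) shift_map (cyl_part \<epsilon>) (Suc k)"
  have "finite ?J" by (rule finite_join_upto) (rule finite_cyl_part)
  then have "(\<Sum>P\<in>?J. measure (\<mu> 0) P * ln (measure (\<mu> 0) P)) =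
      (\<Sum>P\<in>?J - {{}}. measure (\<mu> 0) P * ln (measure (\<mu> 0) P))"
    by (intro sum.mono_neutral_right) auto
  then show ?thesis by (simp add: part_entropy_def cyl_entropy_def join_cyl_part)
qed

lemma admissible_cyl_part:
  assumes "0 < \<epsilon>"
  shows "admissible (Shift_space l L) (shift_dist l L) \<mu> (cyl_part \<epsilon>)"
  unfolding admissible_def
proof (intro conjI allI impI)
  fix n
  show "cyl_part \<epsilon> n \<subseteq> sets (mborel (Shift_space l L n) (shift_dist l L n))"
    unfolding sets_mu_borel[symmetric] cyl_part_def
    using cylinder_measurable[OF n_fun_ge] by blast
next
  show "\<exists>b. \<forall>n. card (cyl_part \<epsilon> n) \<le> b" using card_cyl_part_le[OF assms] by blast
next
  fix e :: real assume "0 < e"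
  show "\<exists>\<delta>>0. \<exists>K. \<forall>n.
      (\<forall>P\<in>cyl_part \<epsilon> n. compactin (mtop (Shift_space l L n) (shift_dist l L n)) (K n P) \<and>
        K n P \<subseteq> P \<and> measure (\<mu> n) (P - K n P) \<le> e) \<and>
      (\<forall>P\<in>cyl_part \<epsilon> n. \<forall>P'\<in>cyl_part \<epsilon> n. P \<noteq> P' \<longrightarrow>
        (\<forall>x\<in>K n P. \<forall>y\<in>K n P'. \<delta> \<le> shift_dist l L n x y))"
  \<comment> \<open>The atoms are compact and separated, so each serves as its own kernel and no
    measure is lost.\<close>
  proof (intro exI[of _ "min 1 \<epsilon>"] exI[of _ "\<lambda>n P. P"] conjI allI ballI impI)
    fix n P assume "P \<in> cyl_part \<epsilon> n"
    then show "compactin (mtop (Shift_space l L n) (shift_dist l L n)) P"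
      using compactin_cylinder by (auto simp: cyl_part_def)
  next
    fix n P P' x y assume "P \<in> cyl_part \<epsilon> n" "P' \<in> cyl_part \<epsilon> n" "P \<noteq> P'" "x \<in> P" "y \<in> P'"
    then show "min 1 \<epsilon> \<le> shift_dist l L n x y" by (rule dist_distinct_cyl_part[OF assms])
  qed (use assms \<open>0 < e\<close> in auto)
qed (rule finite_cyl_part partition_on_cyl_part)+

definition metric_eps :: "real \<Rightarrow> ereal" where
  "metric_eps \<epsilon> = limsup (\<lambda>k. ereal (cyl_entropy (ntilde_fun l L k \<epsilon>) / real k))"

lemma cyl_entropy_ntilde_le:
  assumes "0 < \<epsilon>"
  shows "cyl_entropy (ntilde_fun l L k \<epsilon>) \<le>
    ln ((1 + 1 / \<epsilon>) * real alph_bound * real alph_bound) * (real k + 1)"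
  using cyl_entropy_le[of "ntilde_fun l L k \<epsilon>"] ln_nwords_ntilde_le[OF assms, of k] by linarith

lemma metric_eps_eq_join:
  assumes "0 < \<epsilon>"
  shows "metric_eps \<epsilon> = limsup (\<lambda>n. ereal (part_entropy (\<mu> 0)
    (join_upto (Shift_space l L) shift_map (cyl_part \<epsilon>) n) / real n))"
proof -
  let ?H = "\<lambda>n. part_entropy (\<mu> 0) (join_upto (Shift_space l L) shift_map (cyl_part \<epsilon>) n)"
  have "metric_eps \<epsilon> = limsup (\<lambda>k. ereal (cyl_entropy (ntilde_fun l L k \<epsilon>) / real (Suc k)))"
    unfolding metric_eps_def
    using cyl_entropy_nonneg cyl_entropy_ntilde_le[OF assms] by (rule limsup_mult_ratio)
  also have "\<dots> = limsup (\<lambda>k. ereal (?H (k + 1) / real (k + 1)))"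
    by (simp add: part_entropy_join_cyl_part)
  also have "\<dots> = limsup (\<lambda>n. ereal (?H n / real n))"
    by (rule limsup_shift[where u = "\<lambda>n. ereal (?H n / real n)"])
  finally show ?thesis .
qed

lemma metric_eps_le_metric_entropy:
  assumes "0 < \<epsilon>"
  shows "metric_eps \<epsilon> \<le> metric_entropy (Shift_space l L) (shift_dist l L) shift_map \<mu>"
  unfolding metric_eps_eq_join[OF assms] metric_entropy_def
  using admissible_cyl_part[OF assms] by (intro SUP_upper) auto

lemma metric_eps_antimono:
  assumes "0 < \<epsilon>" "\<epsilon> \<le> \<epsilon>'"
  shows "metric_eps \<epsilon>' \<le> metric_eps \<epsilon>"
  unfolding metric_eps_def
  using cyl_entropy_mono[OF ntilde_antimono[OF assms]]
  by (intro Limsup_mono always_eventually allI) (simp add: divide_right_mono)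

lemma metric_eps_le_top_eps: "metric_eps \<epsilon> \<le> top_eps \<epsilon>"
  unfolding metric_eps_def top_eps_def using cyl_entropy_le
  by (intro Limsup_mono always_eventually allI) (simp add: divide_right_mono)

lemma metric_eps_eq_pi_col_sum:
  "metric_eps \<epsilon> = limsup (\<lambda>k. ereal (pi_col_sum (ntilde_fun l L k \<epsilon>) / real k))"
proof -
  obtain D where D: "\<And>n. \<bar>cyl_entropy n - pi_col_sum n\<bar> \<le> D" using cyl_entropy_pi_col_sum by blast
  have 1: "cyl_entropy n \<le> pi_col_sum n + D" and 2: "pi_col_sum n \<le> cyl_entropy n + D" for n
    using D[of n] by linarith+
  show ?thesis unfolding metric_eps_def
    by (rule antisym; rule limsup_le_add_bounded[where D = D]; rule 1 2)
qed

text \<open>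
  Given an admissible sequence and its compact kernels \<open>K\<close> at distance at least \<open>\<delta>\<close>, each atom
  \<open>R\<close> of the cylinder partition of mesh below \<open>\<delta>\<close> meets at most one kernel. Guessing this one with
  probability \<open>1 - \<alpha>\<close> and every other element with probability \<open>\<alpha> / b\<close> gives a product kernel,
  whose expected logarithmic loss bounds the conditional entropy by Gibbs' inequality.
\<close>

lemma admissible_entropy_le:
  assumes adm: "admissible (Shift_space l L) (shift_dist l L) \<mu> \<P>" and \<eta>: "0 < \<eta>"
  shows "\<exists>\<epsilon>>0. \<forall>n. part_entropy (\<mu> 0) (join_upto (Shift_space l L) shift_map \<P> n) \<le>
    part_entropy (\<mu> 0) (join_upto (Shift_space l L) shift_map (cyl_part \<epsilon>) n) + real n * \<eta>"
proof -
  interpret M: prob_space "\<mu> 0" by (rule prob_space_mu)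
  have fin: "finite (\<P> n)" and part: "partition_on (Shift_space l L n) (\<P> n)"
    and meas: "\<P> n \<subseteq> sets (\<mu> n)" for n
    using adm by (auto simp: admissible_def sets_mu_borel)
  obtain b0 where b0: "\<And>n. card (\<P> n) \<le> b0" using adm by (auto simp: admissible_def)
  define b where "b = real (max 1 b0)"
  have b: "1 \<le> b" "\<And>n. real (card (\<P> n)) \<le> b"
    using b0 by (auto simp: b_def le_max_iff_disj)
  \<comment> \<open>Chosen so that a correct guess, of probability 1 - \<alpha>, costs exactly
    \<eta>/2. A failed one costs \<Lambda>, the loss at \<alpha> / b.\<close>
  define \<alpha> where "\<alpha> = 1 - exp (- (\<eta> / 2))"
  have \<alpha>: "0 < \<alpha>" "\<alpha> < 1" "ln (1 - \<alpha>) = - (\<eta> / 2)" using \<eta> by (auto simp: \<alpha>_def)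
  define \<Lambda> where "\<Lambda> = ln (b / \<alpha>)"
  have "1 < b / \<alpha>" using \<alpha> b by simp
  then have \<Lambda>: "0 < \<Lambda>" by (simp add: \<Lambda>_def)
  \<comment> \<open>At each time the guess fails with probability at most b e, since each of at most
    b elements loses measure at most \<open>e\<close> outside its kernel. The factor makes the
    expected cost of failures the other \<eta>/2.\<close>
  define e where "e = \<eta> / 2 / (b * \<Lambda>)"
  have e: "0 < e" "\<Lambda> * (b * e) = \<eta> / 2" using \<eta> b \<Lambda> by (auto simp: e_def)
  have "\<exists>\<delta>>0. \<exists>K. \<forall>n.
      (\<forall>P\<in>\<P> n. compactin (mtop (Shift_space l L n) (shift_dist l L n)) (K n P) \<and>
        K n P \<subseteq> P \<and> measure (\<mu> n) (P - K n P) \<le> e) \<and>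
      (\<forall>P\<in>\<P> n. \<forall>P'\<in>\<P> n. P \<noteq> P' \<longrightarrow> (\<forall>x\<in>K n P. \<forall>y\<in>K n P'. \<delta> \<le> shift_dist l L n x y))"
    using adm e(1) unfolding admissible_def by blast
  then obtain \<delta> K where \<delta>: "0 < \<delta>"
    and compact_K: "\<And>n P. P \<in> \<P> n \<Longrightarrow> compactin (mtop (Shift_space l L n) (shift_dist l L n)) (K n P)"
    and K_subset: "\<And>n P. P \<in> \<P> n \<Longrightarrow> K n P \<subseteq> P"
    and K_measure: "\<And>n P. P \<in> \<P> n \<Longrightarrow> measure (\<mu> n) (P - K n P) \<le> e"
    and K_dist: "\<And>n P P' x y. P \<in> \<P> n \<Longrightarrow> P' \<in> \<P> n \<Longrightarrow> P \<noteq> P' \<Longrightarrow> x \<in> K n P \<Longrightarrow> y \<in> K n P' \<Longrightarrow>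
      \<delta> \<le> shift_dist l L n x y"
    by metis
  have K_sets: "K n P \<in> sets (\<mu> n)" if P: "P \<in> \<P> n" for n P
  proof -
    interpret S: Metric_space "Shift_space l L n" "shift_dist l L n" by (rule Metric_space_shift)
    have "closedin S.mtopology (K n P)" by (rule compactin_imp_closedin[OF S.Hausdorff_space_mtopology compact_K[OF P]])
    then have "K n P \<subseteq> Shift_space l L n" "openin S.mtopology (Shift_space l L n - K n P)"
      by (auto simp: closedin_def)
    moreover have "U \<in> sets (\<mu> n)" if "openin S.mtopology U" for U
    proof -
      have "{U. openin S.mtopology U} \<subseteq> Pow (Shift_space l L n)"
        using openin_subset by fastforce
      then show ?thesis using that by (simp add: sets_mu_borel mborel_def)
    qed
    ultimately have "space (\<mu> n) - (Shift_space l L n - K n P) \<in> sets (\<mu> n)" "K n P \<subseteq> Shift_space l L n"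
      by auto
    then show ?thesis by (simp add: space_mu double_diff)
  qed
  define q where "q i P R = (if K i P \<inter> R \<noteq> {} then 1 - \<alpha> else \<alpha> / b)" for i P and R :: "(nat \<Rightarrow> nat) set"
  have q_pos: "0 < q i P R" for i P R using \<alpha> b by (simp add: q_def)
  then have q_ne: "q i P R \<noteq> 0" for i P R by (metis less_irrefl)
  have q_sum: "(\<Sum>P\<in>\<P> i. q i P R) \<le> 1" if R: "R \<in> cyl_part \<delta> i" for i R
  proof -
    have unique: "P = P'" if P: "P \<in> \<P> i" "P' \<in> \<P> i" "K i P \<inter> R \<noteq> {}" "K i P' \<inter> R \<noteq> {}" for P P'
    proof (rule ccontr)
      assume "P \<noteq> P'"
      obtain x y where xy: "x \<in> K i P" "x \<in> R" "y \<in> K i P'" "y \<in> R" using P by blast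
      have "R \<subseteq> Shift_space l L i" using partition_onD1[OF partition_on_cyl_part] R by blast
      then have "shift_dist l L i x y < \<delta>"
        using xy cyl_part_agree[OF R xy(2,4)] by (intro shift_dist_less_n_fun[OF \<delta>]) auto
      moreover have "\<delta> \<le> shift_dist l L i x y"
        by (rule K_dist[OF P(1,2) \<open>P \<noteq> P'\<close> xy(1,3)])
      ultimately show False by simp
    qed
    have small: "real (card (\<P> i)) * (\<alpha> / b) \<le> \<alpha>"
    proof -
      have "real (card (\<P> i)) * (\<alpha> / b) \<le> b * (\<alpha> / b)"
        using b \<alpha> by (intro mult_right_mono) auto
      then show ?thesis using b by simp
    qed
    show ?thesis
    proof (cases "\<exists>P\<in>\<P> i. K i P \<inter> R \<noteq> {}")
      case True
      then obtain P0 where P0: "P0 \<in> \<P> i" "K i P0 \<inter> R \<noteq> {}" by blast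
      \<comment> \<open>The share \<alpha> / b is granted to \<open>P0\<close> as well; the at most
        b shares still sum to no more than \<alpha>.\<close>
      have "(\<Sum>P\<in>\<P> i. q i P R) \<le> (\<Sum>P\<in>\<P> i. (if P = P0 then 1 - \<alpha> else 0) + \<alpha> / b)"
        using unique[OF _ P0(1) _ P0(2)] \<alpha> b by (intro sum_mono) (auto simp: q_def)
      also have "\<dots> = 1 - \<alpha> + real (card (\<P> i)) * (\<alpha> / b)"
        using P0(1) fin by (simp add: sum.distrib)
      finally show ?thesis using small by simp
    next
      case False
      then have "(\<Sum>P\<in>\<P> i. q i P R) = real (card (\<P> i)) * (\<alpha> / b)" by (simp add: q_def)
      then show ?thesis using small \<alpha> by simp
    qed
  qed
  have main: "part_entropy (\<mu> 0) (join_upto (Shift_space l L) shift_map \<P> n) \<le>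
    part_entropy (\<mu> 0) (join_upto (Shift_space l L) shift_map (cyl_part \<delta>) n) + real n * \<eta>" for n
  proof -
    define T where "T Q = {x \<in> Shift_space l L 0. \<forall>i<n. iterate shift_map i x \<in> Q i}" for Q
    define I where "I = (\<Pi>\<^sub>E i\<in>{..<n}. \<P> i)"
    define J where "J = (\<Pi>\<^sub>E i\<in>{..<n}. cyl_part \<delta> i)"
    define g where "g Q R = (\<Prod>i<n. q i (Q i) (R i))" for Q R
    have finIJ: "finite I" "finite J"
      unfolding I_def J_def using fin finite_cyl_part by (auto intro!: finite_PiE)
    have disj: "disjoint_family_on T I" "disjoint_family_on T J"
      unfolding T_def I_def J_def by (intro disjoint_family_on_join part partition_on_cyl_part)+
    have UN: "(\<Union>Q\<in>I. T Q) = Shift_space l L 0" "(\<Union>Q\<in>J. T Q) = Shift_space l L 0"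
      unfolding T_def I_def J_def
      by (rule UN_join; use part partition_on_cyl_part iterate_mem_Shift_space in blast)+
    have T_sets: "T Q \<in> sets (\<mu> 0)" if Q: "\<And>i. i < n \<Longrightarrow> Q i \<in> sets (\<mu> i)" for Q
    proof -
      have "T Q = space (\<mu> 0) \<inter> (\<Inter>i\<in>{..<n}. iterate shift_map i -` Q i \<inter> space (\<mu> 0))"
        by (auto simp: T_def space_mu)
      also have "\<dots> \<in> sets (\<mu> 0)"
      proof (cases "n = 0")
        case False
        have "iterate shift_map i -` Q i \<inter> space (\<mu> 0) \<in> sets (\<mu> 0)" if i: "i \<in> {..<n}" for i
          using measurable_sets[OF iterate_measurable] Q i by simp
        then have "(\<Inter>i\<in>{..<n}. iterate shift_map i -` Q i \<inter> space (\<mu> 0)) \<in> sets (\<mu> 0)"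
          using False by (intro sets.finite_INT) auto
        then show ?thesis by (rule sets.Int[OF sets.top])
      qed simp
      finally show ?thesis .
    qed
    have T_I: "T Q \<in> sets (\<mu> 0)" if "Q \<in> I" for Q
      using that meas by (intro T_sets) (auto simp: I_def PiE_iff)
    have T_J: "T Q \<in> sets (\<mu> 0)" if "Q \<in> J" for Q
    proof (rule T_sets)
      fix i assume "i < n"
      then have "Q i \<in> cyl_part \<delta> i" using that by (auto simp: J_def PiE_iff)
      then show "Q i \<in> sets (\<mu> i)" using cylinder_measurable[OF n_fun_ge] by (auto simp: cyl_part_def)
    qed
    have g_pos: "0 < g Q R" for Q R unfolding g_def using q_pos by (intro prod_pos) auto
    have gibbs: "part_entropy (\<mu> 0) (T ` I) \<le> part_entropy (\<mu> 0) (T ` J) +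
        (\<Sum>Q\<in>I. \<Sum>R\<in>J. measure (\<mu> 0) (T Q \<inter> T R) * (- ln (g Q R)))"
      unfolding part_entropy_image[OF finIJ(1) disj(1)] part_entropy_image[OF finIJ(2) disj(2)]
    proof (rule M.gibbs_partition)
      fix R assume R: "R \<in> J"
      \<comment> \<open>The sum runs over all choice functions, including those with empty
        \<open>T Q\<close>; this is why it factors into a product over the times.\<close>
      have "(\<Sum>Q\<in>I. g Q R) = (\<Prod>i<n. \<Sum>P\<in>\<P> i. q i P (R i))"
        unfolding g_def I_def using fin by (intro prod_sum_PiE[symmetric]) auto
      also have "\<dots> \<le> 1"
      proof (intro prod_le_1 conjI)
        fix i assume "i \<in> {..<n}"
        then show "(\<Sum>P\<in>\<P> i. q i P (R i)) \<le> 1" using q_sum R by (auto simp: J_def PiE_iff)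
      qed (intro sum_nonneg less_imp_le q_pos)
      finally show "(\<Sum>Q\<in>I. g Q R) \<le> 1" .
    qed (use finIJ disj UN T_I T_J g_pos in \<open>auto simp: space_mu intro: less_imp_le\<close>)
    define p where "p z = measure (\<mu> 0) (T (fst z) \<inter> T (snd z))" for z
    define bad where "bad i z = (if K i (fst z i) \<inter> snd z i = {} then 1 else (0::real))" for i
      and z :: "(nat \<Rightarrow> (nat \<Rightarrow> nat) set) \<times> (nat \<Rightarrow> (nat \<Rightarrow> nat) set)"
    have p0: "0 \<le> p z" for z by (simp add: p_def)
    have disj_p: "disjoint_family_on (\<lambda>z. T (fst z) \<inter> T (snd z)) (I \<times> J)"
      using disj unfolding disjoint_family_on_def by (auto simp: prod_eq_iff) blast+
    have p_sets: "(\<lambda>z. T (fst z) \<inter> T (snd z)) ` Z \<subseteq> sets (\<mu> 0)" if "Z \<subseteq> I \<times> J" for Z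
      using T_I T_J that by fastforce
    have sum_p: "(\<Sum>z\<in>Z. p z) = measure (\<mu> 0) (\<Union>z\<in>Z. T (fst z) \<inter> T (snd z))" if "Z \<subseteq> I \<times> J" for Z
      unfolding p_def
    proof (rule M.finite_measure_finite_Union[symmetric])
      show "finite Z" using that finIJ by (meson finite_SigmaI finite_subset)
    qed (use p_sets[OF that] disjoint_family_on_mono[OF that disj_p] in auto)
    have p_total: "(\<Sum>z\<in>I \<times> J. p z) \<le> 1" unfolding sum_p[OF order_refl] by (rule M.prob_le_1)
    have p_bad: "(\<Sum>z\<in>I \<times> J. p z * bad i z) \<le> b * e" if i: "i < n" for i
    proof -
      interpret Mi: prob_space "\<mu> i" by (rule prob_space_mu)
      let ?Z = "{z \<in> I \<times> J. K i (fst z i) \<inter> snd z i = {}}"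
      let ?B = "\<Union>P\<in>\<P> i. P - K i P"
      have B: "?B \<in> sets (\<mu> i)" using fin meas K_sets by (intro sets.finite_UN sets.Diff) auto
      have "(\<Sum>z\<in>I \<times> J. p z * bad i z) = (\<Sum>z\<in>?Z. p z)"
        using finIJ by (intro sum.mono_neutral_cong_right) (auto simp: bad_def split: if_splits)
      also have "\<dots> = measure (\<mu> 0) (\<Union>z\<in>?Z. T (fst z) \<inter> T (snd z))" by (rule sum_p) auto
      \<comment> \<open>If the kernel of the chosen element misses the atom at time
        \<open>i\<close>, a point in both sets is at time \<open>i\<close> in that element but
        outside its kernel. By invariance this exceptional set can be measured at time
        \<open>i\<close>.\<close>
      also have "\<dots> \<le> measure (\<mu> 0) {x \<in> Shift_space l L 0. restrict x {i..} \<in> ?B}"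
      proof (rule M.finite_measure_mono)
        show "(\<Union>z\<in>?Z. T (fst z) \<inter> T (snd z)) \<subseteq> {x \<in> Shift_space l L 0. restrict x {i..} \<in> ?B}"
        proof
          fix x assume "x \<in> (\<Union>z\<in>?Z. T (fst z) \<inter> T (snd z))"
          then obtain Q R where QR: "Q \<in> I" "K i (Q i) \<inter> R i = {}" "x \<in> T Q" "x \<in> T R" by auto
          have "restrict x {i..} \<in> Q i" "restrict x {i..} \<in> R i" "x \<in> Shift_space l L 0"
            using QR(3,4) i by (auto simp: T_def simp flip: iterate_shift_map)
          moreover have "Q i \<in> \<P> i" using QR(1) i by (auto simp: I_def PiE_iff)
          ultimately show "x \<in> {x \<in> Shift_space l L 0. restrict x {i..} \<in> ?B}" using QR(2) by blast
        qed
      qed (rule measure_iterate_vimage(2)[OF B])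
      also have "\<dots> = measure (\<mu> i) ?B" by (rule measure_iterate_vimage(1)[OF B])
      also have "\<dots> \<le> (\<Sum>P\<in>\<P> i. measure (\<mu> i) (P - K i P))"
        using fin meas K_sets by (intro Mi.finite_measure_subadditive_finite) (auto intro!: sets.Diff)
      also have "\<dots> \<le> (\<Sum>P\<in>\<P> i. e)" using K_measure by (intro sum_mono) auto
      also have "\<dots> \<le> b * e" using b(2)[of i] e(1) by (simp add: mult_right_mono)
      finally show ?thesis .
    qed
    have log_loss: "- ln (g (fst z) (snd z)) \<le> (\<Sum>i<n. \<eta> / 2 + \<Lambda> * bad i z)" for z
    proof -
      have "- ln (g (fst z) (snd z)) = (\<Sum>i<n. - ln (q i (fst z i) (snd z i)))"
        unfolding g_def by (subst ln_prod) (simp_all add: sum_negf q_ne)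
      also have "\<dots> \<le> (\<Sum>i<n. \<eta> / 2 + \<Lambda> * bad i z)"
      proof (rule sum_mono)
        fix i
        have "- ln (\<alpha> / b) = \<Lambda>" using \<alpha> b by (simp add: \<Lambda>_def ln_div)
        then show "- ln (q i (fst z i) (snd z i)) \<le> \<eta> / 2 + \<Lambda> * bad i z"
          using \<alpha>(3) \<eta> by (simp add: q_def bad_def)
      qed
      finally show ?thesis .
    qed
    have "(\<Sum>Q\<in>I. \<Sum>R\<in>J. measure (\<mu> 0) (T Q \<inter> T R) * (- ln (g Q R))) =
        (\<Sum>z\<in>I \<times> J. p z * (- ln (g (fst z) (snd z))))"
      by (simp add: sum.cartesian_product p_def case_prod_beta)
    also have "\<dots> \<le> (\<Sum>z\<in>I \<times> J. p z * (\<Sum>i<n. \<eta> / 2 + \<Lambda> * bad i z))"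
      using log_loss p0 by (intro sum_mono mult_left_mono) auto
    also have "\<dots> = (\<Sum>i<n. \<Sum>z\<in>I \<times> J. p z * (\<eta> / 2 + \<Lambda> * bad i z))"
      unfolding sum_distrib_left by (rule sum.swap)
    also have "\<dots> = (\<Sum>i<n. (\<Sum>z\<in>I \<times> J. p z) * (\<eta> / 2) + \<Lambda> * (\<Sum>z\<in>I \<times> J. p z * bad i z))"
      by (intro sum.cong refl)
        (simp add: sum_distrib_left sum_distrib_right distrib_left sum.distrib mult.left_commute)
    also have "\<dots> \<le> (\<Sum>i<n. 1 * (\<eta> / 2) + \<Lambda> * (b * e))"
      using p_total p_bad \<eta> \<Lambda> by (intro sum_mono add_mono mult_right_mono mult_left_mono) auto
    also have "\<dots> = real n * \<eta>" by (simp add: e(2))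
    finally show ?thesis
      using gibbs unfolding join_upto_image T_def[symmetric] I_def[symmetric] J_def[symmetric] by simp
  qed
  then show ?thesis using \<delta> by blast
qed

text \<open>The cylinder rates reach every value below the metric entropy. This yields both the
  limit in (i) and the comparison with topological entropy.\<close>

lemma metric_eps_approx:
  assumes "a < metric_entropy (Shift_space l L) (shift_dist l L) shift_map \<mu>"
  shows "\<exists>\<epsilon>>0. a < metric_eps \<epsilon>"
proof -
  obtain r1 where r1: "a < ereal r1" "ereal r1 < metric_entropy (Shift_space l L) (shift_dist l L) shift_map \<mu>"
    using ereal_dense2[OF assms] by blast
  obtain \<P> where adm: "admissible (Shift_space l L) (shift_dist l L) \<mu> \<P>"
    and P: "ereal r1 < limsup (\<lambda>n. ereal (part_entropy (\<mu> 0) (join_upto (Shift_space l L) shift_map \<P> n) / real n))"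
    using r1(2) unfolding metric_entropy_def less_SUP_iff by blast
  obtain r2 where r2: "ereal r1 < ereal r2"
    "ereal r2 < limsup (\<lambda>n. ereal (part_entropy (\<mu> 0) (join_upto (Shift_space l L) shift_map \<P> n) / real n))"
    using ereal_dense2[OF P] by blast
  \<comment> \<open>Two real values strictly between leave a finite positive gap, which is spent on
    the loss per unit of time.\<close>
  define \<eta> where "\<eta> = r2 - r1"
  have "0 < \<eta>" using r2(1) by (simp add: \<eta>_def)
  then obtain \<epsilon> where \<epsilon>: "0 < \<epsilon>"
    "\<And>n. part_entropy (\<mu> 0) (join_upto (Shift_space l L) shift_map \<P> n) \<le>
      part_entropy (\<mu> 0) (join_upto (Shift_space l L) shift_map (cyl_part \<epsilon>) n) + real n * \<eta>"
    using admissible_entropy_le[OF adm] by blast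
  let ?H = "\<lambda>n. part_entropy (\<mu> 0) (join_upto (Shift_space l L) shift_map (cyl_part \<epsilon>) n)"
  have "ereal r2 < limsup (\<lambda>n. ereal (?H n / real n) + ereal \<eta>)"
  proof (rule less_le_trans[OF r2(2)], intro Limsup_mono always_eventually allI)
    fix n
    have "part_entropy (\<mu> 0) (join_upto (Shift_space l L) shift_map \<P> n) / real n \<le> (?H n + real n * \<eta>) / real n"
      by (rule divide_right_mono[OF \<epsilon>(2)]) simp
    also have "\<dots> \<le> ?H n / real n + \<eta>" using \<open>0 < \<eta>\<close> by (cases "n = 0") (auto simp: field_simps)
    finally show "ereal (part_entropy (\<mu> 0) (join_upto (Shift_space l L) shift_map \<P> n) / real n)
        \<le> ereal (?H n / real n) + ereal \<eta>" by simp
  qed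
  also have "\<dots> = metric_eps \<epsilon> + ereal \<eta>"
    unfolding metric_eps_eq_join[OF \<epsilon>(1)] by (intro Limsup_add_ereal_right) auto
  finally have "ereal r1 < metric_eps \<epsilon>"
    by (cases "metric_eps \<epsilon>") (auto simp: \<eta>_def)
  then show ?thesis using r1(1) \<epsilon>(1) less_trans by blast
qed

text \<open>The rates grow as \<epsilon> decreases, so a value exceeded once is exceeded for all
  smaller \<epsilon>, and the limit at 0 is the supremum.\<close>

lemma metric_eps_tendsto:
  "(metric_eps \<longlongrightarrow> metric_entropy (Shift_space l L) (shift_dist l L) shift_map \<mu>) (at_right 0)"
proof (rule order_tendstoI)
  fix a assume "a < metric_entropy (Shift_space l L) (shift_dist l L) shift_map \<mu>"
  then obtain \<epsilon> where \<epsilon>: "0 < \<epsilon>" "a < metric_eps \<epsilon>" using metric_eps_approx by blast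
  have "a < metric_eps x" if "0 < x" "x < \<epsilon>" for x
    using metric_eps_antimono[of x \<epsilon>] that \<epsilon>(2) by (simp add: less_le_trans)
  then show "eventually (\<lambda>x. a < metric_eps x) (at_right 0)"
    unfolding eventually_at_right_field using \<epsilon>(1) by blast
next
  fix a assume a: "metric_entropy (Shift_space l L) (shift_dist l L) shift_map \<mu> < a"
  have "metric_eps x < a" if "0 < x" for x
    using metric_eps_le_metric_entropy[OF that] a by (rule le_less_trans)
  then show "eventually (\<lambda>x. metric_eps x < a) (at_right 0)"
    by (simp add: eventually_at_filter)
qed

text \<open>At each scale the entropy of the window join is at most the logarithm of its number of
  atoms, so the rates compare scale by scale.\<close>

lemma metric_entropy_le_top_entropy:
  "metric_entropy (Shift_space l L) (shift_dist l L) shift_map \<mu> \<le>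
    top_entropy (Shift_space l L) (shift_dist l L) shift_map"
proof (rule ccontr)
  assume "\<not> ?thesis"
  then obtain \<epsilon> where "0 < \<epsilon>" "top_entropy (Shift_space l L) (shift_dist l L) shift_map < metric_eps \<epsilon>"
    using metric_eps_approx by (meson not_le)
  then show False
    using metric_eps_le_top_eps[of \<epsilon>] top_eps_le_top_entropy[of \<epsilon>] by (meson leD order_trans)
qed

section \<open>Equality of the entropies\<close>

text \<open>The condition of (ii) for a single time and a single letter.\<close>

definition dominating :: "real \<Rightarrow> real \<Rightarrow> nat \<Rightarrow> nat \<Rightarrow> bool" where
  "dominating \<delta> \<epsilon> k \<gamma> \<longleftrightarrow> (\<exists>B\<subseteq>alph l (n_fun l L k \<epsilon>).
     (\<forall>\<beta>\<in>B. Lprod l L k (n_fun l L k \<epsilon>) \<gamma> \<beta> \<ge> 1) \<and>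
     (\<Sum>\<beta>\<in>B. \<pi> (n_fun l L k \<epsilon>) \<beta>) \<ge> 1 - \<delta>)"

text \<open>The largest column sum is at least the word count divided by the number of letters, and
  it is passed on to every letter of \<open>B\<close>. The \<pi>-mass of \<open>B\<close> is the
  factor 1 - \<delta>.\<close>

lemma ln_nwords_le_pi_col_sum:
  assumes \<delta>: "\<delta> < 1" and \<gamma>: "\<gamma> \<in> alph l N" "maximizes_col_sum l L N \<gamma>" and dom: "dominating \<delta> \<epsilon> N \<gamma>"
  shows "(1 - \<delta>) * (ln (real (nwords l L 0 N)) - ln (real alph_bound)) \<le> pi_col_sum (n_fun l L N \<epsilon>)"
proof -
  let ?n = "n_fun l L N \<epsilon>"
  obtain B where B: "B \<subseteq> alph l ?n" "\<And>\<beta>. \<beta> \<in> B \<Longrightarrow> Lprod l L N ?n \<gamma> \<beta> \<ge> 1"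
    "(\<Sum>\<beta>\<in>B. \<pi> ?n \<beta>) \<ge> 1 - \<delta>" using dom by (auto simp: dominating_def)
  have c1: "1 \<le> col_sum l L N \<gamma>" by (rule col_sum_pos[OF \<gamma>(1)])
  have ab: "0 < real alph_bound" using alph_bound(1) by simp
  have w0: "0 < real (nwords l L 0 N)" using nwords_pos[of 0 N] by simp
  have "nwords l L 0 N = (\<Sum>\<beta>\<in>alph l N. col_sum l L N \<beta>)" by (rule sum_col_sum[symmetric])
  also have "\<dots> \<le> (\<Sum>\<beta>\<in>alph l N. col_sum l L N \<gamma>)"
    using \<gamma>(2) unfolding maximizes_col_sum_def by (intro sum_mono) auto
  also have "\<dots> \<le> alph_bound * col_sum l L N \<gamma>" using alph_bound(2)[of N] by simp
  finally have "real (nwords l L 0 N) \<le> real alph_bound * real (col_sum l L N \<gamma>)"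
    by (metis of_nat_le_iff of_nat_mult)
  then have "ln (real (nwords l L 0 N)) \<le> ln (real alph_bound * real (col_sum l L N \<gamma>))"
    using w0 by (intro ln_mono) auto
  then have "ln (real (nwords l L 0 N)) - ln (real alph_bound) \<le> ln (real (col_sum l L N \<gamma>))"
    using ab c1 by (simp add: ln_mult)
  then have "(1 - \<delta>) * (ln (real (nwords l L 0 N)) - ln (real alph_bound)) \<le>
      (1 - \<delta>) * ln (real (col_sum l L N \<gamma>))"
    using \<delta> by (intro mult_left_mono) auto
  also have "\<dots> \<le> (\<Sum>\<beta>\<in>B. \<pi> ?n \<beta>) * ln (real (col_sum l L N \<gamma>))"
    using B(3) c1 by (intro mult_right_mono) auto
  also have "\<dots> \<le> (\<Sum>\<beta>\<in>B. \<pi> ?n \<beta> * ln (real (col_sum l L ?n \<beta>)))"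
    unfolding sum_distrib_right
  proof (intro sum_mono mult_left_mono)
    fix \<beta> assume \<beta>: "\<beta> \<in> B"
    then have "col_sum l L N \<gamma> \<le> col_sum l L ?n \<beta>"
      using B \<gamma>(1) by (intro col_sum_le_col_sum[OF n_fun_ge]) auto
    then show "ln (real (col_sum l L N \<gamma>)) \<le> ln (real (col_sum l L ?n \<beta>))"
      using c1 by (intro ln_mono) auto
    show "0 \<le> \<pi> ?n \<beta>" using \<beta> B(1) pi_pos by (auto intro: less_imp_le)
  qed
  also have "\<dots> \<le> pi_col_sum ?n"
    unfolding pi_col_sum_def
  \<comment> \<open>Letters outside \<open>B\<close> may be added because column sums are at least
    1, so their logarithms are nonnegative.\<close>
  proof (rule sum_mono2)
    fix \<beta> assume "\<beta> \<in> alph l ?n - B"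
    then have "0 \<le> \<pi> ?n \<beta>" "1 \<le> col_sum l L ?n \<beta>"
      using pi_pos col_sum_pos by (auto intro: less_imp_le)
    then show "0 \<le> \<pi> ?n \<beta> * ln (real (col_sum l L ?n \<beta>))" by simp
  qed (use B(1) in auto)
  finally show ?thesis .
qed

text \<open>The maximum \<open>N\<close> is the end of the window of some \<open>i \<le> k\<close>.
  Appending the \<epsilon>'-window of \<open>N\<close> gives at most \<open>C\<close> words from
  time \<open>i\<close> on, where \<open>C\<close> multiplies the two window bounds. At scale 1 / C
  the window of \<open>i\<close> must therefore reach at least as far, and \<open>C\<close> does not
  depend on \<open>k\<close>.\<close>

lemma n_fun_ntilde_le:
  assumes "0 < \<epsilon>" "0 < \<epsilon>'"
  shows "\<exists>\<epsilon>''>0. \<forall>k. n_fun l L (ntilde_fun l L k \<epsilon>) \<epsilon>' \<le> ntilde_fun l L k \<epsilon>''"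
proof -
  define C where "C = (1 + 1 / \<epsilon>) * real alph_bound * ((1 + 1 / \<epsilon>') * real alph_bound)"
  have C: "0 < C" unfolding C_def
    using assms alph_bound(1) by (intro mult_pos_pos add_pos_pos) auto
  have "n_fun l L (ntilde_fun l L k \<epsilon>) \<epsilon>' \<le> ntilde_fun l L k (1 / C)" for k
  proof -
    let ?N = "ntilde_fun l L k \<epsilon>"
    let ?n = "n_fun l L ?N \<epsilon>'"
    obtain i where i: "i \<le> k" "?N = n_fun l L i \<epsilon>" using ntilde_attained by blast
    have iN: "i \<le> ?N" unfolding i(2) by (rule n_fun_ge)
    have "real (nwords l L i ?n) \<le> real (nwords l L i ?N) * real (nwords l L ?N ?n)"
      using nwords_submult[OF iN n_fun_ge] by (metis of_nat_le_iff of_nat_mult)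
    also have "\<dots> \<le> C" unfolding C_def
      using nwords_n_fun_le[OF assms(1), of i] nwords_n_fun_le[OF assms(2), of ?N] assms i(2)
      by (intro mult_mono) auto
    finally have le: "real (nwords l L i ?n) \<le> C" .
    have "?n \<le> n_fun l L i (1 / C)"
    proof (rule ccontr)
      assume "\<not> ?thesis"
      then have "nwords l L i (n_fun l L i (1 / C)) \<le> nwords l L i ?n"
        by (intro nwords_mono n_fun_ge) simp
      then show False using nwords_n_fun[of "1 / C" i] le by simp
    qed
    also have "\<dots> \<le> ntilde_fun l L k (1 / C)" by (rule n_fun_le_ntilde[OF i(1)])
    finally show ?thesis .
  qed
  then show ?thesis using C by (intro exI[of _ "1 / C"]) simp
qed

lemma top_eps_le_metric_entropy:
  assumes \<delta>: "0 < \<delta>" "\<delta> < 1" and \<epsilon>: "0 < \<epsilon>" "0 < \<epsilon>'"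
    and dom: "\<And>k \<gamma>. k\<^sub>0 \<le> k \<Longrightarrow> \<gamma> \<in> alph l k \<Longrightarrow> maximizes_col_sum l L k \<gamma> \<Longrightarrow> dominating \<delta> \<epsilon>' k \<gamma>"
  shows "ereal (1 - \<delta>) * top_eps \<epsilon> \<le> metric_entropy (Shift_space l L) (shift_dist l L) shift_map \<mu>"
proof -
  obtain D where D: "\<And>n. \<bar>cyl_entropy n - pi_col_sum n\<bar> \<le> D" using cyl_entropy_pi_col_sum by blast
  obtain \<epsilon>'' where \<epsilon>'': "0 < \<epsilon>''" "\<And>k. n_fun l L (ntilde_fun l L k \<epsilon>) \<epsilon>' \<le> ntilde_fun l L k \<epsilon>''"
    using n_fun_ntilde_le[OF \<epsilon>] by blast
  let ?u = "\<lambda>k. (1 - \<delta>) * ln (real (nwords l L 0 (ntilde_fun l L k \<epsilon>)))"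
  let ?v = "\<lambda>k. cyl_entropy (ntilde_fun l L k \<epsilon>'')"
  let ?E = "D + (1 - \<delta>) * ln (real alph_bound)"
  have bound: "?u k \<le> ?v k + ?E" if k: "k\<^sub>0 \<le> k" for k
  proof -
    let ?N = "ntilde_fun l L k \<epsilon>"
    have "Max (col_sum l L ?N ` alph l ?N) \<in> col_sum l L ?N ` alph l ?N"
      using alph_nonempty by (intro Max_in) auto
    then obtain \<gamma> where \<gamma>: "\<gamma> \<in> alph l ?N" "maximizes_col_sum l L ?N \<gamma>"
      unfolding maximizes_col_sum_def by (metis imageE)
    have "dominating \<delta> \<epsilon>' ?N \<gamma>"
      using dom[OF _ \<gamma>] k ntilde_ge[of k \<epsilon>] by simp
    then have "(1 - \<delta>) * (ln (real (nwords l L 0 ?N)) - ln (real alph_bound)) \<le> pi_col_sum (n_fun l L ?N \<epsilon>')"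
      by (rule ln_nwords_le_pi_col_sum[OF \<delta>(2) \<gamma>])
    also have "\<dots> \<le> cyl_entropy (n_fun l L ?N \<epsilon>') + D" using D[of "n_fun l L ?N \<epsilon>'"] by linarith
    \<comment> \<open>The later time is reached through the cylinder entropy, for which monotonicity
      is known; the exchange with the \<pi>-average costs \<open>D\<close>.\<close>
    also have "\<dots> \<le> ?v k + D" using cyl_entropy_mono[OF \<epsilon>''(2)] by simp
    finally show ?thesis by (simp add: algebra_simps)
  qed
  have "ereal (1 - \<delta>) * top_eps \<epsilon> = limsup (\<lambda>k. ereal (?u k / real k))"
    unfolding top_eps_def using \<delta> by (subst limsup_ereal_mult_left[symmetric]) auto
  \<comment> \<open>The bound holds only from \<open>k\<^sub>0\<close> on, so the index is shifted
    for the comparison and shifted back afterwards.\<close>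
  also have "\<dots> = limsup (\<lambda>k. ereal (?u (k + k\<^sub>0) / real (k + k\<^sub>0)))"
    by (rule limsup_shift_k[where u = "\<lambda>k. ereal (?u k / real k)", symmetric])
  also have "\<dots> \<le> limsup (\<lambda>k. ereal ((?v (k + k\<^sub>0) + ?E) / real (k + k\<^sub>0)))"
    using bound by (intro Limsup_mono always_eventually allI) (simp add: divide_right_mono)
  also have "\<dots> = limsup (\<lambda>k. ereal ((?v k + ?E) / real k))"
    by (rule limsup_shift_k[where u = "\<lambda>k. ereal ((?v k + ?E) / real k)"])
  also have "\<dots> \<le> metric_eps \<epsilon>''"
    unfolding metric_eps_def by (rule limsup_le_add_bounded) (rule order_refl)
  also have "\<dots> \<le> metric_entropy (Shift_space l L) (shift_dist l L) shift_map \<mu>"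
    by (rule metric_eps_le_metric_entropy[OF \<epsilon>''(1)])
  finally show ?thesis .
qed

lemma metric_eps_nonneg: "0 \<le> metric_eps \<epsilon>"
  unfolding metric_eps_def
  by (rule le_Limsup) (auto intro!: always_eventually divide_nonneg_nonneg cyl_entropy_nonneg)

lemma metric_entropy_eq_top_entropy:
  assumes "\<forall>\<delta>\<in>{0<..<1}. \<exists>\<epsilon>>0. \<exists>k\<^sub>0. \<forall>k\<ge>k\<^sub>0. \<forall>\<gamma>\<in>alph l k. maximizes_col_sum l L k \<gamma> \<longrightarrow> dominating \<delta> \<epsilon> k \<gamma>"
  shows "metric_entropy (Shift_space l L) (shift_dist l L) shift_map \<mu> =
    top_entropy (Shift_space l L) (shift_dist l L) shift_map"
proof (rule antisym[OF metric_entropy_le_top_entropy top_entropy_le])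
  fix \<epsilon> :: real assume \<epsilon>: "0 < \<epsilon>"
  let ?h = "metric_entropy (Shift_space l L) (shift_dist l L) shift_map \<mu>"
  show "top_eps \<epsilon> \<le> ?h"
  \<comment> \<open>The factor \<open>z\<close> below 1 plays the part of 1 - \<delta>; letting it
    tend to 1 is valid for infinite values too.\<close>
  proof (rule ereal_le_mult_one_interval)
    have "0 \<le> ?h" using metric_eps_nonneg metric_eps_le_metric_entropy[OF \<epsilon>] by (rule order_trans)
    then show "?h \<noteq> - \<infinity>" by auto
  next
    fix z :: ereal assume z: "0 < z" "z < 1"
    then obtain r where r: "z = ereal r" "0 < r" "r < 1" by (cases z) auto
    then have "1 - r \<in> {0<..<1}" by simp
    then obtain \<epsilon>' k\<^sub>0 where "0 < \<epsilon>'"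
      "\<forall>k\<ge>k\<^sub>0. \<forall>\<gamma>\<in>alph l k. maximizes_col_sum l L k \<gamma> \<longrightarrow> dominating (1 - r) \<epsilon>' k \<gamma>"
      using assms by meson
    then have "ereal (1 - (1 - r)) * top_eps \<epsilon> \<le> ?h"
      using r \<epsilon> by (intro top_eps_le_metric_entropy[where \<epsilon>' = \<epsilon>' and k\<^sub>0 = k\<^sub>0]) auto
    then show "z * top_eps \<epsilon> \<le> ?h" by (simp add: r(1))
  qed
qed

end

theorem theorem4p14:
  fixes l :: "nat \<Rightarrow> nat"
    and L :: "nat \<Rightarrow> nat \<Rightarrow> nat \<Rightarrow> nat"
    and wh vh :: "nat \<Rightarrow> nat \<Rightarrow> real"
    and \<mu> :: "nat \<Rightarrow> (nat \<Rightarrow> nat) measure"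
  assumes "nsft l L"
    and "infinite (Shift_space l L 0)"
    and "parry_ims l L wh vh \<mu>"
  shows "((\<lambda>\<epsilon>. limsup (\<lambda>k. ereal (1 / real k *
             (\<Sum>\<beta>\<in>alph l (ntilde_fun l L k \<epsilon>).
                parry_pi l wh vh (ntilde_fun l L k \<epsilon>) \<beta> *
                ln (real (\<Sum>\<alpha>\<in>alph l 0. Lprod l L 0 (ntilde_fun l L k \<epsilon>) \<alpha> \<beta>))))))
           \<longlongrightarrow> metric_entropy (Shift_space l L) (shift_dist l L) shift_map \<mu>) (at_right 0)
    \<and> ((\<forall>\<delta>\<in>{0<..<1}. \<exists>\<epsilon>>0. \<exists>k\<^sub>0. \<forall>k\<ge>k\<^sub>0. \<forall>\<gamma>\<in>alph l k. maximizes_col_sum l L k \<gamma> \<longrightarrow>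
           (\<exists>B\<subseteq>alph l (n_fun l L k \<epsilon>).
              (\<forall>\<beta>\<in>B. Lprod l L k (n_fun l L k \<epsilon>) \<gamma> \<beta> \<ge> 1) \<and>
              (\<Sum>\<beta>\<in>B. parry_pi l wh vh (n_fun l L k \<epsilon>) \<beta>) \<ge> 1 - \<delta>))
        \<longrightarrow> metric_entropy (Shift_space l L) (shift_dist l L) shift_map \<mu> =
             top_entropy (Shift_space l L) (shift_dist l L) shift_map)"
proof -
  interpret parry_shift l L wh vh \<mu>
    by unfold_locales (rule assms)+
  have "(\<lambda>\<epsilon>. limsup (\<lambda>k. ereal (1 / real k *
             (\<Sum>\<beta>\<in>alph l (ntilde_fun l L k \<epsilon>).
                parry_pi l wh vh (ntilde_fun l L k \<epsilon>) \<beta> *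
                ln (real (\<Sum>\<alpha>\<in>alph l 0. Lprod l L 0 (ntilde_fun l L k \<epsilon>) \<alpha> \<beta>)))))) = metric_eps"
    unfolding metric_eps_eq_pi_col_sum[abs_def] pi_col_sum_def col_sum_def by simp
  then show ?thesis
    using metric_eps_tendsto metric_entropy_eq_top_entropy unfolding dominating_def by simp
qed

end
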